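(* Consider the single-queue vacation model with retrials and glue periods described in the context. If $\rho=\lambda\,\mathbb{E}[B]<1$, then the generating function $X(z)=\mathbb{E}[z^X]$, $|z|\le 1$, of the steady-state number $X$ of customers in the system at the start of a glue period is given by $$X(z)=\prod_{j=0}^{\infty}K\bigl(f^{(j)}(z)\bigr),$$ where, with $\beta(z)=\tilde B(\lambda(1-z))$ and $\sigma(z)=\tilde S(\lambda(1-z))$, $$f(z)=(1-e^{-\nu G})\beta(z)+e^{-\nu G}z,\qquad K(z)=\sigma(z)\,e^{-\lambda(1-\beta(z))G},$$ and $f^{(0)}(z)=z$, $f^{(j)}(z)=f(f^{(j-1)}(z))$ for $j\ge1$.
   Context: Model. Customers arrive at a single queue $Q$ according to a Poisson process with rate $\lambda>0$. Service times are i.i.d., distributed as a generic nonnegative random variable $B$ with $0<\mathbb{E}[B]<\infty$ and Laplace-Stieltjes transform (LST) $\tilde B(s)=\mathbb{E}[e^{-sB}]$. The single server cyclically goes through: a glue period of deterministic length $G>0$, then a visit period, then a vacation. Vacation lengths are i.i.d., distributed as a generic nonnegative random variable $S$ with $\mathbb{E}[S]<\infty$ and LST $\tilde S(s)=\mathbb{E}[e^{-sS}]$. Arrivals, service times, vacation lengths and retrial times are all independent. Customers (new arrivals and retrials) who arrive at $Q$ during a glue period stick, i.e. join the queue. Customers who arrive in any other period (visit or vacation) immediately leave to the orbit and retry after an exponentially distributed time with rate $\nu>0$, independent of everything else; each further unsuccessful retrial is again followed by an independent exponential($\nu$) retrial interval. Service is gated: during a visit period the server serves exactly those customers who are in the queue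 at the end of the preceding glue period (none of those in orbit and no new arrivals); the vacation then begins. $X_n$ is the number of customers in the system (hence all in orbit) at the start of the $n$th glue period. $X$ denotes a random variable whose distribution is the limiting (steady-state) distribution of $X_n$ as $n\to\infty$. *)

theory Defs
  imports "HOL-Probability.Probability"
begin

subsection \<open>Sample-path dynamics\<close>

text \<open>
  The dynamics are deterministic functions of the following data:
  \<^item> \<open>x0\<close>: number of customers in orbit at time 0, when the first glue period starts;
  \<^item> \<open>A i\<close>: interarrival times (\<open>A 0\<close> is the time until the first arrival);
  \<^item> \<open>B k\<close>: service time of customer \<open>k\<close>;
  \<^item> \<open>V n\<close>: length of the vacation that ends the \<open>n\<close>-th cycle;
  \<^item> \<open>R k i\<close>: the \<open>i\<close>-th retrial interval of customer \<open>k\<close>.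

  Customers \<open>k < x0\<close> are those initially in orbit; customer \<open>x0 + j\<close> is the \<open>j\<close>-th arrival
  (counted from 0). All indices, including those of cycles, start at 0.
\<close>

text \<open>Subtraction is truncated, so the value is 0 for the initial customers.\<close>

definition arrival_time :: "nat \<Rightarrow> (nat \<Rightarrow> real) \<Rightarrow> nat \<Rightarrow> real" where
  "arrival_time x0 A k = (\<Sum>i<Suc k - x0. A i)"

text \<open>
  The epochs at which customer \<open>k\<close> would turn up at the queue if it never stuck: its arrival
  (absent for the initial customers, who are already in orbit) and all its retrials. Only the
  epochs up to and including the first one that falls in a glue period have any effect.
\<close>

definition attempts :: "nat \<Rightarrow> (nat \<Rightarrow> real) \<Rightarrow> (nat \<Rightarrow> nat \<Rightarrow> real) \<Rightarrow> nat \<Rightarrow> real set" where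
  "attempts x0 A R k =
     {arrival_time x0 A k + (\<Sum>i<m. R k i) | m. x0 \<le> k \<or> 0 < m}"

text \<open>
  \<open>glue_state \<dots> n\<close> consists of the starting time of glue period \<open>n\<close> and the set of customers
  that have been served before that time. The customers in the queue at the end of the glue
  period \<open>{t..<t + G}\<close> are those not yet served with an attempt in it; the visit lasts for the
  sum of their service times.
\<close>

primrec glue_state ::
  "real \<Rightarrow> nat \<Rightarrow> (nat \<Rightarrow> real) \<Rightarrow> (nat \<Rightarrow> real) \<Rightarrow> (nat \<Rightarrow> real) \<Rightarrow> (nat \<Rightarrow> nat \<Rightarrow> real)
    \<Rightarrow> nat \<Rightarrow> real \<times> nat set" where
  "glue_state G x0 A B V R 0 = (0, {})"
| "glue_state G x0 A B V R (Suc n) =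
     (let (t, D) = glue_state G x0 A B V R n;
          Q = {k. k \<notin> D \<and> attempts x0 A R k \<inter> {t..<t + G} \<noteq> {}}
      in (t + G + (\<Sum>k\<in>Q. B k) + V n, D \<union> Q))"

definition number_at_glue ::
  "real \<Rightarrow> nat \<Rightarrow> (nat \<Rightarrow> real) \<Rightarrow> (nat \<Rightarrow> real) \<Rightarrow> (nat \<Rightarrow> real) \<Rightarrow> (nat \<Rightarrow> nat \<Rightarrow> real)
    \<Rightarrow> nat \<Rightarrow> nat" where
  "number_at_glue G x0 A B V R n =
     (let (t, D) = glue_state G x0 A B V R n
      in card {k. k \<notin> D \<and> (k < x0 \<or> arrival_time x0 A k < t)})"


subsection \<open>The stochastic model\<close>

datatype random_source =
  Initial | Interarrival nat | Service nat | Vacation nat | Retrial nat nat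

text \<open>
  \<open>FB\<close> and \<open>FS\<close> are the laws of the generic service time and vacation length; that they are
  probability measures on the Borel sets follows from the \<open>distr\<close> assumptions. The initial
  number of customers is an arbitrary random variable, independent of everything else.
\<close>

locale glue_retrial_queue = prob_space M
  for M :: "'a measure" +
  fixes lam \<nu> G :: real
    and FB FS :: "real measure"
    and X0 :: "'a \<Rightarrow> nat"
    and A B V :: "nat \<Rightarrow> 'a \<Rightarrow> real"
    and R :: "nat \<Rightarrow> nat \<Rightarrow> 'a \<Rightarrow> real"
  assumes lam_pos: "0 < lam" and nu_pos: "0 < \<nu>" and G_pos: "0 < G"
    and FB_nonneg: "AE b in FB. 0 \<le> b"
    and FB_integrable: "integrable FB (\<lambda>b. b)"
    and FB_mean_pos: "0 < (LINT b|FB. b)"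
    and FS_nonneg: "AE s in FS. 0 \<le> s"
    and FS_integrable: "integrable FS (\<lambda>s. s)"
    and indep: "indep_vars (\<lambda>_. borel) (case_random_source (\<lambda>\<omega>. real (X0 \<omega>)) A B V R) UNIV"
    and A_distr: "\<And>i. distributed M lborel (A i) (exponential_density lam)"
    and B_distr: "\<And>k. distr M borel (B k) = FB"
    and V_distr: "\<And>n. distr M borel (V n) = FS"
    and R_distr: "\<And>k i. distributed M lborel (R k i) (exponential_density \<nu>)"

definition X_glue ::
  "real \<Rightarrow> ('a \<Rightarrow> nat) \<Rightarrow> (nat \<Rightarrow> 'a \<Rightarrow> real) \<Rightarrow> (nat \<Rightarrow> 'a \<Rightarrow> real) \<Rightarrow> (nat \<Rightarrow> 'a \<Rightarrow> real)
    \<Rightarrow> (nat \<Rightarrow> nat \<Rightarrow> 'a \<Rightarrow> real) \<Rightarrow> nat \<Rightarrow> 'a \<Rightarrow> nat" where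
  "X_glue G X0 A B V R n \<omega> =
     number_at_glue G (X0 \<omega>) (\<lambda>i. A i \<omega>) (\<lambda>k. B k \<omega>) (\<lambda>j. V j \<omega>) (\<lambda>k i. R k i \<omega>) n"

definition limiting_distribution :: "'a measure \<Rightarrow> (nat \<Rightarrow> 'a \<Rightarrow> nat) \<Rightarrow> nat pmf \<Rightarrow> bool" where
  "limiting_distribution M X p \<longleftrightarrow>
     (\<forall>k. (\<lambda>n. measure M {\<omega> \<in> space M. X n \<omega> = k}) \<longlonglongrightarrow> pmf p k)"


subsection \<open>Transforms\<close>

definition LST :: "real measure \<Rightarrow> complex \<Rightarrow> complex" where
  "LST F s = (LINT x|F. exp (- (s * complex_of_real x)))"

definition beta_gf :: "real \<Rightarrow> real measure \<Rightarrow> complex \<Rightarrow> complex" where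
  "beta_gf lam FB z = LST FB (of_real lam * (1 - z))"

definition sigma_gf :: "real \<Rightarrow> real measure \<Rightarrow> complex \<Rightarrow> complex" where
  "sigma_gf lam FS z = LST FS (of_real lam * (1 - z))"

definition f_gf :: "real \<Rightarrow> real \<Rightarrow> real \<Rightarrow> real measure \<Rightarrow> complex \<Rightarrow> complex" where
  "f_gf lam \<nu> G FB z =
     of_real (1 - exp (- \<nu> * G)) * beta_gf lam FB z + of_real (exp (- \<nu> * G)) * z"

definition K_gf :: "real \<Rightarrow> real \<Rightarrow> real measure \<Rightarrow> real measure \<Rightarrow> complex \<Rightarrow> complex" where
  "K_gf lam G FB FS z =
     sigma_gf lam FS z * exp (- (of_real lam * (1 - beta_gf lam FB z) * of_real G))"

end

theory Submission
  imports Defs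
begin

text \<open>
  The numbers \<open>X\<^sub>n\<close> form a branching process with immigration. Suppose that a glue period starts
  with \<open>x\<close> customers in orbit. Each of them retries within the period with probability
  \<open>1 - exp (- \<nu> G)\<close>, independently of the others; if it does, it is served and replaced by
  the customers that arrive during its service, whose number has generating function
  \<open>\<beta>\<close>; if not, it stays. Hence it contributes a factor \<open>f z\<close>. The new arrivals of
  the glue period are Poisson with mean \<open>lam G\<close> and are all replaced in the same way, and the
  vacation adds the arrivals during it; together this is the factor \<open>K z\<close>. Thus
  \<open>E (z ^ X\<^sub>n\<^sub>+\<^sub>1 | X\<^sub>n) = K z * f z ^ X\<^sub>n\<close> (\<open>pgf_chain_step\<close>), and iteration gives the finite
  products (\<open>pgf_chain\<close>). The derivative of \<open>f\<close> at 1 is below 1 exactly when the load is,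
  so that the iterates of \<open>f\<close> tend to 1 geometrically on the closed unit disc. The product then
  converges absolutely, the initial number is forgotten, and since the limit is continuous at 1, a
  continuity theorem for generating functions (\<open>pgf_continuity\<close>) gives a limiting distribution.

  Most of the work is to extract the Markov property from sample paths that are functions of fixed
  sequences of interarrival, service, vacation and retrial times. The path is cut at the end of the
  first cycle, and the rest is again a path of the same kind, driven by the residual interarrival
  and retrial sequences (\<open>orbit_size_Suc\<close>). Customers keep their numbers at the cut; what changes is
  only the set \<open>D\<close> of customers already served and the number \<open>c\<close> of customers that have arrived.
  Therefore both are parameters of the generalised path \<open>run\<close>. A residual exponential renewal
  sequence is independent of the number of renewals so far and has the original law
  (\<open>nn_integral_renewal\<close>). So the residual retrial times, then the residual arrivals, and finally
  the unused service times can be replaced by fresh ones, which yields a recursion for the law of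
  the number in orbit (\<open>orbit_prob_Suc\<close>). The solution of this recursion is a Markov chain
  (\<open>orbit_prob_eq_chain\<close>).
\<close>

section \<open>Renewal sequences with exponential steps\<close>

text \<open>
  If step \<open>i\<close> of a renewal process ends at time \<open>sum u {..i}\<close>, this is the number of renewals
  before time \<open>t\<close>. It is meaningful only if the partial sums reach \<open>t\<close>.
\<close>

definition passage :: "real \<Rightarrow> (nat \<Rightarrow> real) \<Rightarrow> nat" where
  "passage t u = (LEAST m. t \<le> sum u {..m})"

text \<open>
  The renewal sequence as an observer sees it who arrives at time \<open>t\<close> during step \<open>m\<close>: what is left
  of this step, followed by the later steps.
\<close>

definition residual_at :: "nat \<Rightarrow> real \<Rightarrow> (nat \<Rightarrow> real) \<Rightarrow> nat \<Rightarrow> real" where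
  "residual_at m t u i = (if i = 0 then sum u {..m} - t else u (m + i))"

definition residual :: "real \<Rightarrow> (nat \<Rightarrow> real) \<Rightarrow> nat \<Rightarrow> real" where
  "residual t u = residual_at (passage t u) t u"

text \<open>
  On paths whose partial sums reach \<open>t\<close> this says \<open>passage t u = m\<close>. In contrast to \<open>passage\<close>, it can
  be decomposed along the first step on every path, which is what allows an induction on \<open>m\<close>
  before it is known that almost all paths are of this kind.
\<close>

definition crosses_at :: "nat \<Rightarrow> real \<Rightarrow> (nat \<Rightarrow> real) \<Rightarrow> bool" where
  "crosses_at m t u \<longleftrightarrow> (\<forall>j<m. sum u {..j} < t) \<and> t \<le> sum u {..m}"

definition renewing :: "(nat \<Rightarrow> real) \<Rightarrow> bool" where
  "renewing u \<longleftrightarrow> (\<forall>i. 0 \<le> u i) \<and> (\<forall>t. \<exists>m. t \<le> sum u {..m})"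

text \<open>
  The Poisson weights. The mean 0, which \<open>poisson_pmf\<close> excludes, is needed here: a visit
  and vacation may have total length 0.
\<close>

definition pois :: "real \<Rightarrow> nat \<Rightarrow> real" where
  "pois x m = exp (- x) * x ^ m / fact m"

abbreviation expm :: "real \<Rightarrow> real measure" where
  "expm r \<equiv> density lborel (exponential_density r)"

abbreviation iid :: "'b measure \<Rightarrow> (nat \<Rightarrow> 'b) measure" where
  "iid N \<equiv> PiM UNIV (\<lambda>_. N)"

lemma crosses_at_passage: "crosses_at m t u \<Longrightarrow> passage t u = m"
  unfolding passage_def crosses_at_def
  by (rule Least_equality) (auto simp: leD intro: leI)

lemma passage_crosses:
  assumes "\<exists>m. t \<le> sum u {..m}" shows "crosses_at (passage t u) t u"
  using LeastI_ex[OF assms] not_less_Least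
  unfolding passage_def crosses_at_def by (metis (mono_tags, lifting) not_le_imp_less)

lemma crosses_at_iff: "renewing u \<Longrightarrow> crosses_at m t u \<longleftrightarrow> passage t u = m"
  using crosses_at_passage passage_crosses unfolding renewing_def by metis

lemma sum_residual_at: "sum (residual_at m t u) {..i} = sum u {..m+i} - t"
  by (induction i) (auto simp: residual_at_def)

lemma sum_residual: "sum (residual t u) {..i} = sum u {..passage t u + i} - t"
  by (simp add: residual_def sum_residual_at)

lemma sum_case_nat: "sum (case_nat x u) {..Suc m} = (x::real) + sum u {..m}"
  by (simp add: sum.atMost_Suc_shift del: sum.atMost_Suc)

lemma crosses_at_0_case_nat: "crosses_at 0 t (case_nat x u) \<longleftrightarrow> t \<le> x"
  by (simp add: crosses_at_def)

lemma crosses_at_Suc_case_nat: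
  "crosses_at (Suc m) t (case_nat x u) \<longleftrightarrow> x < t \<and> crosses_at m (t - x) u"
  unfolding crosses_at_def sum_case_nat All_less_Suc2
  by (auto simp: sum_case_nat)

lemma residual_at_0_case_nat: "residual_at 0 t (case_nat x u) = case_nat (x - t) u"
  by (auto simp: residual_at_def fun_eq_iff split: nat.split)

lemma residual_at_Suc_case_nat: "residual_at (Suc m) t (case_nat x u) = residual_at m (t - x) u"
  by (auto simp: residual_at_def fun_eq_iff sum_case_nat simp del: sum.atMost_Suc)

lemma pois_nonneg: "0 \<le> x \<Longrightarrow> 0 \<le> pois x m"
  by (simp add: pois_def)

lemma pois_measurable [measurable (raw)]:
  assumes [measurable]: "f \<in> borel_measurable N"
  shows "(\<lambda>x. pois (f x) m) \<in> borel_measurable N"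
  unfolding pois_def by measurable

lemma pois_sums: "pois x sums 1"
proof -
  have "(\<lambda>m. exp (-x) * (x ^ m /\<^sub>R fact m)) sums (exp (-x) * exp x)"
    by (intro sums_mult exp_converges)
  moreover have "(\<lambda>m. exp (-x) * (x ^ m /\<^sub>R fact m)) = pois x"
    by (simp add: pois_def fun_eq_iff divide_inverse_commute)
  moreover have "exp (-x) * exp x = 1"
    by (simp add: mult_exp_exp)
  ultimately show ?thesis by simp
qed

lemma suminf_pois: "0 \<le> x \<Longrightarrow> (\<Sum>m. ennreal (pois x m)) = 1"
  by (subst suminf_ennreal2)
     (auto simp: pois_nonneg sums_unique[OF pois_sums, symmetric] intro: sums_summable[OF pois_sums])

lemma prob_space_expm: "0 < r \<Longrightarrow> prob_space (expm r)"
  by (rule prob_space_exponential_density)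

lemma prob_space_iid: "prob_space N \<Longrightarrow> prob_space (iid N)"
  by (rule prob_space_PiM)

lemma nn_integral_iid_case_nat:
  assumes "prob_space N" and F[measurable]: "F \<in> borel_measurable (iid N)"
  shows "(\<integral>\<^sup>+u. F u \<partial>iid N) = (\<integral>\<^sup>+x. \<integral>\<^sup>+u. F (case_nat x u) \<partial>iid N \<partial>N)"
proof -
  interpret S: prob_space "iid N" by (rule prob_space_iid) fact
  interpret N: prob_space N by fact
  interpret sequence_space N ..
  have "(\<integral>\<^sup>+u. F u \<partial>iid N) = (\<integral>\<^sup>+u. F u \<partial>distr (N \<Otimes>\<^sub>M iid N) (iid N) (\<lambda>(s, \<omega>). case_nat s \<omega>))"
    by (simp add: PiM_iter)
  also have "\<dots> = (\<integral>\<^sup>+p. F (case p of (s, \<omega>) \<Rightarrow> case_nat s \<omega>) \<partial>(N \<Otimes>\<^sub>M iid N))"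
    by (rule nn_integral_distr) measurable
  also have "\<dots> = (\<integral>\<^sup>+x. \<integral>\<^sup>+u. F (case_nat x u) \<partial>iid N \<partial>N)"
    by (subst S.nn_integral_fst[symmetric]) (auto simp: split_beta')
  finally show ?thesis .
qed

lemma residual_at_measurable:
  assumes [measurable]: "u \<in> N \<rightarrow>\<^sub>M iid (borel::real measure)" "t \<in> borel_measurable N"
  shows "(\<lambda>\<omega>. residual_at m (t \<omega>) (u \<omega>)) \<in> N \<rightarrow>\<^sub>M iid borel"
proof (rule measurable_PiM_single')
  fix i :: nat
  show "(\<lambda>\<omega>. residual_at m (t \<omega>) (u \<omega>) i) \<in> N \<rightarrow>\<^sub>M borel"
    by (cases "i = 0") (simp_all add: residual_at_def)
qed auto

lemma crosses_at_measurable [measurable (raw)]: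
  assumes [measurable]: "u \<in> N \<rightarrow>\<^sub>M iid (borel::real measure)" "t \<in> borel_measurable N"
  shows "Measurable.pred N (\<lambda>\<omega>. crosses_at m (t \<omega>) (u \<omega>))"
  unfolding crosses_at_def by measurable

lemma passage_measurable [measurable (raw)]:
  assumes [measurable]: "u \<in> N \<rightarrow>\<^sub>M iid (borel::real measure)" "t \<in> borel_measurable N"
  shows "(\<lambda>\<omega>. passage (t \<omega>) (u \<omega>)) \<in> N \<rightarrow>\<^sub>M count_space UNIV"
  unfolding passage_def by measurable

lemma residual_measurable [measurable (raw)]:
  assumes [measurable]: "u \<in> N \<rightarrow>\<^sub>M iid (borel::real measure)" "t \<in> borel_measurable N"
  shows "(\<lambda>\<omega>. residual (t \<omega>) (u \<omega>)) \<in> N \<rightarrow>\<^sub>M iid borel"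
  unfolding residual_def
  by (rule measurable_compose_countable[OF residual_at_measurable]) measurable

text \<open>
  Memorylessness of a single exponential step.
\<close>

lemma exponential_tail_shift:
  assumes r: "0 < r" and t: "0 \<le> t" and [measurable]: "h \<in> borel_measurable borel"
  shows "(\<integral>\<^sup>+x. (if t \<le> x then h (x - t) else 0) \<partial>expm r) = ennreal (exp (- (r * t))) * (\<integral>\<^sup>+x. h x \<partial>expm r)"
proof -
  have "(\<integral>\<^sup>+x. (if t \<le> x then h (x - t) else 0) \<partial>expm r) =
        (\<integral>\<^sup>+x. ennreal (exponential_density r x) * (if t \<le> x then h (x - t) else 0) \<partial>lborel)"
    by (subst nn_integral_density) auto
  also have "\<dots> = (\<integral>\<^sup>+x. ennreal (exponential_density r (t + x)) * (if t \<le> t + x then h x else 0) \<partial>lborel)"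
    by (subst nn_integral_real_affine[where c = 1 and t = t]) (auto intro!: nn_integral_cong)
  also have "\<dots> = (\<integral>\<^sup>+x. ennreal (exp (- (r * t))) * (ennreal (exponential_density r x) * h x) \<partial>lborel)"
  proof (rule nn_integral_cong)
    fix x :: real
    have "ennreal (exponential_density r (t + x)) = ennreal (exp (- (r * t))) * ennreal (exponential_density r x)" if "0 \<le> x"
      using that t r
      by (simp add: exponential_density_def ennreal_mult[symmetric] exp_add[symmetric] algebra_simps mult_exp_exp)
    then show "ennreal (exponential_density r (t + x)) * (if t \<le> t + x then h x else 0) =
        ennreal (exp (- (r * t))) * (ennreal (exponential_density r x) * h x)"
      by (cases "0 \<le> x") (auto simp: exponential_density_def mult.assoc)
  qed
  also have "\<dots> = ennreal (exp (- (r * t))) * (\<integral>\<^sup>+x. h x \<partial>expm r)"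
    by (subst nn_integral_cmult) (auto simp: nn_integral_density)
  finally show ?thesis .
qed

text \<open>
  First-step analysis of the Poisson weights: \<open>m + 1\<close> renewals before \<open>t\<close> mean that the first step
  ends at some \<open>x < t\<close> and is followed by \<open>m\<close> renewals in the remaining time \<open>t - x\<close>.
\<close>

lemma pois_convolution:
  assumes r: "0 < r" and t: "0 \<le> t"
  shows "(\<integral>\<^sup>+x. (if x < t then ennreal (pois (r * (t - x)) m) else 0) \<partial>expm r) = ennreal (pois (r * t) (Suc m))"
proof -
  let ?c = "exp (- (r * t)) * r ^ Suc m / fact m"
  have deriv: "((\<lambda>x. - (c * (t - x) ^ Suc m / Suc m)) has_real_derivative c * (t - x) ^ m) (at x within S)"
    for c x :: real and S
    by (auto intro!: derivative_eq_intros simp del: power_Suc of_nat_Suc)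
  have "(\<integral>\<^sup>+x. (if x < t then ennreal (pois (r * (t - x)) m) else 0) \<partial>expm r) =
        (\<integral>\<^sup>+x. ennreal (?c * (t - x) ^ m) * indicator {0..t} x \<partial>lborel)"
  proof (subst nn_integral_density)
    show "(\<integral>\<^sup>+x. ennreal (exponential_density r x) * (if x < t then ennreal (pois (r * (t - x)) m) else 0) \<partial>lborel) =
        (\<integral>\<^sup>+x. ennreal (?c * (t - x) ^ m) * indicator {0..t} x \<partial>lborel)"
    proof (rule nn_integral_cong_AE)
      show "AE x in lborel. ennreal (exponential_density r x) * (if x < t then ennreal (pois (r * (t - x)) m) else 0) =
        ennreal (?c * (t - x) ^ m) * indicator {0..t} x"
        using AE_lborel_singleton[of t]
      proof (eventually_elim)
        case (elim x)
        have "exponential_density r x * pois (r * (t - x)) m = ?c * (t - x) ^ m" if "0 \<le> x" "x < t"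
        proof -
          have "exponential_density r x * pois (r * (t - x)) m =
              (exp (- (x * r)) * exp (- (r * (t - x)))) * r ^ Suc m * (t - x) ^ m / fact m"
            using that by (simp add: exponential_density_def pois_def power_mult_distrib)
          also have "exp (- (x * r)) * exp (- (r * (t - x))) = exp (- (r * t))"
            by (simp add: mult_exp_exp algebra_simps)
          finally show ?thesis by simp
        qed
        then show ?case using elim r
          by (auto simp: ennreal_mult[symmetric] exponential_density_def pois_nonneg indicator_def)
      qed
    qed
  qed measurable
  also have "\<dots> = ennreal (- (?c * (t - t) ^ Suc m / Suc m) - - (?c * (t - 0) ^ Suc m / Suc m))"
    using t r by (intro nn_integral_FTC_Icc[where F = "\<lambda>x. - (?c * (t - x) ^ Suc m / Suc m)"] deriv) auto
  also have "\<dots> = ennreal (pois (r * t) (Suc m))"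
    by (simp add: pois_def power_mult_distrib field_simps)
  finally show ?thesis .
qed

text \<open>
  By induction on \<open>m\<close>, conditioning on the first step: if it exceeds \<open>t\<close>, memorylessness renews it;
  otherwise the remaining steps have to cross \<open>t - x\<close> at \<open>m - 1\<close>.
\<close>

lemma nn_integral_crosses_at:
  assumes r: "0 < r" and [measurable]: "F \<in> borel_measurable (iid borel)"
  shows "0 \<le> t \<Longrightarrow> (\<integral>\<^sup>+u. (if crosses_at m t u then F (residual_at m t u) else 0) \<partial>iid (expm r)) =
           ennreal (pois (r * t) m) * (\<integral>\<^sup>+u. F u \<partial>iid (expm r))"
proof (induction m arbitrary: t)
  case 0
  note residual_at_measurable[measurable (raw)]
  interpret E: prob_space "iid (expm r)" using r by (intro prob_space_iid prob_space_expm)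
  have "(\<integral>\<^sup>+u. (if crosses_at 0 t u then F (residual_at 0 t u) else 0) \<partial>iid (expm r)) =
     (\<integral>\<^sup>+x. (if t \<le> x then (\<integral>\<^sup>+u. F (case_nat (x - t) u) \<partial>iid (expm r)) else 0) \<partial>expm r)"
    using r by (subst nn_integral_iid_case_nat)
      (auto intro!: nn_integral_cong prob_space_expm simp: crosses_at_0_case_nat residual_at_0_case_nat)
  also have "\<dots> = ennreal (exp (- (r * t))) * (\<integral>\<^sup>+x. (\<integral>\<^sup>+u. F (case_nat x u) \<partial>iid (expm r)) \<partial>expm r)"
    using r 0 by (intro exponential_tail_shift) measurable
  also have "\<dots> = ennreal (pois (r * t) 0) * (\<integral>\<^sup>+u. F u \<partial>iid (expm r))"
    using r by (subst nn_integral_iid_case_nat[of _ F]) (auto intro!: prob_space_expm simp: pois_def)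
  finally show ?case .
next
  case (Suc m)
  note residual_at_measurable[measurable (raw)]
  interpret E: prob_space "iid (expm r)" using r by (intro prob_space_iid prob_space_expm)
  have "(\<integral>\<^sup>+u. (if crosses_at (Suc m) t u then F (residual_at (Suc m) t u) else 0) \<partial>iid (expm r)) =
     (\<integral>\<^sup>+x. (if x < t then (\<integral>\<^sup>+u. (if crosses_at m (t - x) u then F (residual_at m (t - x) u) else 0) \<partial>iid (expm r)) else 0) \<partial>expm r)"
    using r by (subst nn_integral_iid_case_nat)
      (auto intro!: nn_integral_cong prob_space_expm simp: crosses_at_Suc_case_nat residual_at_Suc_case_nat)
  also have "\<dots> = (\<integral>\<^sup>+x. (if x < t then ennreal (pois (r * (t - x)) m) else 0) * (\<integral>\<^sup>+u. F u \<partial>iid (expm r)) \<partial>expm r)"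
    by (intro nn_integral_cong) (simp add: Suc.IH)
  also have "\<dots> = (\<integral>\<^sup>+x. (if x < t then ennreal (pois (r * (t - x)) m) else 0) \<partial>expm r) * (\<integral>\<^sup>+u. F u \<partial>iid (expm r))"
    by (intro nn_integral_multc) measurable
  finally show ?case using pois_convolution[OF r Suc.prems] by simp
qed

lemma AE_expm_nonneg: "AE x in expm r. 0 \<le> x"
  by (subst AE_density) (auto simp: exponential_density_def)

text \<open>
  For \<open>F = 1\<close>, \<open>nn_integral_crosses_at\<close> gives level \<open>k\<close> the Poisson probability of being crossed at \<open>m\<close>.
  These probabilities sum to 1, so that every level is crossed almost surely.
\<close>

lemma AE_renewing:
  assumes r: "0 < r" shows "AE u in iid (expm r). renewing u"
proof -
  interpret E: prob_space "iid (expm r)" using r by (intro prob_space_iid prob_space_expm)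
  have "AE u in iid (expm r). \<exists>m. real k \<le> sum u {..m}" for k :: nat
  proof -
    let ?S = "\<lambda>m. {u \<in> space (iid (expm r)). crosses_at m (real k) u}"
    have meas [measurable]: "Measurable.pred (iid (expm r)) (\<lambda>u. crosses_at m (real k) u)" for m
      by measurable
    have "emeasure (iid (expm r)) (?S m) = ennreal (pois (r * real k) m)" for m
    proof -
      have "emeasure (iid (expm r)) (?S m) = (\<integral>\<^sup>+u. (if crosses_at m (real k) u then 1 else 0) \<partial>iid (expm r))"
        by (subst nn_integral_indicator[symmetric])
           (auto intro!: nn_integral_cong simp: indicator_def simp del: nn_integral_indicator)
      also have "\<dots> = ennreal (pois (r * real k) m)"
        using nn_integral_crosses_at[OF r, of "\<lambda>_. 1" "real k" m] by (simp add: E.emeasure_space_1)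
      finally show ?thesis .
    qed
    moreover have "(\<Sum>m. emeasure (iid (expm r)) (?S m)) = emeasure (iid (expm r)) (\<Union>m. ?S m)"
      by (intro suminf_emeasure) (auto simp: disjoint_family_on_def dest!: crosses_at_passage)
    ultimately have "emeasure (iid (expm r)) (\<Union>m. ?S m) = 1"
      using r suminf_pois[of "r * real k"] by simp
    then have "AE u in iid (expm r). u \<in> (\<Union>m. ?S m)"
      by (intro E.AE_in_set_eq_1[THEN iffD2]) (auto simp: E.emeasure_eq_measure)
    then show ?thesis
      by eventually_elim (auto simp: crosses_at_def)
  qed
  then have "AE u in iid (expm r). \<forall>k. \<exists>m. real k \<le> sum u {..m}"
    by (simp add: AE_all_countable)
  moreover have "AE u in iid (expm r). \<forall>i. 0 \<le> u i"
    unfolding AE_all_countable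
    using r by (intro allI AE_PiM_component prob_space_expm AE_expm_nonneg) auto
  ultimately show ?thesis
  proof eventually_elim
    case (elim u)
    have "\<exists>m. t \<le> sum u {..m}" for t
      using elim(1) real_arch_simple[of t] by (meson order_trans)
    with elim(2) show ?case by (simp add: renewing_def)
  qed
qed

text \<open>
  The strong form of memorylessness on which everything rests: at a fixed time, the number of renewals
  is Poisson, and the residual sequence is independent of it and distributed like the original one.
\<close>

lemma nn_integral_renewal:
  assumes r: "0 < r" and t: "0 \<le> t" and F[measurable]: "\<And>m. F m \<in> borel_measurable (iid borel)"
  shows "(\<integral>\<^sup>+u. F (passage t u) (residual t u) \<partial>iid (expm r)) =
           (\<Sum>m. ennreal (pois (r * t) m) * (\<integral>\<^sup>+u. F m u \<partial>iid (expm r)))"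
proof -
  note residual_at_measurable[measurable (raw)]
  have "(\<integral>\<^sup>+u. F (passage t u) (residual t u) \<partial>iid (expm r)) =
     (\<integral>\<^sup>+u. (\<Sum>m. if crosses_at m t u then F m (residual_at m t u) else 0) \<partial>iid (expm r))"
  proof (rule nn_integral_cong_AE, use AE_renewing[OF r] in eventually_elim)
    case (elim u)
    then have "(\<Sum>m. if crosses_at m t u then F m (residual_at m t u) else 0) =
      (\<Sum>m. if m = passage t u then F m (residual_at m t u) else 0)"
      by (intro suminf_cong) (auto simp: crosses_at_iff)
    also have "\<dots> = F (passage t u) (residual t u)"
      using suminf_finite[of "{passage t u}" "\<lambda>m. if m = passage t u then F m (residual_at m t u) else 0"]
      by (simp add: residual_def)
    finally show ?case ..
  qed
  also have "\<dots> = (\<Sum>m. \<integral>\<^sup>+u. (if crosses_at m t u then F m (residual_at m t u) else 0) \<partial>iid (expm r))"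
    by (intro nn_integral_suminf) measurable
  finally show ?thesis by (simp add: nn_integral_crosses_at[OF r F t])
qed

lemma sum_mono_atMost: "(\<And>i. 0 \<le> u i) \<Longrightarrow> j \<le> k \<Longrightarrow> sum u {..j} \<le> sum u {..k::nat}" for u :: "nat \<Rightarrow> real"
  by (rule sum_mono2) auto

text \<open>
  This equivalence with \<open>passage\<close> turns all comparisons of epochs with a fixed time into comparisons
  of indices.
\<close>

lemma le_sum_iff_passage_le:
  assumes "renewing u" shows "t \<le> sum u {..j} \<longleftrightarrow> passage t u \<le> j"
proof -
  have c: "crosses_at (passage t u) t u" using assms by (intro passage_crosses) (auto simp: renewing_def)
  show ?thesis
    using c sum_mono_atMost[of u "passage t u" j] assms
    unfolding crosses_at_def renewing_def by (metis not_le order_trans)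
qed

lemma renewing_residual:
  assumes "renewing u" shows "renewing (residual t u)"
  unfolding renewing_def
proof (intro conjI allI)
  fix i show "0 \<le> residual t u i"
    using assms le_sum_iff_passage_le[OF assms, of t "passage t u"]
    by (auto simp: residual_def residual_at_def renewing_def)
next
  fix s
  obtain m where "s + t \<le> sum u {..m}" using assms unfolding renewing_def by blast
  then have "s + t \<le> sum u {..passage t u + m}"
    using sum_mono_atMost[of u m "passage t u + m"] assms by (auto simp: renewing_def)
  then show "\<exists>m. s \<le> sum (residual t u) {..m}" by (auto simp: sum_residual intro!: exI[of _ m])
qed

lemma passage_add:
  assumes "renewing u" "0 \<le> t"
  shows "passage (s + t) u = passage s u + passage t (residual s u)"
proof (rule antisym)
  have "t \<le> sum (residual s u) {..passage t (residual s u)}"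
    using le_sum_iff_passage_le[OF renewing_residual[OF assms(1)], of t s] by blast
  then show "passage (s + t) u \<le> passage s u + passage t (residual s u)"
    by (simp add: sum_residual le_sum_iff_passage_le[OF assms(1), symmetric] add.commute)
next
  let ?j = "passage (s + t) u"
  have "s + t \<le> sum u {..?j}" using le_sum_iff_passage_le[OF assms(1)] by blast
  then have le: "passage s u \<le> ?j" using le_sum_iff_passage_le[OF assms(1), of s ?j] assms(2) by auto
  then have "t \<le> sum (residual s u) {..?j - passage s u}"
    using \<open>s + t \<le> _\<close> by (simp add: sum_residual)
  then have "passage t (residual s u) \<le> ?j - passage s u"
    using le_sum_iff_passage_le[OF renewing_residual[OF assms(1)], of t s] by simp
  then show "passage s u + passage t (residual s u) \<le> ?j" using le by simp
qed

lemma residual_add: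
  assumes "renewing u" "0 \<le> t"
  shows "residual (s + t) u = residual t (residual s u)"
proof
  fix i
  show "residual (s + t) u i = residual t (residual s u) i"
    by (cases "i = 0") 
       (auto simp: residual_def[of "s + t"] residual_def[of t] residual_at_def sum_residual passage_add[OF assms],
        simp add: residual_def residual_at_def ac_simps)
qed

section \<open>Restarting the sample path after one cycle\<close>

text \<open>
  The dynamics of \<open>glue_state\<close>, started when the customers in \<open>D\<close> have already been served. The
  customers below \<open>c\<close> have arrived before time 0; customer \<open>k < c\<close> outside \<open>D\<close> is in orbit, with
  first retrial at \<open>R k 0\<close>.
\<close>

primrec run ::
  "real \<Rightarrow> nat \<Rightarrow> nat set \<Rightarrow> (nat \<Rightarrow> real) \<Rightarrow> (nat \<Rightarrow> real) \<Rightarrow> (nat \<Rightarrow> real) \<Rightarrow> (nat \<Rightarrow> nat \<Rightarrow> real)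
    \<Rightarrow> nat \<Rightarrow> real \<times> nat set" where
  "run G c D A B V R 0 = (0, D)"
| "run G c D A B V R (Suc n) =
     (let (t, S) = run G c D A B V R n;
          Q = {k. k \<notin> S \<and> attempts c A R k \<inter> {t..<t + G} \<noteq> {}}
      in (t + G + (\<Sum>k\<in>Q. B k) + V n, S \<union> Q))"

definition orbit_size ::
  "real \<Rightarrow> nat \<Rightarrow> nat set \<Rightarrow> (nat \<Rightarrow> real) \<Rightarrow> (nat \<Rightarrow> real) \<Rightarrow> (nat \<Rightarrow> real) \<Rightarrow> (nat \<Rightarrow> nat \<Rightarrow> real)
    \<Rightarrow> nat \<Rightarrow> nat" where
  "orbit_size G c D A B V R n =
     (let (t, S) = run G c D A B V R n in card {k. k \<notin> S \<and> (k < c \<or> arrival_time c A k < t)})"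

lemma glue_state_eq_run: "glue_state G c A B V R n = run G c {} A B V R n"
  by (induction n) auto

lemma number_at_glue_eq: "number_at_glue G c A B V R n = orbit_size G c {} A B V R n"
  by (simp add: number_at_glue_def orbit_size_def glue_state_eq_run)

text \<open>
  The retrial intervals of a customer as seen at time \<open>t\<close>. Its retrial clock has been running since
  its arrival; for one that arrives after \<open>t\<close> it has not started.
\<close>

definition delayed :: "nat \<Rightarrow> (nat \<Rightarrow> real) \<Rightarrow> real \<Rightarrow> (nat \<Rightarrow> nat \<Rightarrow> real) \<Rightarrow> nat \<Rightarrow> nat \<Rightarrow> real" where
  "delayed c A t R k =
     (if arrival_time c A k < t then residual (t - arrival_time c A k) (R k) else R k)"

lemma arrival_time_old: "k < c \<Longrightarrow> arrival_time c A k = 0"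
  by (simp add: arrival_time_def)

lemma arrival_time_new: "c \<le> k \<Longrightarrow> arrival_time c A k = sum A {..k - c}"
  by (simp add: arrival_time_def Suc_diff_le lessThan_Suc_atMost)

lemma arrival_time_less_iff:
  assumes "renewing A" "0 < t"
  shows "arrival_time c A k < t \<longleftrightarrow> k < c + passage t A"
proof (cases "k < c")
  case False
  then show ?thesis
    using le_sum_iff_passage_le[OF assms(1), of t "k - c"] by (auto simp: arrival_time_new)
qed (use assms in \<open>simp add: arrival_time_old\<close>)

lemma arrival_time_residual:
  assumes "c + passage t A \<le> k"
  shows "arrival_time (c + passage t A) (residual t A) k = arrival_time c A k - t"
  using assms by (simp add: arrival_time_new sum_residual)

lemma attempts_old: "k < c \<Longrightarrow> attempts c A R k = {sum (R k) {..m} | m. True}"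
  unfolding attempts_def arrival_time_old
  by (auto simp: gr0_conv_Suc lessThan_Suc_atMost arrival_time_old) (metis lessThan_Suc_atMost)

lemma attempts_new:
  "c \<le> k \<Longrightarrow> attempts c A R k = {arrival_time c A k + sum (R k) {..<m} | m. True}"
  unfolding attempts_def by auto

lemma sum_nonneg_renewing: "renewing u \<Longrightarrow> 0 \<le> sum u S"
  by (auto simp: renewing_def intro: sum_nonneg)

text \<open>
  A customer that has arrived before \<open>t\<close> is, at time \<open>t\<close>, an initial customer of the restarted path:
  its arrival itself is no attempt any more, and its retrials after \<open>t\<close> are the partial sums of the
  residual sequence. For a later customer only the origin of time is shifted.
\<close>

lemma attempts_restart:
  assumes A: "renewing A" and R: "renewing (R k)" and t: "0 < t"
  shows "attempts c A R k \<inter> {t..} =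
    (+) t ` attempts (c + passage t A) (residual t A) (delayed c A t R) k"
proof (cases "arrival_time c A k < t")
  case True
  define a where "a = arrival_time c A k"
  have k: "k < c + passage t A" using arrival_time_less_iff[OF A t] True by simp
  have mem: "x \<in> attempts c A R k \<inter> {t..} \<longleftrightarrow> (\<exists>m. x = a + sum (R k) {..m} \<and> t - a \<le> sum (R k) {..m})" for x
  proof (cases "k < c")
    case True
    then have "a = 0" by (simp add: a_def arrival_time_old)
    then show ?thesis using True by (auto simp: attempts_old)
  next
    case False
    show ?thesis
    proof
      assume "x \<in> attempts c A R k \<inter> {t..}"
      then obtain m where m: "x = a + sum (R k) {..<m}" "t \<le> x"
        using False by (auto simp: attempts_new a_def)
      with True have "m \<noteq> 0" by (cases m) (auto simp: a_def)
      then obtain j where "m = Suc j" using not0_implies_Suc by blast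
      with m show "\<exists>m. x = a + sum (R k) {..m} \<and> t - a \<le> sum (R k) {..m}"
        by (intro exI[of _ j]) (simp add: lessThan_Suc_atMost)
    next
      assume "\<exists>m. x = a + sum (R k) {..m} \<and> t - a \<le> sum (R k) {..m}"
      then obtain m where "x = a + sum (R k) {..<Suc m}" "t \<le> x"
        by (auto simp: lessThan_Suc_atMost)
      then show "x \<in> attempts c A R k \<inter> {t..}"
        using False by (auto simp only: attempts_new a_def not_less)
    qed
  qed
  have "attempts c A R k \<inter> {t..} = {a + sum (R k) {..m} | m. passage (t - a) (R k) \<le> m}"
    unfolding set_eq_iff mem le_sum_iff_passage_le[OF R] by simp
  also have "\<dots> = {a + sum (R k) {..passage (t - a) (R k) + i} | i. True}"
    unfolding le_iff_add by blast
  also have "\<dots> = {t + sum (residual (t - a) (R k)) {..i} | i. True}"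
    by (simp add: sum_residual add.commute)
  also have "\<dots> = (+) t ` attempts (c + passage t A) (residual t A) (delayed c A t R) k"
    using True k by (auto simp: attempts_old delayed_def a_def)
  finally show ?thesis .
next
  case False
  then have k: "c + passage t A \<le> k" using arrival_time_less_iff[OF A t, of c k] by simp
  then have "c \<le> k" by simp
  have "t \<le> arrival_time c A k + sum (R k) {..<m}" for m
    using False sum_nonneg_renewing[OF R, of "{..<m}"] by simp
  then show ?thesis using False k \<open>c \<le> k\<close>
    by (auto simp: attempts_new delayed_def arrival_time_residual full_SetCompr_eq image_image)
qed

lemma hits_restart:
  assumes "renewing A" "renewing (R k)" "0 < t" "0 \<le> s"
  shows "attempts c A R k \<inter> {t + s..<t + s + G} \<noteq> {} \<longleftrightarrow>
    attempts (c + passage t A) (residual t A) (delayed c A t R) k \<inter> {s..<s + G} \<noteq> {}"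
proof -
  let ?X = "attempts (c + passage t A) (residual t A) (delayed c A t R) k"
  have "attempts c A R k \<inter> {t + s..<t + s + G} = (attempts c A R k \<inter> {t..}) \<inter> {t + s..<t + s + G}"
    using assms by auto
  also have "\<dots> = (+) t ` (?X \<inter> {s..<s + G})"
    unfolding attempts_restart[where R = R and k = k and c = c, OF assms(1-3)] by auto
  finally show ?thesis by simp
qed

lemma fst_run_nonneg:
  assumes "0 \<le> G" "\<And>k. 0 \<le> B k" "\<And>k. 0 \<le> V k"
  shows "0 \<le> fst (run G c D A B V R n)"
  by (induction n) (use assms in \<open>auto simp: Let_def split_beta intro!: add_nonneg_nonneg sum_nonneg\<close>)

lemma first_cycle_pos:
  assumes B: "\<And>k. 0 \<le> B k" and V: "\<And>k. 0 \<le> V k" and G: "0 < G"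
    and t: "run G c D A B V R (Suc 0) = (t, S)"
  shows "0 < t"
proof -
  have "0 \<le> sum B Q" for Q using B by (simp add: sum_nonneg)
  then show ?thesis using t G V[of 0] by (auto simp: Let_def intro!: add_pos_nonneg)
qed

text \<open>
  By induction on \<open>n\<close>, since by \<open>hits_restart\<close> the same customers are collected in each glue period.
\<close>

lemma run_restart:
  assumes A: "renewing A" and R: "\<And>k. renewing (R k)" and B: "\<And>k. 0 \<le> B k" and V: "\<And>k. 0 \<le> V k"
    and G: "0 < G" and t: "run G c D A B V R (Suc 0) = (t, S)"
  shows "run G c D A B V R (Suc n) =
    map_prod ((+) t) id
      (run G (c + passage t A) S (residual t A) B (\<lambda>j. V (Suc j)) (delayed c A t R) n)"
proof (induction n)
  case (Suc n)
  have "0 < t" using first_cycle_pos[OF B V G t] .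
  obtain s X where X: "run G (c + passage t A) S (residual t A) B (\<lambda>j. V (Suc j)) (delayed c A t R) n = (s, X)"
    by fastforce
  have "0 \<le> s" using fst_run_nonneg[of G B "\<lambda>j. V (Suc j)"] X B V G by (metis fst_conv less_imp_le)
  have IH: "run G c D A B V R (Suc n) = (t + s, X)"
    unfolding Suc.IH X by simp
  show ?case
    unfolding run.simps(2)[of G c D A B V R "Suc n"] IH
    using hits_restart[OF A R \<open>0 < t\<close> \<open>0 \<le> s\<close>] by (simp add: X Let_def add.assoc)
qed (use t in simp)

lemma orbit_size_restart:
  assumes A: "renewing A" and R: "\<And>k. renewing (R k)" and B: "\<And>k. 0 \<le> B k" and V: "\<And>k. 0 \<le> V k"
    and G: "0 < G" and t: "run G c D A B V R (Suc 0) = (t, S)"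
  shows "orbit_size G c D A B V R (Suc n) =
      orbit_size G (c + passage t A) S (residual t A) B (\<lambda>j. V (Suc j)) (delayed c A t R) n"
proof -
  have "0 < t" using first_cycle_pos[OF B V G t] .
  obtain s X where X: "run G (c + passage t A) S (residual t A) B (\<lambda>j. V (Suc j)) (delayed c A t R) n = (s, X)"
    by fastforce
  have "0 \<le> s" using fst_run_nonneg[of G B "\<lambda>j. V (Suc j)"] X B V G by (metis fst_conv less_imp_le)
  have "(k < c \<or> arrival_time c A k < t + s) \<longleftrightarrow>
    (k < c + passage t A \<or> arrival_time (c + passage t A) (residual t A) k < s)" for k
  proof (cases "k < c + passage t A")
    case True
    then show ?thesis using arrival_time_less_iff[OF A \<open>0 < t\<close>, of c k] \<open>0 \<le> s\<close> by auto
  next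
    case False
    then show ?thesis by (auto simp: arrival_time_residual)
  qed
  then show ?thesis
    unfolding orbit_size_def run_restart[OF assms, of n] X by simp
qed

lemma attempt_before_iff_old:
  assumes R: "renewing (R k)" and "k < c" "0 < G"
  shows "attempts c A R k \<inter> {0..<G} \<noteq> {} \<longleftrightarrow> passage G (R k) \<noteq> 0"
proof -
  have "(\<exists>m. sum (R k) {..m} < G) \<longleftrightarrow> sum (R k) {..0} < G"
    using sum_mono_atMost[of "R k" 0] R unfolding renewing_def by (meson le0 le_less_trans)
  also have "\<dots> \<longleftrightarrow> passage G (R k) \<noteq> 0"
    using le_sum_iff_passage_le[OF R, of G 0] by (auto simp: not_le)
  finally show ?thesis
    using sum_nonneg_renewing[OF R] \<open>k < c\<close> by (auto simp: attempts_old)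
qed

lemma attempt_before_iff_new:
  assumes A: "renewing A" and R: "renewing (R k)" and "c \<le> k" "0 < G"
  shows "attempts c A R k \<inter> {0..<G} \<noteq> {} \<longleftrightarrow> k < c + passage G A"
proof -
  have "0 \<le> arrival_time c A k" unfolding arrival_time_def by (rule sum_nonneg_renewing[OF A])
  moreover have "(\<exists>m. arrival_time c A k + sum (R k) {..<m} < G) \<longleftrightarrow> arrival_time c A k + sum (R k) {..<0} < G"
    using sum_nonneg_renewing[OF R] by (smt (verit) lessThan_0 sum.empty)
  ultimately show ?thesis
    using sum_nonneg_renewing[OF R] \<open>c \<le> k\<close> arrival_time_less_iff[OF A \<open>0 < G\<close>, of c k]
    by (auto simp: attempts_new)
qed

text \<open>
  The first glue period collects the customers in orbit with at least one retrial before \<open>G\<close>, and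
  all new arrivals before \<open>G\<close>.
\<close>

lemma run_first:
  assumes A: "renewing A" and R: "\<And>k. renewing (R k)" and G: "0 < G" and D: "D \<subseteq> {..<c}"
  defines "Q \<equiv> {k\<in>{..<c} - D. passage G (R k) \<noteq> 0} \<union> {c..<c + passage G A}"
  shows "run G c D A B V R (Suc 0) = (G + (sum B Q + V 0), D \<union> Q)"
proof -
  have "{k. k \<notin> D \<and> attempts c A R k \<inter> {0..<0 + G} \<noteq> {}} = Q"
  proof (intro set_eqI)
    fix k
    show "k \<in> {k. k \<notin> D \<and> attempts c A R k \<inter> {0..<0 + G} \<noteq> {}} \<longleftrightarrow> k \<in> Q"
      using D attempt_before_iff_old[OF R _ G, of k c A] attempt_before_iff_new[OF A R _ G, of c k]
      by (cases "k < c") (auto simp: Q_def)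
  qed
  then show ?thesis by (simp add: Let_def)
qed

text \<open>
  The cut at the end of the first cycle. The cycle lasts for \<open>G + \<tau>\<close>; the arrival sequence is
  restarted in two stages, at \<open>G\<close> and then after \<open>\<tau>\<close>, because \<open>\<tau>\<close> itself depends on the arrivals
  before \<open>G\<close>.
\<close>

lemma orbit_size_Suc:
  assumes A: "renewing A" and R: "\<And>k. renewing (R k)" and B: "\<And>k. 0 \<le> B k" and V: "\<And>k. 0 \<le> V k"
    and G: "0 < G" and D: "D \<subseteq> {..<c}"
  defines "Q \<equiv> {k\<in>{..<c} - D. passage G (R k) \<noteq> 0} \<union> {c..<c + passage G A}"
  defines "\<tau> \<equiv> sum B Q + V 0"
  shows "orbit_size G c D A B V R (Suc n) =
      orbit_size G (c + (passage G A + passage \<tau> (residual G A))) (D \<union> Q) (residual \<tau> (residual G A)) B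
        (\<lambda>j. V (Suc j)) (delayed c A (G + \<tau>) R) n"
proof -
  have "0 \<le> \<tau>" using B V by (simp add: \<tau>_def sum_nonneg)
  have 1: "run G c D A B V R (Suc 0) = (G + \<tau>, D \<union> Q)"
    unfolding \<tau>_def Q_def by (rule run_first[OF A R G D])
  show ?thesis
    by (simp only: orbit_size_restart[OF A R B V G 1] passage_add[OF A \<open>0 \<le> \<tau>\<close>]
        residual_add[OF A \<open>0 \<le> \<tau>\<close>])
qed

text \<open>
  The service times of customers served before the start can be changed freely. This separates the
  service times that determine the length of the first cycle from the later path.
\<close>

lemma run_cong_unserved:
  assumes "\<And>k. k \<notin> D \<Longrightarrow> B k = B' k"
  shows "run G c D A B V R n = run G c D A B' V R n \<and> D \<subseteq> snd (run G c D A B V R n)"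
proof (induction n)
  case (Suc n)
  obtain t S where S: "run G c D A B' V R n = (t, S)" by (rule prod.exhaust)
  have IH1: "run G c D A B V R n = (t, S)" using Suc.IH S by simp
  moreover have "D \<subseteq> S" using conjunct2[OF Suc.IH] IH1 by simp
  ultimately have IH: "run G c D A B V R n = (t, S)" "D \<subseteq> S" .
  define Q where "Q = {k. k \<notin> S \<and> attempts c A R k \<inter> {t..<t + G} \<noteq> {}}"
  have "sum B Q = sum B' Q"
  proof (rule sum.cong)
    fix k assume "k \<in> Q"
    then show "B k = B' k" using IH(2) by (intro assms) (auto simp: Q_def)
  qed simp
  then show ?case
    using IH(2) by (simp only: run.simps IH(1) S Let_def prod.case Q_def[symmetric]) auto
qed simp

lemma orbit_size_cong_unserved:
  assumes "\<And>k. k \<notin> D \<Longrightarrow> B k = B' k"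
  shows "orbit_size G c D A B V R n = orbit_size G c D A B' V R n"
  unfolding orbit_size_def
  by (subst conjunct1[OF run_cong_unserved[of D B B', OF assms]]) simp_all

lemma orbit_size_0: "D \<subseteq> {..<c} \<Longrightarrow> renewing A \<Longrightarrow> orbit_size G c D A B V R 0 = card ({..<c} - D)"
proof -
  assume "D \<subseteq> {..<c}" "renewing A"
  have "\<not> arrival_time c A k < 0" for k
    unfolding arrival_time_def not_less by (rule sum_nonneg_renewing) fact
  then have "{k. k \<notin> D \<and> (k < c \<or> arrival_time c A k < 0)} = {..<c} - D" by auto
  then show ?thesis by (simp add: orbit_size_def)
qed

section \<open>Measurability of the sample path\<close>

text \<open>
  The sum over an infinite set is 0 by convention, so boundedness of the random set has to be
  decided first; then the sum is a finite one with a measurable upper limit.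
\<close>

lemma sum_random_set_measurable:
  fixes b :: "nat \<Rightarrow> 'a \<Rightarrow> real"
  assumes [measurable]: "\<And>k. b k \<in> borel_measurable N" "\<And>k. Measurable.pred N (\<lambda>\<omega>. k \<in> Q \<omega>)"
  shows "(\<lambda>\<omega>. \<Sum>k\<in>Q \<omega>. b k \<omega>) \<in> borel_measurable N"
proof -
  define m where "m \<omega> = (LEAST m. \<forall>k. m \<le> k \<longrightarrow> k \<notin> Q \<omega>)" for \<omega>
  have [measurable]: "m \<in> N \<rightarrow>\<^sub>M count_space UNIV" unfolding m_def by measurable
  have [measurable]: "(\<lambda>\<omega>. \<Sum>k<m \<omega>. if k \<in> Q \<omega> then b k \<omega> else 0) \<in> borel_measurable N"
    by (rule measurable_compose_countable[where g = m and f = "\<lambda>m \<omega>. \<Sum>k<m. if k \<in> Q \<omega> then b k \<omega> else 0"]) measurable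
  have "(\<lambda>\<omega>. if \<exists>m. \<forall>k. m \<le> k \<longrightarrow> k \<notin> Q \<omega> then (\<Sum>k<m \<omega>. if k \<in> Q \<omega> then b k \<omega> else 0) else 0) \<in> borel_measurable N"
    by measurable
  also have "(\<lambda>\<omega>. if \<exists>m. \<forall>k. m \<le> k \<longrightarrow> k \<notin> Q \<omega> then (\<Sum>k<m \<omega>. if k \<in> Q \<omega> then b k \<omega> else 0) else 0) =
    (\<lambda>\<omega>. \<Sum>k\<in>Q \<omega>. b k \<omega>)"
  proof
    fix \<omega>
    show "(if \<exists>m. \<forall>k. m \<le> k \<longrightarrow> k \<notin> Q \<omega> then (\<Sum>k<m \<omega>. if k \<in> Q \<omega> then b k \<omega> else 0) else 0) = (\<Sum>k\<in>Q \<omega>. b k \<omega>)"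
    proof (cases "\<exists>m. \<forall>k. m \<le> k \<longrightarrow> k \<notin> Q \<omega>")
      case True
      then have "\<forall>k. m \<omega> \<le> k \<longrightarrow> k \<notin> Q \<omega>" unfolding m_def by (rule LeastI_ex)
      then have "Q \<omega> \<subseteq> {..<m \<omega>}" by (meson lessThan_iff not_le_imp_less subsetI)
      then have "{..<m \<omega>} \<inter> Q \<omega> = Q \<omega>" by auto
      then show ?thesis using True by (simp add: sum.inter_restrict[symmetric])
    next
      case False
      then have "infinite (Q \<omega>)"
        unfolding finite_nat_set_iff_bounded by (meson leD)
      then show ?thesis unfolding if_not_P[OF False] by simp
    qed
  qed
  finally show ?thesis .
qed

lemma card_random_set_measurable:
  assumes [measurable]: "\<And>k::nat. Measurable.pred N (\<lambda>\<omega>. k \<in> Q \<omega>)"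
  shows "(\<lambda>\<omega>. card (Q \<omega>)) \<in> N \<rightarrow>\<^sub>M count_space UNIV"
proof -
  have [measurable]: "(\<lambda>\<omega>. \<Sum>k\<in>Q \<omega>. (1::real)) \<in> borel_measurable N"
    by (rule sum_random_set_measurable) measurable
  have "(\<lambda>\<omega>. nat \<lfloor>\<Sum>k\<in>Q \<omega>. (1::real)\<rfloor>) \<in> N \<rightarrow>\<^sub>M count_space UNIV"
    by measurable
  then show ?thesis by simp
qed

lemma arrival_time_measurable [measurable (raw)]:
  assumes [measurable]: "A \<in> N \<rightarrow>\<^sub>M iid (borel::real measure)"
  shows "(\<lambda>\<omega>. arrival_time c (A \<omega>) k) \<in> borel_measurable N"
  unfolding arrival_time_def by measurable

lemma delayed_measurable [measurable (raw)]:
  assumes [measurable]: "A \<in> N \<rightarrow>\<^sub>M iid (borel::real measure)" "t \<in> borel_measurable N"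
    "R \<in> N \<rightarrow>\<^sub>M iid (iid (borel::real measure))"
  shows "(\<lambda>\<omega>. delayed c (A \<omega>) (t \<omega>) (R \<omega>)) \<in> N \<rightarrow>\<^sub>M iid (iid borel)"
proof (rule measurable_PiM_single')
  fix k :: nat
  show "(\<lambda>\<omega>. delayed c (A \<omega>) (t \<omega>) (R \<omega>) k) \<in> N \<rightarrow>\<^sub>M iid borel"
    unfolding delayed_def by measurable
qed (auto simp: space_PiM)

lemma attempts_hit_measurable:
  assumes [measurable]: "A \<in> N \<rightarrow>\<^sub>M iid (borel::real measure)" "t \<in> borel_measurable N"
    "R \<in> N \<rightarrow>\<^sub>M iid (iid (borel::real measure))"
  shows "Measurable.pred N (\<lambda>\<omega>. attempts c (A \<omega>) (R \<omega>) k \<inter> {t \<omega>..<t \<omega> + G} \<noteq> {})"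
proof -
  have "Measurable.pred N (\<lambda>\<omega>. \<exists>m. (c \<le> k \<or> 0 < m) \<and>
      t \<omega> \<le> arrival_time c (A \<omega>) k + (\<Sum>i<m. R \<omega> k i) \<and> arrival_time c (A \<omega>) k + (\<Sum>i<m. R \<omega> k i) < t \<omega> + G)"
    by measurable
  also have "(\<lambda>\<omega>. \<exists>m. (c \<le> k \<or> 0 < m) \<and>
      t \<omega> \<le> arrival_time c (A \<omega>) k + (\<Sum>i<m. R \<omega> k i) \<and> arrival_time c (A \<omega>) k + (\<Sum>i<m. R \<omega> k i) < t \<omega> + G) =
      (\<lambda>\<omega>. attempts c (A \<omega>) (R \<omega>) k \<inter> {t \<omega>..<t \<omega> + G} \<noteq> {})"
  proof
    fix \<omega>
    have "S \<inter> {a..<b} \<noteq> {} \<longleftrightarrow> (\<exists>x\<in>S. a \<le> x \<and> x < b)" for S and a b :: real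
      by auto
    then show "(\<exists>m. (c \<le> k \<or> 0 < m) \<and>
      t \<omega> \<le> arrival_time c (A \<omega>) k + (\<Sum>i<m. R \<omega> k i) \<and> arrival_time c (A \<omega>) k + (\<Sum>i<m. R \<omega> k i) < t \<omega> + G) =
      (attempts c (A \<omega>) (R \<omega>) k \<inter> {t \<omega>..<t \<omega> + G} \<noteq> {})"
      unfolding attempts_def by blast
  qed
  finally show ?thesis .
qed

lemma run_measurable:
  assumes [measurable]: "A \<in> N \<rightarrow>\<^sub>M iid (borel::real measure)" "B \<in> N \<rightarrow>\<^sub>M iid (borel::real measure)"
    "V \<in> N \<rightarrow>\<^sub>M iid (borel::real measure)" "R \<in> N \<rightarrow>\<^sub>M iid (iid (borel::real measure))"
  shows "(\<lambda>\<omega>. fst (run G c D (A \<omega>) (B \<omega>) (V \<omega>) (R \<omega>) n)) \<in> borel_measurable N \<and>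
    (\<forall>k. Measurable.pred N (\<lambda>\<omega>. k \<in> snd (run G c D (A \<omega>) (B \<omega>) (V \<omega>) (R \<omega>) n)))"
proof (induction n)
  case (Suc n)
  define t where "t \<omega> = fst (run G c D (A \<omega>) (B \<omega>) (V \<omega>) (R \<omega>) n)" for \<omega>
  define S where "S \<omega> = snd (run G c D (A \<omega>) (B \<omega>) (V \<omega>) (R \<omega>) n)" for \<omega>
  have [measurable]: "t \<in> borel_measurable N" "Measurable.pred N (\<lambda>\<omega>. k \<in> S \<omega>)" for k
    using Suc by (auto simp: t_def[abs_def] S_def[abs_def])
  define Q where "Q \<omega> = {k. k \<notin> S \<omega> \<and> attempts c (A \<omega>) (R \<omega>) k \<inter> {t \<omega>..<t \<omega> + G} \<noteq> {}}" for \<omega>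
  have [measurable]: "Measurable.pred N (\<lambda>\<omega>. k \<in> Q \<omega>)" for k
  proof -
    have "Measurable.pred N (\<lambda>\<omega>. k \<notin> S \<omega> \<and> attempts c (A \<omega>) (R \<omega>) k \<inter> {t \<omega>..<t \<omega> + G} \<noteq> {})"
      by (intro pred_intros_logic attempts_hit_measurable) measurable
    then show ?thesis by (simp add: Q_def)
  qed
  have eq: "run G c D (A \<omega>) (B \<omega>) (V \<omega>) (R \<omega>) (Suc n) = (t \<omega> + G + (\<Sum>k\<in>Q \<omega>. B \<omega> k) + V \<omega> n, S \<omega> \<union> Q \<omega>)" for \<omega>
    by (simp add: t_def S_def Q_def Let_def split_beta)
  have [measurable]: "(\<lambda>\<omega>. \<Sum>k\<in>Q \<omega>. B \<omega> k) \<in> borel_measurable N"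
    by (rule sum_random_set_measurable) measurable
  show ?case
    unfolding eq fst_conv snd_conv Un_iff by (intro conjI allI) measurable
qed simp

lemma orbit_size_measurable [measurable (raw)]:
  assumes c[measurable]: "c \<in> N \<rightarrow>\<^sub>M count_space UNIV"
    and [measurable]: "A \<in> N \<rightarrow>\<^sub>M iid (borel::real measure)" "B \<in> N \<rightarrow>\<^sub>M iid (borel::real measure)"
    "V \<in> N \<rightarrow>\<^sub>M iid (borel::real measure)" "R \<in> N \<rightarrow>\<^sub>M iid (iid (borel::real measure))"
  shows "(\<lambda>\<omega>. orbit_size G (c \<omega>) D (A \<omega>) (B \<omega>) (V \<omega>) (R \<omega>) n) \<in> N \<rightarrow>\<^sub>M count_space UNIV"
proof (rule measurable_compose_countable[OF _ c])
  fix c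
  define t where "t \<omega> = fst (run G c D (A \<omega>) (B \<omega>) (V \<omega>) (R \<omega>) n)" for \<omega>
  define S where "S \<omega> = snd (run G c D (A \<omega>) (B \<omega>) (V \<omega>) (R \<omega>) n)" for \<omega>
  have [measurable]: "t \<in> borel_measurable N" "Measurable.pred N (\<lambda>\<omega>. k \<in> S \<omega>)" for k
    using run_measurable[OF assms(2-5)] by (auto simp: t_def[abs_def] S_def[abs_def])
  have eq: "orbit_size G c D (A \<omega>) (B \<omega>) (V \<omega>) (R \<omega>) n =
      card {k. k \<notin> S \<omega> \<and> (k < c \<or> arrival_time c (A \<omega>) k < t \<omega>)}" for \<omega>
    by (simp add: orbit_size_def t_def S_def split_beta)
  show "(\<lambda>\<omega>. orbit_size G c D (A \<omega>) (B \<omega>) (V \<omega>) (R \<omega>) n) \<in> N \<rightarrow>\<^sub>M count_space UNIV"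
    unfolding eq by (rule card_random_set_measurable) (simp, measurable)
qed

section \<open>Independent coordinates\<close>

text \<open>
  Coordinates outside \<open>S\<close> can be redrawn independently of those in \<open>S\<close>. This is independence
  of two infinite blocks in a form that keeps the index set of the product.
\<close>

lemma nn_integral_iid_split:
  assumes N: "prob_space N" and F[measurable]: "F \<in> borel_measurable (iid N)"
  shows "(\<integral>\<^sup>+u. F u \<partial>iid N) = (\<integral>\<^sup>+x. \<integral>\<^sup>+y. F (\<lambda>k::nat. if k \<in> S then x k else y k) \<partial>iid N \<partial>iid N)"
proof -
  interpret N: prob_space "iid N" by (rule prob_space_iid) fact
  interpret N0: prob_space N by fact
  interpret P: product_prob_space "\<lambda>_. N" "UNIV :: nat set" ..
  let ?f = "\<lambda>(x, y) k. if k \<in> S then x k else (y k :: 'a)"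
  have [measurable]: "?f \<in> iid N \<Otimes>\<^sub>M iid N \<rightarrow>\<^sub>M iid N"
  proof (rule measurable_PiM_single')
    fix k :: nat show "(\<lambda>\<omega>. ?f \<omega> k) \<in> iid N \<Otimes>\<^sub>M iid N \<rightarrow>\<^sub>M N"
      by (cases "k \<in> S") (simp_all add: split_beta')
  qed (auto simp: space_pair_measure space_PiM PiE_iff)
  have "distr (iid N \<Otimes>\<^sub>M iid N) (iid N) ?f = iid N"
  proof (rule P.PiM_eq)
    fix J and X :: "nat \<Rightarrow> 'a set"
    assume J: "finite J" "J \<subseteq> UNIV" and X: "\<And>j. j \<in> J \<Longrightarrow> X j \<in> sets N"
    have cyl: "prod_emb UNIV (\<lambda>_. N) J' (Pi\<^sub>E J' X) = {u \<in> space (iid N). \<forall>j\<in>J'. u j \<in> X j}" for J'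
      by (auto simp: prod_emb_def space_PiM PiE_iff)
    have s: "prod_emb UNIV (\<lambda>_. N) J' (Pi\<^sub>E J' X) \<in> sets (iid N)" if "J' \<subseteq> J" for J'
      using J X that by (intro sets_PiM_I) (auto intro: finite_subset)
    have "emeasure (distr (iid N \<Otimes>\<^sub>M iid N) (iid N) ?f) (prod_emb UNIV (\<lambda>_. N) J (Pi\<^sub>E J X)) =
      emeasure (iid N \<Otimes>\<^sub>M iid N) (?f -` prod_emb UNIV (\<lambda>_. N) J (Pi\<^sub>E J X) \<inter> space (iid N \<Otimes>\<^sub>M iid N))"
      using s by (intro emeasure_distr) auto
    also have "?f -` prod_emb UNIV (\<lambda>_. N) J (Pi\<^sub>E J X) \<inter> space (iid N \<Otimes>\<^sub>M iid N) =
       prod_emb UNIV (\<lambda>_. N) (J \<inter> S) (Pi\<^sub>E (J \<inter> S) X) \<times> prod_emb UNIV (\<lambda>_. N) (J - S) (Pi\<^sub>E (J - S) X)"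
      unfolding cyl by (auto simp: space_pair_measure space_PiM PiE_iff split: if_splits)
    also have "emeasure (iid N \<Otimes>\<^sub>M iid N) \<dots> = (\<Prod>j\<in>J \<inter> S. emeasure N (X j)) * (\<Prod>j\<in>J - S. emeasure N (X j))"
      using J X
      by (subst N.emeasure_pair_measure_Times)
         (auto intro!: s P.emeasure_PiM_emb arg_cong2[where f = "(*)"])
    also have "\<dots> = (\<Prod>j\<in>J. emeasure N (X j))"
      using J by (subst prod.union_disjoint[symmetric]) (auto intro!: prod.cong)
    finally show "emeasure (distr (iid N \<Otimes>\<^sub>M iid N) (iid N) ?f) (prod_emb UNIV (\<lambda>_. N) J (Pi\<^sub>E J X)) =
      (\<Prod>j\<in>J. emeasure N (X j))" .
  qed simp
  then have "(\<integral>\<^sup>+u. F u \<partial>iid N) = (\<integral>\<^sup>+u. F u \<partial>distr (iid N \<Otimes>\<^sub>M iid N) (iid N) ?f)"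
    by simp
  also have "\<dots> = (\<integral>\<^sup>+p. F (?f p) \<partial>(iid N \<Otimes>\<^sub>M iid N))"
    by (rule nn_integral_distr) measurable
  also have "\<dots> = (\<integral>\<^sup>+x. \<integral>\<^sup>+y. F (?f (x, y)) \<partial>iid N \<partial>iid N)"
    by (rule N.nn_integral_fst[symmetric]) measurable
  finally show ?thesis by simp
qed

lemma nn_integral_iid_component:
  assumes N: "prob_space N" and F[measurable]: "F \<in> borel_measurable N"
  shows "(\<integral>\<^sup>+u. F (u k) \<partial>iid N) = (\<integral>\<^sup>+x. F x \<partial>N)"
proof -
  interpret N0: prob_space N by fact
  interpret P: product_prob_space "\<lambda>_. N" "UNIV :: nat set" ..
  have "(\<integral>\<^sup>+x. F x \<partial>N) = (\<integral>\<^sup>+x. F x \<partial>distr (iid N) N (\<lambda>u. u k))"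
    using P.PiM_component[of k] by simp
  then show ?thesis by (simp add: nn_integral_distr)
qed

lemma fun_upd_iid_measurable [measurable (raw)]:
  assumes [measurable]: "y \<in> L \<rightarrow>\<^sub>M iid N" "x \<in> L \<rightarrow>\<^sub>M N"
  shows "(\<lambda>\<omega>. (y \<omega>)(k := x \<omega>)) \<in> L \<rightarrow>\<^sub>M iid N"
proof (rule measurable_PiM_single')
  fix i show "(\<lambda>\<omega>. ((y \<omega>)(k := x \<omega>)) i) \<in> L \<rightarrow>\<^sub>M N"
    by (cases "i = k") simp_all
next
  show "(\<lambda>\<omega>. (y \<omega>)(k := x \<omega>)) \<in> space L \<rightarrow> UNIV \<rightarrow>\<^sub>E space N"
    using measurable_space[OF assms(1)] measurable_space[OF assms(2)] by (auto simp: space_PiM PiE_iff)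
qed

lemma nn_integral_iid_upd:
  assumes N: "prob_space N" and F[measurable]: "F \<in> borel_measurable (iid N)"
  shows "(\<integral>\<^sup>+u. F u \<partial>iid N) = (\<integral>\<^sup>+y. \<integral>\<^sup>+x. F (y(k := x)) \<partial>N \<partial>iid N)"
proof -
  interpret N: prob_space "iid N" by (rule prob_space_iid) fact
  interpret N0: prob_space N by fact
  interpret NN: pair_sigma_finite "iid N" "iid N" ..
  have "(\<integral>\<^sup>+u. F u \<partial>iid N) = (\<integral>\<^sup>+x. \<integral>\<^sup>+y. F (y(k := x k)) \<partial>iid N \<partial>iid N)"
    by (subst nn_integral_iid_split[OF N F, of "{k}"]) (auto simp: fun_upd_def intro!: nn_integral_cong arg_cong[where f = F])
  also have "\<dots> = (\<integral>\<^sup>+y. \<integral>\<^sup>+x. F (y(k := x k)) \<partial>iid N \<partial>iid N)"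
    by (rule NN.Fubini') measurable
  also have "\<dots> = (\<integral>\<^sup>+y. \<integral>\<^sup>+x. F (y(k := x)) \<partial>N \<partial>iid N)"
    by (intro nn_integral_cong nn_integral_iid_component[OF N]) measurable
  finally show ?thesis .
qed

lemma distr_iid_coordinatewise:
  assumes N: "prob_space N" and phi: "\<And>k. \<phi> k \<in> N \<rightarrow>\<^sub>M N" "\<And>k. distr N N (\<phi> k) = N"
  shows "distr (iid N) (iid N) (\<lambda>r k::nat. \<phi> k (r k)) = iid N"
proof -
  interpret N0: prob_space N by fact
  interpret P: product_prob_space "\<lambda>_. N" "UNIV :: nat set" ..
  note phi(1)[measurable]
  let ?f = "\<lambda>r k::nat. \<phi> k (r k)"
  have [measurable]: "?f \<in> iid N \<rightarrow>\<^sub>M iid N"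
    by (rule measurable_PiM_single') (auto simp: space_PiM intro: measurable_space[OF phi(1)])
  show ?thesis
  proof (rule P.PiM_eq)
    fix J and X :: "nat \<Rightarrow> 'a set"
    assume J: "finite J" "J \<subseteq> UNIV" and X: "\<And>j. j \<in> J \<Longrightarrow> X j \<in> sets N"
    have "emeasure (distr (iid N) (iid N) ?f) (prod_emb UNIV (\<lambda>_. N) J (Pi\<^sub>E J X)) =
      emeasure (iid N) (?f -` prod_emb UNIV (\<lambda>_. N) J (Pi\<^sub>E J X) \<inter> space (iid N))"
      using J X by (intro emeasure_distr sets_PiM_I) auto
    also have "?f -` prod_emb UNIV (\<lambda>_. N) J (Pi\<^sub>E J X) \<inter> space (iid N) =
       prod_emb UNIV (\<lambda>_. N) J (Pi\<^sub>E J (\<lambda>j. \<phi> j -` X j \<inter> space N))"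
      using measurable_space[OF phi(1)] by (auto simp: prod_emb_def space_PiM PiE_iff)
    also have "emeasure (iid N) \<dots> = (\<Prod>j\<in>J. emeasure N (\<phi> j -` X j \<inter> space N))"
      using J X by (intro P.emeasure_PiM_emb) auto
    also have "\<dots> = (\<Prod>j\<in>J. emeasure (distr N N (\<phi> j)) (X j))"
      using X by (intro prod.cong) (auto simp: emeasure_distr)
    finally show "emeasure (distr (iid N) (iid N) ?f) (prod_emb UNIV (\<lambda>_. N) J (Pi\<^sub>E J X)) =
      (\<Prod>j\<in>J. emeasure N (X j))" by (simp add: phi(2))
  qed simp
qed

text \<open>
  If on every coordinate the event \<open>P k\<close> is independent of \<open>\<phi> k\<close> and \<open>\<phi> k\<close> preserves the measure,
  then all these events together are independent of the transformed sequence. The coordinates in \<open>U\<close>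
  are treated one at a time, by integrating out coordinate \<open>j\<close> first.
\<close>

lemma nn_integral_iid_coordinatewise:
  assumes N: "prob_space N" and U: "finite U"
  shows "\<lbrakk>\<And>k. \<phi> k \<in> N \<rightarrow>\<^sub>M N; \<And>k. Measurable.pred N (P k); F \<in> borel_measurable (iid N);
      \<And>k. k \<notin> U \<Longrightarrow> distr N N (\<phi> k) = N;
      \<And>k F. k \<in> U \<Longrightarrow> F \<in> borel_measurable N \<Longrightarrow>
         (\<integral>\<^sup>+x. (if P k x then F (\<phi> k x) else 0) \<partial>N) = w k * (\<integral>\<^sup>+x. F x \<partial>N)\<rbrakk> \<Longrightarrow>
     (\<integral>\<^sup>+r. (if \<forall>k\<in>U. P k (r k) then F (\<lambda>k. \<phi> k (r k)) else 0) \<partial>iid N) = (\<Prod>k\<in>U. w k) * (\<integral>\<^sup>+r. F r \<partial>iid N)"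
  using U
proof (induction U arbitrary: \<phi> F rule: finite_induct)
  case empty
  note [measurable] = empty(1-3)
  have [measurable]: "(\<lambda>r k. \<phi> k (r k)) \<in> iid N \<rightarrow>\<^sub>M iid N"
    by (rule measurable_PiM_single') (auto simp: space_PiM intro: measurable_space[OF empty(1)])
  have "(\<integral>\<^sup>+r. F r \<partial>iid N) = (\<integral>\<^sup>+r. F r \<partial>distr (iid N) (iid N) (\<lambda>r k. \<phi> k (r k)))"
    using empty(4) by (subst distr_iid_coordinatewise[OF N empty(1)]) auto
  then show ?case by (simp add: nn_integral_distr)
next
  case (insert j U)
  note [measurable] = insert.prems(1-3)
  interpret N: prob_space "iid N" by (rule prob_space_iid) fact
  interpret N0: prob_space N by fact
  define \<phi>' where "\<phi>' = \<phi>(j := \<lambda>x. x)"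
  \<comment> \<open>Coordinate \<open>j\<close> is transformed inside \<open>F'\<close>, so that the induction hypothesis leaves it alone.\<close>
  define F' where "F' r = (if P j (r j) then F (r(j := \<phi> j (r j))) else 0)" for r
  have F'[measurable]: "F' \<in> borel_measurable (iid N)" unfolding F'_def by measurable
  have "(\<integral>\<^sup>+r. (if \<forall>k\<in>insert j U. P k (r k) then F (\<lambda>k. \<phi> k (r k)) else 0) \<partial>iid N) =
        (\<integral>\<^sup>+r. (if \<forall>k\<in>U. P k (r k) then F' (\<lambda>k. \<phi>' k (r k)) else 0) \<partial>iid N)"
    by (intro nn_integral_cong) (auto simp: F'_def \<phi>'_def fun_upd_def intro!: arg_cong[where f = F])
  also have "\<dots> = (\<Prod>k\<in>U. w k) * (\<integral>\<^sup>+r. F' r \<partial>iid N)"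
  proof (rule insert.IH)
    show "\<phi>' k \<in> N \<rightarrow>\<^sub>M N" for k by (simp add: \<phi>'_def)
    show "distr N N (\<phi>' k) = N" if "k \<notin> U" for k
      using that insert.prems(4)[of k] by (simp add: \<phi>'_def distr_id2)
    show "(\<integral>\<^sup>+x. (if P k x then F (\<phi>' k x) else 0) \<partial>N) = w k * (\<integral>\<^sup>+x. F x \<partial>N)"
      if "k \<in> U" "F \<in> borel_measurable N" for k F
    proof -
      have "\<phi>' k = \<phi> k" using that(1) insert.hyps by (auto simp: \<phi>'_def)
      then show ?thesis unfolding \<open>\<phi>' k = \<phi> k\<close> using that by (intro insert.prems(5)) auto
    qed
  qed (use F' insert.prems(2) in auto)
  also have "(\<integral>\<^sup>+r. F' r \<partial>iid N) = (\<integral>\<^sup>+y. \<integral>\<^sup>+x. F' (y(j := x)) \<partial>N \<partial>iid N)"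
    by (rule nn_integral_iid_upd[OF N]) measurable
  also have "\<dots> = (\<integral>\<^sup>+y. \<integral>\<^sup>+x. (if P j x then (\<lambda>x. F (y(j := x))) (\<phi> j x) else 0) \<partial>N \<partial>iid N)"
    by (simp add: F'_def cong: if_cong)
  also have "\<dots> = (\<integral>\<^sup>+y. w j * (\<integral>\<^sup>+x. F (y(j := x)) \<partial>N) \<partial>iid N)"
    by (intro nn_integral_cong insert.prems(5)) measurable
  also have "\<dots> = w j * (\<integral>\<^sup>+y. \<integral>\<^sup>+x. F (y(j := x)) \<partial>N \<partial>iid N)"
    by (rule nn_integral_cmult) measurable
  also have "(\<integral>\<^sup>+y. \<integral>\<^sup>+x. F (y(j := x)) \<partial>N \<partial>iid N) = (\<integral>\<^sup>+r. F r \<partial>iid N)"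
    by (rule nn_integral_iid_upd[OF N, symmetric]) measurable
  finally show ?case using insert.hyps by (simp add: ac_simps)
qed

section \<open>The one-cycle transition\<close>

text \<open>
  The laws of the model without an underlying probability space: paths are integrated against
  product measures, one source of randomness at a time.
\<close>

locale glue_laws =
  fixes lam \<nu> G :: real and FB FS :: "real measure"
  assumes lam_pos: "0 < lam" and nu_pos: "0 < \<nu>" and G_pos: "0 < G"
    and FB_prob: "prob_space FB" and FB_sets [measurable_cong]: "sets FB = sets borel"
    and FS_prob: "prob_space FS" and FS_sets [measurable_cong]: "sets FS = sets borel"
    and FB_nonneg: "AE b in FB. 0 \<le> b" and FS_nonneg: "AE s in FS. 0 \<le> s"
begin

abbreviation "PA \<equiv> iid (expm lam)"
abbreviation "PB \<equiv> iid FB"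
abbreviation "PV \<equiv> iid FS"
abbreviation "PE \<equiv> iid (expm \<nu>)"
abbreviation "PR \<equiv> iid (iid (expm \<nu>))"

sublocale A: prob_space PA by (intro prob_space_iid prob_space_expm lam_pos)
sublocale B: prob_space PB by (intro prob_space_iid FB_prob)
sublocale V: prob_space PV by (intro prob_space_iid FS_prob)
sublocale E: prob_space PE by (intro prob_space_iid prob_space_expm nu_pos)
sublocale R: prob_space PR by (intro prob_space_iid prob_space_expm nu_pos)

definition size_indicator :: "nat \<Rightarrow> nat \<Rightarrow> nat set \<Rightarrow> nat \<Rightarrow> (nat \<Rightarrow> real) \<Rightarrow> (nat \<Rightarrow> real) \<Rightarrow> (nat \<Rightarrow> real) \<Rightarrow> (nat \<Rightarrow> nat \<Rightarrow> real) \<Rightarrow> ennreal" where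
  "size_indicator n m D c A B V R = (if orbit_size G c D A B V R n = m then 1 else 0)"

definition orbit_prob :: "nat \<Rightarrow> nat \<Rightarrow> nat set \<Rightarrow> nat \<Rightarrow> ennreal" where
  "orbit_prob n m D c = (\<integral>\<^sup>+V. \<integral>\<^sup>+B. \<integral>\<^sup>+A. \<integral>\<^sup>+R. size_indicator n m D c A B V R \<partial>PR \<partial>PA \<partial>PB \<partial>PV)"

definition stick_prob :: real where "stick_prob = 1 - exp (- \<nu> * G)"

lemma stick_prob_bounds: "0 \<le> stick_prob" "stick_prob \<le> 1"
  using nu_pos G_pos by (auto simp: stick_prob_def)

text \<open>
  The probability that, of the customers \<open>U\<close> in orbit, exactly those in \<open>Q\<close> retry in a glue period.
\<close>

definition stick_weight :: "nat set \<Rightarrow> nat set \<Rightarrow> ennreal" where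
  "stick_weight U Q = (\<Prod>k\<in>U. ennreal (if k \<in> Q then stick_prob else 1 - stick_prob))"

lemma size_indicator_measurable [measurable (raw)]:
  assumes [measurable]: "c \<in> N \<rightarrow>\<^sub>M count_space UNIV"
    "A \<in> N \<rightarrow>\<^sub>M iid (borel::real measure)" "B \<in> N \<rightarrow>\<^sub>M iid (borel::real measure)"
    "V \<in> N \<rightarrow>\<^sub>M iid (borel::real measure)" "R \<in> N \<rightarrow>\<^sub>M iid (iid (borel::real measure))"
  shows "(\<lambda>\<omega>. size_indicator n m D (c \<omega>) (A \<omega>) (B \<omega>) (V \<omega>) (R \<omega>)) \<in> borel_measurable N"
  unfolding size_indicator_def by measurable

lemma sets_PR [measurable_cong]: "sets PR = sets (iid (iid (borel :: real measure)))"
  by (intro sets_PiM_cong) auto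

lemma shift_measurable [measurable (raw)]:
  assumes [measurable]: "V \<in> N \<rightarrow>\<^sub>M iid (borel::real measure)"
  shows "(\<lambda>\<omega> j. V \<omega> (Suc j)) \<in> N \<rightarrow>\<^sub>M iid borel"
  by (rule measurable_PiM_single') (auto simp: space_PiM)

lemma in_space_iid [measurable]: "(u :: nat \<Rightarrow> real) \<in> space (iid borel)"
  by (simp add: space_PiM)

lemma passage_residual_measurable:
  assumes F: "\<And>m. F m \<in> borel_measurable (iid (borel :: real measure))"
  shows "(\<lambda>u. F (passage t u) (residual t u)) \<in> borel_measurable (iid borel)"
proof (rule measurable_compose_countable[where f = "\<lambda>m u. F m (residual t u)" and g = "passage t"])
  show "(\<lambda>u. F m (residual t u)) \<in> borel_measurable (iid borel)" for m
    by (rule measurable_compose[OF _ F]) measurable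
qed measurable

lemma nn_integral_residual:
  assumes r: "0 < r" and t: "0 \<le> t" and [measurable]: "F \<in> borel_measurable (iid borel)"
  shows "(\<integral>\<^sup>+u. F (residual t u) \<partial>iid (expm r)) = (\<integral>\<^sup>+u. F u \<partial>iid (expm r))"
  using nn_integral_renewal[OF r t, of "\<lambda>_. F"] r t by (simp add: suminf_pois)

lemma distr_residual:
  assumes r: "0 < r" and t: "0 \<le> t"
  shows "distr (iid (expm r)) (iid (expm r)) (residual t) = iid (expm r)"
proof (rule measure_eqI)
  have [measurable]: "residual t \<in> iid (expm r) \<rightarrow>\<^sub>M iid (expm r)" by measurable
  fix X assume "X \<in> sets (distr (iid (expm r)) (iid (expm r)) (residual t))"
  then have X[measurable]: "X \<in> sets (iid (expm r))" by simp
  have "emeasure (distr (iid (expm r)) (iid (expm r)) (residual t)) X =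
     (\<integral>\<^sup>+u. indicator X u \<partial>distr (iid (expm r)) (iid (expm r)) (residual t))"
    by simp
  also have "\<dots> = (\<integral>\<^sup>+u. indicator X (residual t u) \<partial>iid (expm r))"
    by (rule nn_integral_distr) measurable
  also have "\<dots> = (\<integral>\<^sup>+u. indicator X u \<partial>iid (expm r))"
    by (rule nn_integral_residual[OF r t]) measurable
  finally show "emeasure (distr (iid (expm r)) (iid (expm r)) (residual t)) X = emeasure (iid (expm r)) X"
    by simp
qed simp

text \<open>
  Whether a customer retries before \<open>G\<close> is a statement about its number of renewals before \<open>G\<close>; its
  retrials seen at \<open>G + t\<close> are a function of its residual sequence at \<open>G\<close>. The two are independent.
\<close>

lemma nn_integral_retrial_coordinate:
  assumes t: "0 \<le> t" and [measurable]: "F \<in> borel_measurable (iid borel)"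
  shows "(\<integral>\<^sup>+u. (if (passage G u \<noteq> 0) = b then F (residual (G + t) u) else 0) \<partial>PE) =
      ennreal (if b then stick_prob else 1 - stick_prob) * (\<integral>\<^sup>+u. F u \<partial>PE)"
proof -
  have "(\<integral>\<^sup>+u. (if (passage G u \<noteq> 0) = b then F (residual (G + t) u) else 0) \<partial>PE) =
     (\<integral>\<^sup>+u. (if (passage G u \<noteq> 0) = b then F (residual t (residual G u)) else 0) \<partial>PE)"
    by (rule nn_integral_cong_AE, use AE_renewing[OF nu_pos] in eventually_elim)
       (simp add: residual_add t cong: if_cong)
  also have "\<dots> = (\<Sum>m. ennreal (pois (\<nu> * G) m) * (\<integral>\<^sup>+u. (if (m \<noteq> 0) = b then F (residual t u) else 0) \<partial>PE))"
    using G_pos by (intro nn_integral_renewal nu_pos) auto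
  also have "\<dots> = (\<Sum>m. ennreal (if (m \<noteq> 0) = b then pois (\<nu> * G) m else 0) * (\<integral>\<^sup>+u. F u \<partial>PE))"
    by (intro suminf_cong) (auto simp: nn_integral_residual nu_pos t)
  also have "\<dots> = (\<Sum>m. ennreal (if (m \<noteq> 0) = b then pois (\<nu> * G) m else 0)) * (\<integral>\<^sup>+u. F u \<partial>PE)"
    by simp
  also have "(\<Sum>m. ennreal (if (m \<noteq> 0) = b then pois (\<nu> * G) m else 0)) =
      ennreal (if b then stick_prob else 1 - stick_prob)"
  proof -
    have 0: "(\<lambda>m. if m = 0 then pois (\<nu> * G) m else 0) sums pois (\<nu> * G) 0"
      by (rule sums_single)
    have "(\<lambda>m. pois (\<nu> * G) m - (if m = 0 then pois (\<nu> * G) m else 0)) sums (1 - pois (\<nu> * G) 0)"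
      by (intro sums_diff pois_sums 0)
    also have "(\<lambda>m. pois (\<nu> * G) m - (if m = 0 then pois (\<nu> * G) m else 0)) = (\<lambda>m. if m \<noteq> 0 then pois (\<nu> * G) m else 0)"
      by auto
    finally have "(\<lambda>m. if (m \<noteq> 0) = b then pois (\<nu> * G) m else 0) sums (if b then stick_prob else 1 - stick_prob)"
      using 0 by (cases b) (auto simp: stick_prob_def pois_def)
    then show ?thesis
      using nu_pos G_pos by (subst suminf_ennreal2) (auto simp: pois_nonneg sums_iff)
  qed
  finally show ?thesis .
qed

lemma AE_retrials_renewing: "AE R in PR. \<forall>k. renewing (R k)"
  unfolding AE_all_countable
  by (intro allI AE_PiM_component prob_space_iid prob_space_expm nu_pos AE_renewing) simp

text \<open>
  With arrivals, services and vacations fixed, the length of the first cycle depends on the retrials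
  only through the set \<open>Q\<close> of customers in orbit that retry before \<open>G\<close>. After splitting according
  to \<open>Q\<close>, every retrial sequence is inspected at a fixed time and can be replaced by a fresh one.
\<close>

lemma nn_integral_retrials:
  fixes c n m :: nat
  assumes A: "renewing A" and B: "\<And>k. 0 \<le> B k" and V: "\<And>k. 0 \<le> V k" and D: "D \<subseteq> {..<c}"
  defines "N \<equiv> passage G A"
  defines "\<tau> \<equiv> \<lambda>Q. sum B (Q \<union> {c..<c + N}) + V 0"
  shows "(\<integral>\<^sup>+R. size_indicator (Suc n) m D c A B V R \<partial>PR) =
    (\<Sum>Q\<in>Pow ({..<c} - D). stick_weight ({..<c} - D) Q *
      (\<integral>\<^sup>+R. size_indicator n m (D \<union> (Q \<union> {c..<c + N})) (c + (N + passage (\<tau> Q) (residual G A)))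
         (residual (\<tau> Q) (residual G A)) B (\<lambda>j. V (Suc j)) R \<partial>PR))"
proof -
  define U where "U = {..<c} - D"
  have U: "finite U" by (simp add: U_def)
  define F where "F Q = size_indicator n m (D \<union> (Q \<union> {c..<c + N})) (c + (N + passage (\<tau> Q) (residual G A)))
         (residual (\<tau> Q) (residual G A)) B (\<lambda>j. V (Suc j))" for Q
  define \<phi> where "\<phi> Q k u = (if arrival_time c A k < G + \<tau> Q then residual (G + \<tau> Q - arrival_time c A k) u else u)" for Q k u
  define P where "P Q k u \<longleftrightarrow> (passage G u \<noteq> 0) = (k \<in> Q)" for Q and k :: nat and u
  have tau: "0 \<le> \<tau> Q" for Q using B V by (simp add: \<tau>_def sum_nonneg)
  have delayed: "delayed c A (G + \<tau> Q) R = (\<lambda>k. \<phi> Q k (R k))" for Q R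
    by (simp add: fun_eq_iff delayed_def \<phi>_def)
  have F_meas[measurable]: "F Q \<in> borel_measurable (iid (iid borel))" for Q
    unfolding F_def by measurable
  have P_meas: "Measurable.pred PE (P Q k)" for Q k
    unfolding P_def by measurable
  have phi_meas: "\<phi> Q k \<in> PE \<rightarrow>\<^sub>M PE" for Q k
    unfolding \<phi>_def by measurable
  have [measurable]: "(\<lambda>R. if \<forall>k\<in>U. P Q k (R k) then F Q (\<lambda>k. \<phi> Q k (R k)) else 0) \<in> borel_measurable PR" for Q
    unfolding delayed[symmetric] P_def using U by measurable
  \<comment> \<open>Exactly one summand is nonzero, that of the set of customers that do retry.\<close>
  have "(\<integral>\<^sup>+R. size_indicator (Suc n) m D c A B V R \<partial>PR) =
    (\<integral>\<^sup>+R. (\<Sum>Q\<in>Pow U. if \<forall>k\<in>U. P Q k (R k) then F Q (\<lambda>k. \<phi> Q k (R k)) else 0) \<partial>PR)"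
  proof (rule nn_integral_cong_AE, use AE_retrials_renewing in eventually_elim)
    case (elim R)
    define Q where "Q = {k\<in>U. passage G (R k) \<noteq> 0}"
    have "(\<forall>k\<in>U. P Q' k (R k)) \<longleftrightarrow> Q' = Q" if "Q' \<in> Pow U" for Q'
      using that by (auto simp: P_def Q_def)
    then have "(\<Sum>Q\<in>Pow U. if \<forall>k\<in>U. P Q k (R k) then F Q (\<lambda>k. \<phi> Q k (R k)) else 0) =
       (\<Sum>Q'\<in>Pow U. if Q' = Q then F Q' (\<lambda>k. \<phi> Q' k (R k)) else 0)"
      by (intro sum.cong) auto
    also have "\<dots> = F Q (delayed c A (G + \<tau> Q) R)"
      using U by (simp add: delayed Q_def)
    also have "\<dots> = size_indicator (Suc n) m D c A B V R"
      unfolding size_indicator_def F_def using orbit_size_Suc[OF A _ B V G_pos D, where R = R and n = n] elim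
      by (simp add: \<tau>_def Q_def N_def U_def)
    finally show ?case ..
  qed
  also have "\<dots> = (\<Sum>Q\<in>Pow U. \<integral>\<^sup>+R. (if \<forall>k\<in>U. P Q k (R k) then F Q (\<lambda>k. \<phi> Q k (R k)) else 0) \<partial>PR)"
    by (rule nn_integral_sum) measurable
  also have "\<dots> = (\<Sum>Q\<in>Pow U. stick_weight U Q * (\<integral>\<^sup>+R. F Q R \<partial>PR))"
    unfolding stick_weight_def
  proof (intro sum.cong refl nn_integral_iid_coordinatewise U phi_meas P_meas)
    fix Q
    show "F Q \<in> borel_measurable PR" by measurable
    show "distr PE PE (\<phi> Q k) = PE" for k
    proof (cases "arrival_time c A k < G + \<tau> Q")
      case True
      then have "\<phi> Q k = residual (G + \<tau> Q - arrival_time c A k)" by (simp add: \<phi>_def fun_eq_iff)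
      then show ?thesis using True by (simp add: distr_residual nu_pos)
    next
      case False
      then have "\<phi> Q k = (\<lambda>u. u)" by (simp add: \<phi>_def fun_eq_iff)
      then show ?thesis by (simp add: distr_id2)
    qed
    show "(\<integral>\<^sup>+u. (if P Q k u then H (\<phi> Q k u) else 0) \<partial>PE) =
      ennreal (if k \<in> Q then stick_prob else 1 - stick_prob) * (\<integral>\<^sup>+u. H u \<partial>PE)"
      if k: "k \<in> U" and H[measurable]: "H \<in> borel_measurable PE" for k H
    proof -
      have "arrival_time c A k = 0" using k by (simp add: U_def arrival_time_old)
      then have phi: "\<phi> Q k = residual (G + \<tau> Q)" using G_pos tau[of Q] by (simp add: \<phi>_def fun_eq_iff)
      show ?thesis unfolding phi P_def by (rule nn_integral_retrial_coordinate[OF tau]) measurable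
    qed
  qed (auto intro!: prob_space_iid prob_space_expm nu_pos)
  finally show ?thesis by (simp add: F_def U_def)
qed

text \<open>
  Next the arrivals are replaced: \<open>N\<close> of them come before \<open>G\<close>, and \<open>N\<close> fixes the length \<open>\<tau>\<close> of
  the rest of the cycle, in which \<open>M\<close> more arrive. Memorylessness is applied at \<open>G\<close> and then at \<open>\<tau>\<close>.
\<close>

lemma nn_integral_arrivals:
  fixes c n m :: nat
  assumes B: "\<And>k. 0 \<le> B k" and V: "\<And>k. 0 \<le> V k" and D: "D \<subseteq> {..<c}"
  shows "(\<integral>\<^sup>+A. \<integral>\<^sup>+R. size_indicator (Suc n) m D c A B V R \<partial>PR \<partial>PA) =
    (\<Sum>Q\<in>Pow ({..<c} - D). stick_weight ({..<c} - D) Q *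
      (\<Sum>N. ennreal (pois (lam * G) N) * (\<Sum>M. ennreal (pois (lam * (sum B (Q \<union> {c..<c + N}) + V 0)) M) *
      (\<integral>\<^sup>+A. \<integral>\<^sup>+R. size_indicator n m (D \<union> (Q \<union> {c..<c + N})) (c + (N + M)) A B (\<lambda>j. V (Suc j)) R \<partial>PR \<partial>PA))))"
proof -
  define \<tau> where "\<tau> Q N = sum B (Q \<union> {c..<c + N}) + V 0" for Q N
  have tau: "0 \<le> \<tau> Q N" for Q N using B V by (simp add: \<tau>_def sum_nonneg)
  define H where "H Q N M A = (\<integral>\<^sup>+R. size_indicator n m (D \<union> (Q \<union> {c..<c + N})) (c + (N + M)) A B (\<lambda>j. V (Suc j)) R \<partial>PR)" for Q N M A
  have H_meas[measurable]: "H Q N M \<in> borel_measurable (iid borel)" for Q N M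
    unfolding H_def by measurable
  have H_res[measurable]: "(\<lambda>A. H Q N (passage t A) (residual t A)) \<in> borel_measurable (iid borel)" for Q N t
    by (rule passage_residual_measurable) measurable
  have [measurable]: "(\<lambda>A. H Q (passage G A) (passage (\<tau> Q (passage G A)) (residual G A))
      (residual (\<tau> Q (passage G A)) (residual G A))) \<in> borel_measurable (iid borel)" for Q
    by (rule passage_residual_measurable[where F = "\<lambda>N A. H Q N (passage (\<tau> Q N) A) (residual (\<tau> Q N) A)"]) measurable
  have "(\<integral>\<^sup>+A. \<integral>\<^sup>+R. size_indicator (Suc n) m D c A B V R \<partial>PR \<partial>PA) =
    (\<integral>\<^sup>+A. (\<Sum>Q\<in>Pow ({..<c} - D). stick_weight ({..<c} - D) Q *
       H Q (passage G A) (passage (\<tau> Q (passage G A)) (residual G A)) (residual (\<tau> Q (passage G A)) (residual G A))) \<partial>PA)"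
    by (rule nn_integral_cong_AE, use AE_renewing[OF lam_pos] in eventually_elim)
       (simp add: nn_integral_retrials[OF _ B V D] H_def \<tau>_def)
  also have "\<dots> = (\<Sum>Q\<in>Pow ({..<c} - D). stick_weight ({..<c} - D) Q *
      (\<integral>\<^sup>+A. H Q (passage G A) (passage (\<tau> Q (passage G A)) (residual G A))
        (residual (\<tau> Q (passage G A)) (residual G A)) \<partial>PA))"
    by (subst nn_integral_sum) (measurable, intro sum.cong refl nn_integral_cmult, measurable)
  also have "\<dots> = (\<Sum>Q\<in>Pow ({..<c} - D). stick_weight ({..<c} - D) Q *
      (\<Sum>N. ennreal (pois (lam * G) N) * (\<integral>\<^sup>+A. H Q N (passage (\<tau> Q N) A) (residual (\<tau> Q N) A) \<partial>PA)))"
    by (intro sum.cong refl arg_cong2[where f = "(*)"]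
         nn_integral_renewal[OF lam_pos, where F = "\<lambda>N A. H _ N (passage (\<tau> _ N) A) (residual (\<tau> _ N) A)"])
       (use G_pos in simp, measurable)
  also have "\<dots> = (\<Sum>Q\<in>Pow ({..<c} - D). stick_weight ({..<c} - D) Q *
      (\<Sum>N. ennreal (pois (lam * G) N) * (\<Sum>M. ennreal (pois (lam * \<tau> Q N) M) * (\<integral>\<^sup>+A. H Q N M A \<partial>PA))))"
    by (intro sum.cong suminf_cong refl arg_cong2[where f = "(*)"] nn_integral_renewal[OF lam_pos tau]) measurable
  finally show ?thesis by (simp add: H_def \<tau>_def)
qed

text \<open>
  The probability of \<open>M\<close> arrivals while the customers in \<open>Q\<close> are served and the vacation is taken.
\<close>

definition work_prob :: "nat set \<Rightarrow> nat \<Rightarrow> ennreal" where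
  "work_prob Q M = (\<integral>\<^sup>+V. \<integral>\<^sup>+B. ennreal (pois (lam * (sum B Q + V 0)) M) \<partial>PB \<partial>PV)"

text \<open>
  The number of arrivals during the visit and vacation depends on the services of \<open>Q\<close> and on the first
  vacation, the continuation only on the services outside \<open>D\<close> and on the later vacations.
\<close>

lemma nn_integral_services:
  assumes Q: "Q \<subseteq> D"
  shows "(\<integral>\<^sup>+V. \<integral>\<^sup>+B. ennreal (pois (lam * (sum B Q + V 0)) M) *
      (\<integral>\<^sup>+A. \<integral>\<^sup>+R. size_indicator n m D c A B (\<lambda>j. V (Suc j)) R \<partial>PR \<partial>PA) \<partial>PB \<partial>PV) = work_prob Q M * orbit_prob n m D c"
proof -
  define L where "L B V = (\<integral>\<^sup>+A. \<integral>\<^sup>+R. size_indicator n m D c A B V R \<partial>PR \<partial>PA)" for B V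
  have L_meas[measurable]: "(\<lambda>\<omega>. L (B \<omega>) (V \<omega>)) \<in> borel_measurable N"
    if [measurable]: "B \<in> N \<rightarrow>\<^sub>M iid borel" "V \<in> N \<rightarrow>\<^sub>M iid borel" for B V and N :: "'z measure"
    unfolding L_def by measurable
  have L_cong: "L (\<lambda>k. if k \<in> D then x k else y k) V = L y V" for x y V
    unfolding L_def size_indicator_def by (simp cong: if_cong add: orbit_size_cong_unserved[of D "\<lambda>k. if k \<in> D then x k else y k" y])
  have sum_cong: "sum (\<lambda>k. if k \<in> D then x k else y k) Q = sum x Q" for x y :: "nat \<Rightarrow> real"
    using Q by (intro sum.cong) auto
  have services: "(\<integral>\<^sup>+B. ennreal (pois (lam * (sum B Q + v)) M) * L B V \<partial>PB) =
     (\<integral>\<^sup>+B. ennreal (pois (lam * (sum B Q + v)) M) \<partial>PB) * (\<integral>\<^sup>+B. L B V \<partial>PB)" for v V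
  proof -
    have "(\<integral>\<^sup>+B. ennreal (pois (lam * (sum B Q + v)) M) * L B V \<partial>PB) =
      (\<integral>\<^sup>+x. \<integral>\<^sup>+y. ennreal (pois (lam * (sum x Q + v)) M) * L y V \<partial>PB \<partial>PB)"
      by (subst nn_integral_iid_split[OF FB_prob, where S = D]) (measurable, simp add: L_cong sum_cong)
    also have "\<dots> = (\<integral>\<^sup>+x. ennreal (pois (lam * (sum x Q + v)) M) * (\<integral>\<^sup>+y. L y V \<partial>PB) \<partial>PB)"
      by (intro nn_integral_cong nn_integral_cmult) measurable
    finally show ?thesis by (simp add: nn_integral_multc)
  qed
  have [measurable]: "(\<lambda>V. (\<integral>\<^sup>+B. ennreal (pois (lam * (sum B Q + V 0)) M) \<partial>PB) *
      (\<integral>\<^sup>+B. L B (\<lambda>j. V (Suc j)) \<partial>PB)) \<in> borel_measurable PV"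
    by measurable
  have "(\<integral>\<^sup>+V. \<integral>\<^sup>+B. ennreal (pois (lam * (sum B Q + V 0)) M) * L B (\<lambda>j. V (Suc j)) \<partial>PB \<partial>PV) =
     (\<integral>\<^sup>+V. (\<integral>\<^sup>+B. ennreal (pois (lam * (sum B Q + V 0)) M) \<partial>PB) * (\<integral>\<^sup>+B. L B (\<lambda>j. V (Suc j)) \<partial>PB) \<partial>PV)"
    by (simp add: services)
  also have "\<dots> = (\<integral>\<^sup>+v. \<integral>\<^sup>+V. (\<integral>\<^sup>+B. ennreal (pois (lam * (sum B Q + v)) M) \<partial>PB) * (\<integral>\<^sup>+B. L B V \<partial>PB) \<partial>PV \<partial>FS)"
    by (subst nn_integral_iid_case_nat[OF FS_prob]) simp_all
  also have "\<dots> = (\<integral>\<^sup>+v. (\<integral>\<^sup>+B. ennreal (pois (lam * (sum B Q + v)) M) \<partial>PB) * (\<integral>\<^sup>+V. \<integral>\<^sup>+B. L B V \<partial>PB \<partial>PV) \<partial>FS)"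
    by (intro nn_integral_cong nn_integral_cmult) measurable
  also have "\<dots> = (\<integral>\<^sup>+v. (\<integral>\<^sup>+B. ennreal (pois (lam * (sum B Q + v)) M) \<partial>PB) \<partial>FS) * (\<integral>\<^sup>+V. \<integral>\<^sup>+B. L B V \<partial>PB \<partial>PV)"
    by (rule nn_integral_multc) measurable
  also have "(\<integral>\<^sup>+v. (\<integral>\<^sup>+B. ennreal (pois (lam * (sum B Q + v)) M) \<partial>PB) \<partial>FS) = work_prob Q M"
    unfolding work_prob_def by (rule nn_integral_iid_component[OF FS_prob, symmetric]) measurable
  finally show ?thesis by (simp add: L_def orbit_prob_def)
qed

lemma AE_services_nonneg: "AE B in PB. \<forall>k. 0 \<le> B k"
  unfolding AE_all_countable by (intro allI AE_PiM_component FB_prob FB_nonneg) simp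

lemma AE_vacations_nonneg: "AE V in PV. \<forall>k. 0 \<le> V k"
  unfolding AE_all_countable by (intro allI AE_PiM_component FS_prob FS_nonneg) simp

text \<open>
  The Markov recursion: \<open>Q\<close> are the retrying customers, \<open>N\<close> and \<open>M\<close> count the arrivals
  during and after the glue period.
\<close>

lemma orbit_prob_Suc:
  assumes D: "D \<subseteq> {..<c}"
  shows "orbit_prob (Suc n) m D c =
    (\<Sum>Q\<in>Pow ({..<c} - D). stick_weight ({..<c} - D) Q *
      (\<Sum>N. ennreal (pois (lam * G) N) *
      (\<Sum>M. work_prob (Q \<union> {c..<c + N}) M * orbit_prob n m (D \<union> (Q \<union> {c..<c + N})) (c + (N + M)))))"
proof -
  define T where "T Q N M B V = ennreal (pois (lam * (sum B (Q \<union> {c..<c + N}) + V 0)) M) *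
      (\<integral>\<^sup>+A. \<integral>\<^sup>+R. size_indicator n m (D \<union> (Q \<union> {c..<c + N})) (c + (N + M)) A B (\<lambda>j. V (Suc j)) R \<partial>PR \<partial>PA)"
    for Q N M B V
  have T_meas[measurable]: "(\<lambda>\<omega>. T Q N M (B \<omega>) (V \<omega>)) \<in> borel_measurable L"
    if [measurable]: "B \<in> L \<rightarrow>\<^sub>M iid borel" "V \<in> L \<rightarrow>\<^sub>M iid borel" for B V Q N M and L :: "'z measure"
    unfolding T_def by measurable
  have "orbit_prob (Suc n) m D c =
    (\<integral>\<^sup>+V. \<integral>\<^sup>+B. (\<Sum>Q\<in>Pow ({..<c} - D). stick_weight ({..<c} - D) Q *
      (\<Sum>N. ennreal (pois (lam * G) N) * (\<Sum>M. T Q N M B V))) \<partial>PB \<partial>PV)"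
    unfolding orbit_prob_def
  proof (rule nn_integral_cong_AE, use AE_vacations_nonneg in eventually_elim)
    case (elim V)
    then show ?case
      by (intro nn_integral_cong_AE, use AE_services_nonneg in eventually_elim)
         (simp add: nn_integral_arrivals[OF _ _ D] T_def)
  qed
  also have "\<dots> = (\<integral>\<^sup>+V. (\<Sum>Q\<in>Pow ({..<c} - D). stick_weight ({..<c} - D) Q *
      (\<Sum>N. ennreal (pois (lam * G) N) * (\<Sum>M. \<integral>\<^sup>+B. T Q N M B V \<partial>PB))) \<partial>PV)"
    by (simp add: nn_integral_sum nn_integral_cmult nn_integral_suminf)
  also have "\<dots> = (\<Sum>Q\<in>Pow ({..<c} - D). stick_weight ({..<c} - D) Q *
      (\<Sum>N. ennreal (pois (lam * G) N) * (\<Sum>M. \<integral>\<^sup>+V. \<integral>\<^sup>+B. T Q N M B V \<partial>PB \<partial>PV)))"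
    by (simp add: nn_integral_sum nn_integral_cmult nn_integral_suminf)
  also have "\<dots> = (\<Sum>Q\<in>Pow ({..<c} - D). stick_weight ({..<c} - D) Q *
      (\<Sum>N. ennreal (pois (lam * G) N) *
      (\<Sum>M. work_prob (Q \<union> {c..<c + N}) M * orbit_prob n m (D \<union> (Q \<union> {c..<c + N})) (c + (N + M)))))"
    unfolding T_def by (subst nn_integral_services) auto
  finally show ?thesis .
qed

lemma orbit_prob_0:
  assumes "D \<subseteq> {..<c}"
  shows "orbit_prob 0 m D c = (if card ({..<c} - D) = m then 1 else 0)"
proof -
  have "orbit_prob 0 m D c = (\<integral>\<^sup>+V. \<integral>\<^sup>+B. \<integral>\<^sup>+A. (if card ({..<c} - D) = m then 1 else 0) \<partial>PA \<partial>PB \<partial>PV)"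
    unfolding orbit_prob_def
  proof (rule nn_integral_cong, rule nn_integral_cong)
    fix B V
    show "(\<integral>\<^sup>+A. \<integral>\<^sup>+R. size_indicator 0 m D c A B V R \<partial>PR \<partial>PA) = (\<integral>\<^sup>+A. (if card ({..<c} - D) = m then 1 else 0) \<partial>PA)"
      by (rule nn_integral_cong_AE, use AE_renewing[OF lam_pos] in eventually_elim)
         (use assms in \<open>simp add: size_indicator_def orbit_size_0 R.emeasure_space_1\<close>)
  qed
  then show ?thesis by (simp add: A.emeasure_space_1 B.emeasure_space_1 V.emeasure_space_1)
qed

end

section \<open>Generating functions of probability mass functions\<close>

abbreviation pgf :: "nat pmf \<Rightarrow> complex \<Rightarrow> complex" where
  "pgf p z \<equiv> measure_pmf.expectation p (\<lambda>k. z ^ k)"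

lemma norm_power_le_1: "norm z \<le> 1 \<Longrightarrow> norm (z ^ k) \<le> (1::real)" for z :: complex
  by (simp add: norm_power power_le_one)

lemma integrable_pmf_bounded:
  fixes f :: "'a \<Rightarrow> complex"
  shows "(\<And>x. norm (f x) \<le> b) \<Longrightarrow> integrable (measure_pmf p) f"
  by (rule measure_pmf.integrable_const_bound[where B = b]) auto

lemma norm_expectation_pmf_le:
  fixes f :: "'a \<Rightarrow> complex"
  assumes "\<And>x. norm (f x) \<le> b"
  shows "norm (measure_pmf.expectation p f) \<le> b"
proof -
  have "norm (measure_pmf.expectation p f) \<le> (\<integral>x. norm (f x) \<partial>measure_pmf p)"
    by (rule integral_norm_bound)
  also have "\<dots> \<le> (\<integral>x. b \<partial>measure_pmf p)"
    using assms by (intro integral_mono integrable_norm integrable_pmf_bounded[of _ b]) auto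
  finally show ?thesis by simp
qed

text \<open>
  The real case, applied to the real and imaginary part.
\<close>

lemma expectation_bind_pmf:
  fixes f :: "'b \<Rightarrow> complex"
  assumes f: "\<And>x. norm (f x) \<le> b"
  shows "measure_pmf.expectation (bind_pmf p g) f = measure_pmf.expectation p (\<lambda>x. measure_pmf.expectation (g x) f)"
proof -
  have real: "measure_pmf.expectation (bind_pmf p g) h = measure_pmf.expectation p (\<lambda>x. measure_pmf.expectation (g x) h)"
    if "\<And>x. \<bar>h x\<bar> \<le> b" for h :: "'b \<Rightarrow> real"
    unfolding measure_pmf_bind
    by (rule integral_bind[where K = "count_space UNIV" and B = b and B' = 1])
       (use that measurable_measure_pmf[of g] in \<open>auto simp: measure_pmf.emeasure_space_1 intro: measure_pmf.finite_measure\<close>)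
  have int: "integrable (measure_pmf q) f" for q by (rule integrable_pmf_bounded[OF f])
  have int2: "integrable (measure_pmf p) (\<lambda>x. measure_pmf.expectation (g x) f)"
    by (rule integrable_pmf_bounded[OF norm_expectation_pmf_le[OF f]])
  have "\<bar>Re (f x)\<bar> \<le> b" "\<bar>Im (f x)\<bar> \<le> b" for x
    using f[of x] abs_Re_le_cmod abs_Im_le_cmod order_trans by blast+
  then show ?thesis
    using int int2 real[of "\<lambda>x. Re (f x)"] real[of "\<lambda>x. Im (f x)"]
    by (intro complex_eqI) simp_all
qed

lemma integral_pmf_nat_sums:
  fixes f :: "nat \<Rightarrow> complex"
  assumes "\<And>x. norm (f x) \<le> b"
  shows "(\<lambda>k. complex_of_real (pmf p k) * f k) sums measure_pmf.expectation p f"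
proof -
  have "integrable (measure_pmf p) f" by (rule integrable_pmf_bounded[OF assms])
  then have "integrable (count_space UNIV) (\<lambda>k. pmf p k *\<^sub>R f k)"
    unfolding measure_pmf_eq_density by (subst (asm) integrable_density) auto
  from sums_integral_count_space_nat[OF this] show ?thesis
    unfolding measure_pmf_eq_density by (subst integral_density) (auto simp: scaleR_conv_of_real)
qed

definition mixed_poisson :: "'b measure \<Rightarrow> ('b \<Rightarrow> real) \<Rightarrow> nat pmf" where
  "mixed_poisson W T = embed_pmf (\<lambda>m. \<integral>\<omega>. pois (T \<omega>) m \<partial>W)"

lemma pois_le_1: "0 \<le> x \<Longrightarrow> pois x m \<le> 1"
  using sum_le_suminf[OF sums_summable[OF pois_sums], of "{m}" x] sums_unique[OF pois_sums, of x, symmetric]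
  by (auto simp: pois_nonneg)

context
  fixes W :: "'b measure" and T :: "'b \<Rightarrow> real"
  assumes W: "prob_space W" and T[measurable]: "T \<in> borel_measurable W" and T_nonneg: "AE \<omega> in W. 0 \<le> T \<omega>"
begin

interpretation W: prob_space W by fact

lemma integrable_pois: "integrable W (\<lambda>\<omega>. pois (T \<omega>) m)"
  by (rule W.integrable_const_bound[where B = 1], use T_nonneg in eventually_elim)
     (auto simp: pois_nonneg pois_le_1)

lemma nn_integral_pois: "(\<integral>\<^sup>+\<omega>. ennreal (pois (T \<omega>) m) \<partial>W) = ennreal (\<integral>\<omega>. pois (T \<omega>) m \<partial>W)"
  by (rule nn_integral_eq_integral[OF integrable_pois], use T_nonneg in eventually_elim) (simp add: pois_nonneg)

lemma integral_pois_nonneg: "0 \<le> (\<integral>\<omega>. pois (T \<omega>) m \<partial>W)"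
  by (rule integral_nonneg_AE, use T_nonneg in eventually_elim) (simp add: pois_nonneg)

lemma pmf_mixed_poisson: "pmf (mixed_poisson W T) m = (\<integral>\<omega>. pois (T \<omega>) m \<partial>W)"
  unfolding mixed_poisson_def
proof (rule pmf_embed_pmf)
  have "(\<integral>\<^sup>+m. ennreal (\<integral>\<omega>. pois (T \<omega>) m \<partial>W) \<partial>count_space UNIV) = (\<integral>\<^sup>+\<omega>. (\<Sum>m. ennreal (pois (T \<omega>) m)) \<partial>W)"
    by (simp add: nn_integral_count_space_nat nn_integral_suminf nn_integral_pois)
  also have "\<dots> = (\<integral>\<^sup>+\<omega>. 1 \<partial>W)"
    by (rule nn_integral_cong_AE, use T_nonneg in eventually_elim) (simp add: suminf_pois)
  finally show "(\<integral>\<^sup>+m. ennreal (\<integral>\<omega>. pois (T \<omega>) m \<partial>W) \<partial>count_space UNIV) = 1"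
    by (simp add: W.emeasure_space_1)
qed (rule integral_pois_nonneg)

text \<open>
  Given the mean \<open>T\<close>, the Poisson generating function is the exponential series at \<open>z T\<close>; the sum
  and the integral may be exchanged because the weights are dominated by those at \<open>z = 1\<close>.
\<close>

lemma pgf_mixed_poisson:
  assumes z: "norm z \<le> 1"
  shows "pgf (mixed_poisson W T) z = (\<integral>\<omega>. exp (- ((1 - z) * complex_of_real (T \<omega>))) \<partial>W)"
proof -
  define f where "f m \<omega> = complex_of_real (pois (T \<omega>) m) * z ^ m" for m \<omega>
  have f_le: "norm (f m \<omega>) \<le> pois (T \<omega>) m" if "0 \<le> T \<omega>" for m \<omega>
    using norm_power_le_1[OF z, of m] pois_nonneg[OF that, of m]
    by (simp add: f_def norm_mult mult_left_le)
  have f_int: "integrable W (f m)" for m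
    unfolding f_def by (intro integrable_mult_left integrable_of_real integrable_pois)
  have f_sum: "f m \<omega> = exp (- T \<omega>) * ((complex_of_real (T \<omega>) * z) ^ m /\<^sub>R fact m)" for m \<omega>
    by (simp add: f_def pois_def power_mult_distrib scaleR_conv_of_real field_simps)
  have sums: "(\<lambda>m. f m \<omega>) sums exp (- ((1 - z) * complex_of_real (T \<omega>)))" for \<omega>
  proof -
    have "(\<lambda>m. f m \<omega>) sums (exp (- T \<omega>) * exp (complex_of_real (T \<omega>) * z))"
      unfolding f_sum by (intro sums_mult exp_converges)
    also have "complex_of_real (exp (- T \<omega>)) * exp (complex_of_real (T \<omega>) * z) = exp (- ((1 - z) * complex_of_real (T \<omega>)))"
      by (simp add: exp_of_real[symmetric] mult_exp_exp algebra_simps)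
    finally show ?thesis .
  qed
  have "(\<lambda>m. complex_of_real (pmf (mixed_poisson W T) m) * z ^ m) sums pgf (mixed_poisson W T) z"
    by (rule integral_pmf_nat_sums[OF norm_power_le_1[OF z]])
  moreover have "complex_of_real (pmf (mixed_poisson W T) m) * z ^ m = integral\<^sup>L W (f m)" for m
    unfolding f_def by (simp add: pmf_mixed_poisson)
  ultimately have "pgf (mixed_poisson W T) z = (\<Sum>m. integral\<^sup>L W (f m))"
    by (simp add: sums_iff)
  also have "\<dots> = (\<integral>\<omega>. (\<Sum>m. f m \<omega>) \<partial>W)"
  proof (rule integral_suminf[OF f_int, symmetric])
    show "AE \<omega> in W. summable (\<lambda>m. norm (f m \<omega>))"
      using T_nonneg
    proof eventually_elim
      case (elim \<omega>)
      show ?case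
        by (rule summable_comparison_test'[OF sums_summable[OF pois_sums[of "T \<omega>"]], of 0])
           (simp add: f_le[OF elim])
    qed
    show "summable (\<lambda>m. \<integral>\<omega>. norm (f m \<omega>) \<partial>W)"
    proof (rule summable_comparison_test'[of "\<lambda>m. pmf (mixed_poisson W T) m" 0])
      have "(\<lambda>k. complex_of_real (pmf (mixed_poisson W T) k) * 1) sums 1"
        using integral_pmf_nat_sums[of "\<lambda>_. 1" 1 "mixed_poisson W T"] by simp
      then show "summable (\<lambda>m. pmf (mixed_poisson W T) m)"
        by (simp add: sums_of_real_iff[where c = 1, simplified] sums_iff summable_of_real_iff)
      show "norm (\<integral>\<omega>. norm (f m \<omega>) \<partial>W) \<le> pmf (mixed_poisson W T) m" for m
        unfolding pmf_mixed_poisson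
        by (simp, intro integral_mono_AE integrable_norm f_int integrable_pois, use T_nonneg in eventually_elim) (rule f_le)
    qed
  qed
  also have "\<dots> = (\<integral>\<omega>. exp (- ((1 - z) * complex_of_real (T \<omega>))) \<partial>W)"
    using sums by (simp add: sums_iff)
  finally show ?thesis .
qed

end

lemma pmf_poisson_pois: "0 < r \<Longrightarrow> pmf (poisson_pmf r) m = pois r m"
  by (simp add: pois_def)

lemma pgf_poisson:
  assumes r: "0 < r" and z: "norm z \<le> 1"
  shows "pgf (poisson_pmf r) z = exp (- (of_real r * (1 - z)))"
proof -
  have W: "prob_space (measure_pmf (return_pmf ()))" by (rule measure_pmf.prob_space_axioms)
  have "poisson_pmf r = mixed_poisson (measure_pmf (return_pmf ())) (\<lambda>_. r)"
    using r by (intro pmf_eqI) (simp add: pmf_mixed_poisson[OF W] pmf_poisson_pois del: pmf_poisson)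
  then show ?thesis using pgf_mixed_poisson[OF W _ _ z, of "\<lambda>_. r"] r by (simp add: mult.commute)
qed

section \<open>The embedded Markov chain\<close>

lemma sum_Pow_card:
  fixes g :: "nat \<Rightarrow> 'b::comm_semiring_1"
  assumes "finite U"
  shows "(\<Sum>Q\<in>Pow U. g (card Q)) = (\<Sum>j\<le>card U. of_nat (card U choose j) * g j)"
proof -
  have "(\<Sum>Q\<in>Pow U. g (card Q)) = (\<Sum>j\<le>card U. \<Sum>Q\<in>{Q \<in> Pow U. card Q = j}. g (card Q))"
    using assms by (intro sum.group[symmetric]) (auto simp: card_mono)
  also have "\<dots> = (\<Sum>j\<le>card U. of_nat (card U choose j) * g j)"
    using assms by (intro sum.cong refl) (simp add: n_subsets[symmetric])
  finally show ?thesis .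
qed

context glue_laws
begin

lemma stick_weight_card:
  assumes "finite U" "Q \<subseteq> U"
  shows "stick_weight U Q = ennreal (stick_prob ^ card Q * (1 - stick_prob) ^ (card U - card Q))"
proof -
  have "stick_weight U Q = (\<Prod>k\<in>Q. ennreal stick_prob) * (\<Prod>k\<in>U - Q. ennreal (1 - stick_prob))"
    unfolding stick_weight_def using assms
    by (subst prod.subset_diff[OF assms(2,1)]) (auto simp: mult.commute Int_absorb1 intro!: arg_cong2[where f = "(*)"] prod.cong)
  also have "\<dots> = ennreal (stick_prob ^ card Q * (1 - stick_prob) ^ (card U - card Q))"
    using assms stick_prob_bounds
    by (simp add: card_Diff_subset finite_subset ennreal_power ennreal_mult)
  finally show ?thesis .
qed

definition work_pmf :: "nat \<Rightarrow> nat pmf" where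
  "work_pmf j = mixed_poisson (PV \<Otimes>\<^sub>M PB) (\<lambda>(V, B). lam * (sum B {..<j} + V 0))"

lemma prob_space_VB: "prob_space (PV \<Otimes>\<^sub>M PB)"
  by (rule prob_space_pair) unfold_locales

lemma AE_work_nonneg: "AE p in PV \<Otimes>\<^sub>M PB. 0 \<le> (case p of (V, B) \<Rightarrow> lam * (sum B {..<j} + V 0))"
proof -
  interpret VB: pair_sigma_finite PV PB ..
  have "AE V in PV. AE B in PB. 0 \<le> lam * (sum B {..<j} + V 0)"
    using AE_vacations_nonneg
  proof eventually_elim
    case (elim V)
    from AE_services_nonneg show ?case
      by eventually_elim (use elim lam_pos in \<open>simp add: sum_nonneg\<close>)
  qed
  moreover have "{p \<in> space (PV \<Otimes>\<^sub>M PB). 0 \<le> lam * (sum (snd p) {..<j} + fst p 0)} \<in> sets (PV \<Otimes>\<^sub>M PB)"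
    by measurable
  ultimately have "AE p in PV \<Otimes>\<^sub>M PB. 0 \<le> lam * (sum (snd p) {..<j} + fst p 0)"
    using VB.AE_pair_iff[where P = "\<lambda>V B. 0 \<le> lam * (sum B {..<j} + V 0)"] by simp
  then show ?thesis by (simp add: split_beta)
qed

text \<open>
  Service times are exchangeable, so that only the number of customers served matters.
\<close>

lemma nn_integral_services_card:
  assumes "finite Q" and h[measurable]: "h \<in> borel_measurable borel"
  shows "(\<integral>\<^sup>+B. h (sum B Q) \<partial>PB) = (\<integral>\<^sup>+B. h (sum B {..<card Q}) \<partial>PB)"
proof -
  have key: "(\<integral>\<^sup>+B. h (sum B (f ` {..<j})) \<partial>PB) = (\<integral>\<^sup>+y. h (sum y {..<j}) \<partial>PiM {..<j} (\<lambda>_. FB))"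
    if inj: "inj_on f {..<j}" for f :: "nat \<Rightarrow> nat" and j
  proof -
    have "distr PB (PiM {..<j} (\<lambda>_. FB)) (\<lambda>\<omega>. \<lambda>n\<in>{..<j}. \<omega> (f n)) = PiM {..<j} (\<lambda>_. FB)"
      using inj by (intro distr_PiM_reindex) (auto intro: FB_prob)
    then have "(\<integral>\<^sup>+y. h (sum y {..<j}) \<partial>PiM {..<j} (\<lambda>_. FB)) =
       (\<integral>\<^sup>+y. h (sum y {..<j}) \<partial>distr PB (PiM {..<j} (\<lambda>_. FB)) (\<lambda>\<omega>. \<lambda>n\<in>{..<j}. \<omega> (f n)))" by simp
    also have "\<dots> = (\<integral>\<^sup>+B. h (\<Sum>n<j. B (f n)) \<partial>PB)"
      by (subst nn_integral_distr) auto
    finally show ?thesis using inj by (simp add: sum.reindex)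
  qed
  obtain f where "bij_betw f {..<card Q} Q"
    using ex_bij_betw_nat_finite[OF assms(1)] by (auto simp: atLeast0LessThan)
  then have f: "inj_on f {..<card Q}" "f ` {..<card Q} = Q" by (auto simp: bij_betw_def)
  show ?thesis using key[OF f(1)] key[of "\<lambda>n. n" "card Q"] by (simp add: f(2))
qed

lemma work_prob_eq:
  assumes "finite Q"
  shows "work_prob Q M = ennreal (pmf (work_pmf (card Q)) M)"
proof -
  have "work_prob Q M = (\<integral>\<^sup>+V. \<integral>\<^sup>+B. ennreal (pois (lam * (sum B {..<card Q} + V 0)) M) \<partial>PB \<partial>PV)"
    unfolding work_prob_def
    by (intro nn_integral_cong nn_integral_services_card[OF assms, where h = "\<lambda>x. ennreal (pois (lam * (x + _)) M)"]) measurable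
  also have "\<dots> = (\<integral>\<^sup>+p. ennreal (pois (case p of (V, B) \<Rightarrow> lam * (sum B {..<card Q} + V 0)) M) \<partial>(PV \<Otimes>\<^sub>M PB))"
    by (subst B.nn_integral_fst[symmetric]) (auto simp: split_beta')
  also have "\<dots> = ennreal (pmf (work_pmf (card Q)) M)"
    unfolding work_pmf_def
    using nn_integral_pois[OF prob_space_VB _ AE_work_nonneg[of "card Q"]] pmf_mixed_poisson[OF prob_space_VB _ AE_work_nonneg[of "card Q"]]
    by (simp add: split_beta')
  finally show ?thesis .
qed

text \<open>
  Of \<open>x\<close> customers in orbit, \<open>j\<close> retry; \<open>N\<close> customers arrive during the glue period, and \<open>M\<close> during
  the visit to these \<open>j + N\<close> customers and the vacation.
\<close>

definition chain_step :: "nat \<Rightarrow> nat pmf" where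
  "chain_step x = bind_pmf (binomial_pmf x stick_prob) (\<lambda>j. bind_pmf (poisson_pmf (lam * G))
     (\<lambda>N. map_pmf (\<lambda>M. x - j + M) (work_pmf (j + N))))"

primrec chain :: "nat \<Rightarrow> nat \<Rightarrow> nat pmf" where
  "chain 0 x = return_pmf x"
| "chain (Suc n) x = bind_pmf (chain_step x) (chain n)"

lemma nn_integral_pmf_nat: "(\<integral>\<^sup>+k. g k \<partial>measure_pmf p) = (\<Sum>k. ennreal (pmf p k) * g k)" for g :: "nat \<Rightarrow> ennreal"
  by (simp add: nn_integral_measure_pmf nn_integral_count_space_nat)

lemma nn_integral_chain_step:
  fixes g :: "nat \<Rightarrow> ennreal"
  shows "(\<integral>\<^sup>+y. g y \<partial>measure_pmf (chain_step x)) =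
    (\<Sum>j\<le>x. of_nat (x choose j) * (ennreal (stick_prob ^ j * (1 - stick_prob) ^ (x - j)) *
      (\<Sum>N. ennreal (pois (lam * G) N) * (\<Sum>M. ennreal (pmf (work_pmf (j + N)) M) * g (x - j + M)))))"
proof -
  have "(\<integral>\<^sup>+y. g y \<partial>measure_pmf (chain_step x)) =
     (\<integral>\<^sup>+j. (\<Sum>N. ennreal (pois (lam * G) N) * (\<Sum>M. ennreal (pmf (work_pmf (j + N)) M) * g (x - j + M)))
        \<partial>measure_pmf (binomial_pmf x stick_prob))"
    unfolding chain_step_def nn_integral_bind_pmf nn_integral_map_pmf nn_integral_pmf_nat[of "work_pmf j" for j]
      nn_integral_pmf_nat[of "poisson_pmf r" for r]
    using lam_pos G_pos by (simp add: pmf_poisson_pois del: pmf_poisson)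
  also have "\<dots> = (\<Sum>j\<le>x. (\<Sum>N. ennreal (pois (lam * G) N) * (\<Sum>M. ennreal (pmf (work_pmf (j + N)) M) * g (x - j + M))) *
      ennreal (pmf (binomial_pmf x stick_prob) j))"
    using stick_prob_bounds
    by (intro nn_integral_measure_pmf_support) (auto simp: set_pmf_binomial_eq split: if_splits)
  also have "\<dots> = (\<Sum>j\<le>x. of_nat (x choose j) * (ennreal (stick_prob ^ j * (1 - stick_prob) ^ (x - j)) *
      (\<Sum>N. ennreal (pois (lam * G) N) * (\<Sum>M. ennreal (pmf (work_pmf (j + N)) M) * g (x - j + M)))))"
    using stick_prob_bounds
    by (intro sum.cong refl) (simp add: ennreal_mult ac_simps ennreal_of_nat_eq_real_of_nat)
  finally show ?thesis .
qed

text \<open>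
  The recursion \<open>orbit_prob_Suc\<close> runs over sets of customers, but all its weights depend on their sizes
  only. Grouping the sets \<open>Q\<close> by size turns their weights into binomial ones.
\<close>

proposition orbit_prob_eq_chain:
  "D \<subseteq> {..<c} \<Longrightarrow> orbit_prob n m D c = ennreal (pmf (chain n (card ({..<c} - D))) m)"
proof (induction n arbitrary: D c)
  case 0
  then show ?case by (simp add: orbit_prob_0 pmf_return)
next
  case (Suc n)
  define U where "U = {..<c} - D"
  have U: "finite U" by (simp add: U_def)
  define g where "g y = ennreal (pmf (chain n y) m)" for y
  have "orbit_prob (Suc n) m D c =
    (\<Sum>Q\<in>Pow U. stick_weight U Q * (\<Sum>N. ennreal (pois (lam * G) N) *
      (\<Sum>M. ennreal (pmf (work_pmf (card Q + N)) M) * g (card U - card Q + M))))"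
    unfolding orbit_prob_Suc[OF Suc.prems] U_def[symmetric]
  proof (intro sum.cong suminf_cong refl arg_cong2[where f = "(*)"])
    fix Q N M assume Q: "Q \<in> Pow U"
    then have "finite Q" "Q \<inter> {c..<c + N} = {}" using U by (auto simp: U_def intro: finite_subset)
    then show "work_prob (Q \<union> {c..<c + N}) M = ennreal (pmf (work_pmf (card Q + N)) M)"
      by (simp add: work_prob_eq card_Un_disjoint)
    have D': "D \<union> (Q \<union> {c..<c + N}) \<subseteq> {..<c + (N + M)}"
      using Suc.prems Q by (auto simp: U_def)
    have "{..<c + (N + M)} - (D \<union> (Q \<union> {c..<c + N})) = (U - Q) \<union> {c + N..<c + N + M}"
      using Suc.prems Q by (auto simp: U_def)
    moreover have "(U - Q) \<inter> {c + N..<c + N + M} = {}" by (auto simp: U_def)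
    ultimately have "card ({..<c + (N + M)} - (D \<union> (Q \<union> {c..<c + N}))) = card U - card Q + M"
      using U Q \<open>finite Q\<close> by (simp add: card_Un_disjoint card_Diff_subset)
    then show "orbit_prob n m (D \<union> (Q \<union> {c..<c + N})) (c + (N + M)) = g (card U - card Q + M)"
      by (simp add: Suc.IH[OF D'] g_def)
  qed
  also have "\<dots> = (\<Sum>Q\<in>Pow U. ennreal (stick_prob ^ card Q * (1 - stick_prob) ^ (card U - card Q)) *
      (\<Sum>N. ennreal (pois (lam * G) N) *
      (\<Sum>M. ennreal (pmf (work_pmf (card Q + N)) M) * g (card U - card Q + M))))"
    using U by (intro sum.cong refl) (simp add: stick_weight_card)
  also have "\<dots> = (\<integral>\<^sup>+y. g y \<partial>measure_pmf (chain_step (card U)))"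
    unfolding nn_integral_chain_step by (rule sum_Pow_card[OF U])
  also have "\<dots> = ennreal (pmf (chain (Suc n) (card U)) m)"
    by (simp add: g_def ennreal_pmf_bind)
  finally show ?case by (simp add: U_def)
qed

end

section \<open>Transforms of the transition probabilities\<close>

text \<open>
  The derivative of the exponential function is bounded by 1 on the left half-plane.
\<close>

lemma norm_exp_minus_one_le:
  fixes w :: complex
  assumes "Re w \<le> 0"
  shows "norm (exp w - 1) \<le> norm w"
proof -
  have "norm (exp w - exp 0) \<le> 1 * norm (w - 0)"
  proof (rule field_differentiable_bound[where S = "{u. Re u \<le> 0}" and f' = exp])
    show "convex {u. Re u \<le> 0}" by (rule convex_halfspace_Re_le)
    show "(exp has_field_derivative exp z) (at z within {u. Re u \<le> 0})" for z :: complex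
      by (rule DERIV_subset[OF DERIV_exp]) simp
  qed (use assms in auto)
  then show ?thesis by simp
qed

lemma norm_LST_kernel_le_1: "0 \<le> Re s \<Longrightarrow> 0 \<le> x \<Longrightarrow> norm (exp (- (s * complex_of_real x))) \<le> 1"
  by simp

lemma LST_bounds:
  assumes F: "prob_space F" and [measurable_cong]: "sets F = sets borel" and nn: "AE x in F. 0 \<le> x" and s: "0 \<le> Re s"
  shows integrable_LST_kernel: "integrable F (\<lambda>x. exp (- (s * complex_of_real x)))"
    and norm_LST_le_1: "norm (LST F s) \<le> 1"
proof -
  interpret prob_space F by fact
  show int: "integrable F (\<lambda>x. exp (- (s * complex_of_real x)))"
    using nn by (intro integrable_const_bound[where B = 1]) (auto simp del: norm_exp_eq_Re intro: norm_LST_kernel_le_1[OF s])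
  have "norm (LST F s) \<le> (\<integral>x. norm (exp (- (s * complex_of_real x))) \<partial>F)"
    unfolding LST_def by (rule integral_norm_bound)
  also have "\<dots> \<le> (\<integral>x. 1 \<partial>F)"
    using nn int by (intro integral_mono_AE) (auto simp del: norm_exp_eq_Re intro: norm_LST_kernel_le_1[OF s])
  finally show "norm (LST F s) \<le> 1" by (simp add: prob_space)
qed

lemma norm_one_minus_LST_le:
  assumes F: "prob_space F" and b[measurable_cong]: "sets F = sets borel" and nn: "AE x in F. 0 \<le> x" and s: "0 \<le> Re s"
    and I: "integrable F (\<lambda>x. x)"
  shows "norm (1 - LST F s) \<le> norm s * (\<integral>x. x \<partial>F)"
proof -
  interpret prob_space F by fact
  note int = integrable_LST_kernel[OF F b nn s]
  have "1 - LST F s = (\<integral>x. 1 - exp (- (s * complex_of_real x)) \<partial>F)"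
    unfolding LST_def using int by (simp add: prob_space)
  also have "norm \<dots> \<le> (\<integral>x. norm (1 - exp (- (s * complex_of_real x))) \<partial>F)"
    by (rule integral_norm_bound)
  also have "\<dots> \<le> (\<integral>x. norm s * x \<partial>F)"
  proof (rule integral_mono_AE)
    show "AE x in F. norm (1 - exp (- (s * complex_of_real x))) \<le> norm s * x"
      using nn
    proof eventually_elim
      case (elim x)
      have "norm (exp (- (s * complex_of_real x)) - 1) \<le> norm (- (s * complex_of_real x))"
        using s elim by (intro norm_exp_minus_one_le) simp
      then show ?case using elim by (simp add: norm_minus_commute norm_mult)
    qed
  qed (use int I in auto)
  finally show ?thesis by simp
qed

context glue_laws
begin

abbreviation "\<beta> \<equiv> beta_gf lam FB"
abbreviation "\<sigma> \<equiv> sigma_gf lam FS"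
abbreviation "f \<equiv> f_gf lam \<nu> G FB"
abbreviation "K \<equiv> K_gf lam G FB FS"

lemma Re_arg_nonneg: "norm z \<le> 1 \<Longrightarrow> 0 \<le> Re (of_real lam * (1 - z))"
  using lam_pos complex_Re_le_cmod[of z] by simp

lemma norm_beta_le_1: "norm z \<le> 1 \<Longrightarrow> norm (\<beta> z) \<le> 1"
  unfolding beta_gf_def by (rule norm_LST_le_1[OF FB_prob FB_sets FB_nonneg Re_arg_nonneg])

lemma norm_sigma_le_1: "norm z \<le> 1 \<Longrightarrow> norm (\<sigma> z) \<le> 1"
  unfolding sigma_gf_def by (rule norm_LST_le_1[OF FS_prob FS_sets FS_nonneg Re_arg_nonneg])

lemma f_gf_eq: "f z = of_real stick_prob * \<beta> z + of_real (1 - stick_prob) * z"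
  by (simp add: f_gf_def stick_prob_def)

lemma norm_f_le_1:
  assumes "norm z \<le> 1" shows "norm (f z) \<le> 1"
proof -
  have "norm (f z) \<le> stick_prob * norm (\<beta> z) + (1 - stick_prob) * norm z"
    unfolding f_gf_eq using stick_prob_bounds
    by (intro norm_triangle_le) (simp add: norm_mult del: of_real_diff)
  also have "\<dots> \<le> stick_prob * 1 + (1 - stick_prob) * 1"
    using assms norm_beta_le_1[OF assms] stick_prob_bounds by (intro add_mono mult_left_mono) auto
  finally show ?thesis by simp
qed

lemma norm_iterate_f_le_1: "norm z \<le> 1 \<Longrightarrow> norm ((f ^^ n) z) \<le> 1"
  by (induction n) (auto intro: norm_f_le_1)

text \<open>
  The total time is a sum of independent variables, so that its transform factorises.
\<close>

lemma pgf_work_pmf: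
  assumes z: "norm z \<le> 1"
  shows "pgf (work_pmf j) z = \<beta> z ^ j * \<sigma> z"
proof -
  define s where "s = of_real lam * (1 - z)"
  define e where "e x = exp (- (s * complex_of_real x))" for x
  have s: "0 \<le> Re s" unfolding s_def by (rule Re_arg_nonneg[OF z])
  have [measurable]: "e \<in> borel_measurable borel" unfolding e_def by measurable
  interpret VB: pair_sigma_finite PV PB ..
  interpret VBp: prob_space "PV \<Otimes>\<^sub>M PB" by (rule prob_space_VB)
  interpret FB0: prob_space FB by (rule FB_prob)
  interpret FS0: prob_space FS by (rule FS_prob)
  interpret FB: product_prob_space "\<lambda>_. FB" "UNIV :: nat set" ..
  interpret FS: product_prob_space "\<lambda>_. FS" "UNIV :: nat set" ..
  have int_e: "integrable FB e"
    unfolding e_def by (rule integrable_LST_kernel[OF FB_prob FB_sets FB_nonneg s])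
  have services: "(\<integral>B. (\<Prod>k<j. e (B k)) \<partial>PB) = \<beta> z ^ j"
  proof -
    have "(\<integral>B. (\<Prod>k<j. e (B k)) \<partial>PB) =
        (\<integral>y. (\<Prod>k<j. e (y k)) \<partial>distr PB (PiM {..<j} (\<lambda>_. FB)) (\<lambda>x. restrict x {..<j}))"
      by (subst integral_distr) auto
    also have "\<dots> = (\<integral>y. (\<Prod>k<j. e (y k)) \<partial>PiM {..<j} (\<lambda>_. FB))"
      by (subst FB.distr_PiM_restrict_finite) auto
    also have "\<dots> = (\<Prod>k<j. integral\<^sup>L FB e)"
      by (rule FB.product_integral_prod) (auto intro: int_e)
    finally show ?thesis by (simp add: beta_gf_def LST_def e_def[abs_def] s_def)
  qed
  have vacation: "(\<integral>V. e (V 0) \<partial>PV) = \<sigma> z"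
  proof -
    have "integral\<^sup>L FS e = integral\<^sup>L (distr PV FS (\<lambda>V. V 0)) e"
      using FS.PiM_component[of 0] by simp
    also have "\<dots> = (\<integral>V. e (V 0) \<partial>PV)" by (subst integral_distr) auto
    finally show ?thesis by (simp add: sigma_gf_def LST_def e_def[abs_def] s_def)
  qed
  define h where "h = (\<lambda>(V, B). e (V (0::nat)) * (\<Prod>k<j. e (B (k::nat))))"
  have [measurable]: "h \<in> borel_measurable (PV \<Otimes>\<^sub>M PB)" unfolding h_def by measurable
  have h: "exp (- ((1 - z) * complex_of_real (case p of (V, B) \<Rightarrow> lam * (sum B {..<j} + V 0)))) = h p" for p
  proof -
    obtain V B where p: "p = (V, B)" by (rule prod.exhaust)
    have "h p = exp (- (s * complex_of_real (V 0)) + (\<Sum>k<j. - (s * complex_of_real (B k))))"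
      by (simp only: h_def p e_def prod.case exp_add exp_sum[OF finite_lessThan])
    also have "- (s * complex_of_real (V 0)) + (\<Sum>k<j. - (s * complex_of_real (B k))) =
        - ((1 - z) * complex_of_real (lam * (sum B {..<j} + V 0)))"
    proof -
      have "(\<Sum>k<j. - (s * complex_of_real (B k))) = - (s * complex_of_real (sum B {..<j}))"
        by (simp add: sum_negf sum_distrib_left)
      then show ?thesis by (simp add: s_def algebra_simps)
    qed
    finally show ?thesis by (simp add: p)
  qed
  have int_h: "integrable (PV \<Otimes>\<^sub>M PB) h"
  proof (rule VBp.integrable_const_bound[where B = 1])
    show "AE p in PV \<Otimes>\<^sub>M PB. norm (h p) \<le> 1"
      using AE_work_nonneg[of j]
    proof eventually_elim
      case (elim p)
      then show ?case unfolding h[symmetric]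
        using z complex_Re_le_cmod[of z] by simp
    qed
  qed measurable
  have "pgf (work_pmf j) z = integral\<^sup>L (PV \<Otimes>\<^sub>M PB) h"
    unfolding work_pmf_def using pgf_mixed_poisson[OF prob_space_VB _ AE_work_nonneg[of j] z]
    by (simp add: h)
  also have "\<dots> = (\<integral>V. \<integral>B. h (V, B) \<partial>PB \<partial>PV)"
    by (rule VB.integral_fst'[OF int_h, symmetric])
  also have "\<dots> = \<beta> z ^ j * \<sigma> z"
    by (simp add: h_def services vacation mult.commute)
  finally show ?thesis .
qed

text \<open>
  The branching property. Each of the \<open>x\<close> customers contributes a summand \<open>\<beta> z\<close> or \<open>z\<close> of a
  binomial expansion, which sums to \<open>f z\<close>.
\<close>

lemma pgf_chain_step:
  assumes z: "norm z \<le> 1"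
  shows "pgf (chain_step x) z = K z * f z ^ x"
proof -
  note [simp] = norm_beta_le_1[OF z] norm_sigma_le_1[OF z]
  note b = norm_power_le_1[OF z]
  have inner: "measure_pmf.expectation (map_pmf (\<lambda>M. x - j + M) (work_pmf (j + N))) (\<lambda>k. z ^ k) =
      (z ^ (x - j) * \<beta> z ^ j * \<sigma> z) * \<beta> z ^ N" for j N
    by (simp add: power_add pgf_work_pmf[OF z] ac_simps)
  have "pgf (chain_step x) z = measure_pmf.expectation (binomial_pmf x stick_prob)
     (\<lambda>j. measure_pmf.expectation (poisson_pmf (lam * G)) (\<lambda>N. (z ^ (x - j) * \<beta> z ^ j * \<sigma> z) * \<beta> z ^ N))"
    unfolding chain_step_def by (simp only: expectation_bind_pmf[OF b] inner)
  also have "\<dots> = measure_pmf.expectation (binomial_pmf x stick_prob)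
     (\<lambda>j. (z ^ (x - j) * \<beta> z ^ j * \<sigma> z) * exp (- (of_real (lam * G) * (1 - \<beta> z))))"
    using lam_pos G_pos by (simp only: integral_mult_right_zero pgf_poisson norm_beta_le_1[OF z] mult_pos_pos)
  also have "\<dots> = (\<Sum>j\<le>x. pmf (binomial_pmf x stick_prob) j *\<^sub>R
      ((z ^ (x - j) * \<beta> z ^ j * \<sigma> z) * exp (- (of_real (lam * G) * (1 - \<beta> z)))))"
    using stick_prob_bounds by (intro integral_measure_pmf) (auto simp: set_pmf_binomial_eq split: if_splits)
  also have "\<dots> = K z * (\<Sum>j\<le>x. of_nat (x choose j) * (of_real stick_prob * \<beta> z) ^ j * (of_real (1 - stick_prob) * z) ^ (x - j))"
    using stick_prob_bounds unfolding sum_distrib_left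
    by (intro sum.cong refl) (simp add: K_gf_def scaleR_conv_of_real power_mult_distrib ac_simps del: of_real_diff)
  also have "\<dots> = K z * f z ^ x"
    unfolding f_gf_eq by (simp only: binomial_ring)
  finally show ?thesis .
qed

lemma pgf_chain:
  assumes z: "norm z \<le> 1"
  shows "pgf (chain n x) z = (\<Prod>j<n. K ((f ^^ j) z)) * (f ^^ n) z ^ x"
proof (induction n arbitrary: x)
  case (Suc n)
  have "pgf (chain (Suc n) x) z = measure_pmf.expectation (chain_step x) (\<lambda>y. pgf (chain n y) z)"
    by (simp add: expectation_bind_pmf[OF norm_power_le_1[OF z]])
  also have "\<dots> = (\<Prod>j<n. K ((f ^^ j) z)) * pgf (chain_step x) ((f ^^ n) z)"
    by (simp add: Suc.IH)
  finally show ?case by (simp add: pgf_chain_step norm_iterate_f_le_1[OF z])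
qed simp

end

section \<open>Continuity theorem for probability generating functions\<close>

text \<open>
  With \<open>h m = x ^ m\<close> and \<open>b = x ^ k\<close> this bounds the remainder of a generating function, with
  \<open>b = 1\<close> the error caused by truncating the distribution.
\<close>

lemma expectation_pmf_initial_segment:
  fixes h :: "nat \<Rightarrow> complex"
  assumes h: "\<And>m. norm (h m) \<le> 1" and tail: "\<And>m. k \<le> m \<Longrightarrow> norm (h m) \<le> b"
  shows "norm (measure_pmf.expectation q h - (\<Sum>j<k. of_real (pmf q j) * h j)) \<le> b * (1 - (\<Sum>j<k. pmf q j))"
proof -
  define g where "g m = (if m < k then 0 else h m)" for m
  have int: "integrable (measure_pmf q) h'" if "\<And>m. norm (h' m) \<le> norm (h m)" for h' :: "nat \<Rightarrow> complex"
    using that h order_trans by (intro integrable_pmf_bounded[of _ 1]) blast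
  have "measure_pmf.expectation q h = measure_pmf.expectation q (\<lambda>m. (if m < k then h m else 0) + g m)"
    by (intro Bochner_Integration.integral_cong) (auto simp: g_def)
  also have "\<dots> = measure_pmf.expectation q (\<lambda>m. if m < k then h m else 0) + measure_pmf.expectation q g"
    by (intro Bochner_Integration.integral_add int) (auto simp: g_def)
  also have "measure_pmf.expectation q (\<lambda>m. if m < k then h m else 0) = (\<Sum>j<k. of_real (pmf q j) * h j)"
    by (subst integral_measure_pmf[of "{..<k}"]) (auto simp: scaleR_conv_of_real split: if_splits)
  finally have eq: "measure_pmf.expectation q h - (\<Sum>j<k. of_real (pmf q j) * h j) = measure_pmf.expectation q g"
    by simp
  have "norm (measure_pmf.expectation q g) \<le> (\<integral>m. norm (g m) \<partial>measure_pmf q)"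
    by (rule integral_norm_bound)
  also have "\<dots> \<le> (\<integral>m. b * indicator {k..} m \<partial>measure_pmf q)"
  proof (rule integral_mono)
    show "integrable (measure_pmf q) (\<lambda>m. norm (g m))" by (intro integrable_norm int) (simp add: g_def)
    show "integrable (measure_pmf q) (\<lambda>m. b * indicator {k..} m)"
      by (intro integrable_mult_right measure_pmf.integrable_const_bound[where B = 1]) auto
    show "norm (g m) \<le> b * indicator {k..} m" for m
      using tail[of m] by (auto simp: g_def indicator_def)
  qed
  also have "\<dots> = b * measure_pmf.prob q {k..}" by simp
  also have "measure_pmf.prob q {k..} = 1 - (\<Sum>j<k. pmf q j)"
  proof -
    have "measure_pmf.prob q (UNIV - {..<k}) = 1 - measure_pmf.prob q {..<k}"
      by (subst measure_pmf.prob_compl[symmetric]) auto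
    moreover have "UNIV - {..<k} = {k..}" by auto
    ultimately show ?thesis by (simp add: measure_measure_pmf_finite)
  qed
  finally show ?thesis by (simp add: eq)
qed

lemma sum_pmf_le_1: "(\<Sum>j<k. pmf q j) \<le> 1" for q :: "nat pmf"
  using measure_pmf.prob_le_1[of q "{..<k}"] by (simp add: measure_measure_pmf_finite)

text \<open>
  Coefficients are peeled off one after the other. Once the first \<open>k\<close> of them converge, coefficient
  \<open>k\<close> differs by at most \<open>x\<close>, uniformly in \<open>n\<close>, from the quotient
  \<open>(pgf (p n) x - (\<Sum>j<k. pmf (p n) j * x ^ j)) / x ^ k\<close>, which converges for every fixed \<open>x\<close>.
\<close>

lemma pmf_converges_if_pgf_converges:
  fixes p :: "nat \<Rightarrow> nat pmf"
  assumes lim: "\<And>x. 0 < x \<Longrightarrow> x < 1 \<Longrightarrow> convergent (\<lambda>n. pgf (p n) (of_real x))"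
  shows "convergent (\<lambda>n. pmf (p n) k)"
proof (induction k rule: less_induct)
  case (less k)
  have bound: "norm ((pgf (p n) (of_real x) - (\<Sum>j<k. of_real (pmf (p n) j) * of_real x ^ j)) / of_real x ^ k - of_real (pmf (p n) k)) \<le> x"
    if x: "0 < x" "x < 1" for x n
  proof -
    have "norm (pgf (p n) (of_real x) - (\<Sum>j<Suc k. of_real (pmf (p n) j) * of_real x ^ j)) \<le> x ^ Suc k * (1 - (\<Sum>j<Suc k. pmf (p n) j))"
      using x by (intro expectation_pmf_initial_segment) (auto simp: norm_power power_le_one power_decreasing simp del: power_Suc)
    also have "\<dots> \<le> x ^ Suc k * 1"
      using x by (intro mult_left_mono) (auto simp: sum_nonneg simp del: sum.lessThan_Suc power_Suc)
    finally have "norm (pgf (p n) (of_real x) - (\<Sum>j<k. of_real (pmf (p n) j) * of_real x ^ j) - of_real (pmf (p n) k) * of_real x ^ k) / x ^ k \<le> x"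
      using x by (simp add: divide_le_eq algebra_simps)
    moreover have "(u - v) / of_real x ^ k - w = (u - v - w * of_real x ^ k) / of_real x ^ k" for u v w :: complex
      using x by (simp add: field_simps)
    ultimately show ?thesis using x by (simp add: norm_divide norm_power)
  qed
  have "Cauchy (\<lambda>n. complex_of_real (pmf (p n) k))"
  proof (rule CauchyI)
    fix e :: real assume e: "0 < e"
    \<comment> \<open>The approximation error \<open>x\<close> occurs twice; half of \<open>e\<close> is left for the Cauchy property of \<open>c\<close>.\<close>
    define x where "x = min (1/2) (e / 4)"
    have x: "0 < x" "x < 1" "x \<le> e / 4" using e by (auto simp: x_def)
    define c where "c n = (pgf (p n) (of_real x) - (\<Sum>j<k. of_real (pmf (p n) j) * of_real x ^ j)) / of_real x ^ k" for n
    have "convergent (\<lambda>n. complex_of_real (pmf (p n) j))" if j: "j < k" for j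
    proof -
      obtain L where "(\<lambda>n. pmf (p n) j) \<longlonglongrightarrow> L"
        using less[OF j] unfolding convergent_def by blast
      then show ?thesis by (intro convergentI[OF tendsto_of_real])
    qed
    then have "convergent c"
      unfolding c_def divide_inverse using x
      by (intro convergent_diff lim convergent_sum convergent_mult convergent_const) auto
    then have "Cauchy c" by (rule convergent_Cauchy)
    then obtain n0 where n0: "\<And>m n. m \<ge> n0 \<Longrightarrow> n \<ge> n0 \<Longrightarrow> norm (c m - c n) < e / 2"
      using CauchyD[of c "e / 2"] e by auto
    have "norm (complex_of_real (pmf (p m) k) - complex_of_real (pmf (p n) k)) < e" if "m \<ge> n0" "n \<ge> n0" for m n
    proof -
      have "complex_of_real (pmf (p m) k) - complex_of_real (pmf (p n) k) =
        (c m - c n) - (c m - of_real (pmf (p m) k)) + (c n - of_real (pmf (p n) k))" by simp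
      also have "norm \<dots> \<le> norm (c m - c n) + norm (c m - of_real (pmf (p m) k)) + norm (c n - of_real (pmf (p n) k))"
        by (intro order_trans[OF norm_triangle_ineq] add_right_mono norm_triangle_ineq4)
      also have "\<dots> < e / 2 + x + x"
        using n0[OF that] bound[OF x(1,2)] unfolding c_def[symmetric] by (intro add_less_le_mono) auto
      finally show ?thesis using x(3) by simp
    qed
    then show "\<exists>M. \<forall>m\<ge>M. \<forall>n\<ge>M. norm (complex_of_real (pmf (p m) k) - complex_of_real (pmf (p n) k)) < e"
      by blast
  qed
  then obtain L where "(\<lambda>n. complex_of_real (pmf (p n) k)) \<longlonglongrightarrow> L"
    unfolding Cauchy_convergent_iff convergent_def by blast
  from tendsto_Re[OF this] show ?case by (intro convergentI[of _ "Re L"]) simp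
qed

text \<open>
  Since the limit has total mass 1, no mass escapes to infinity: an initial segment that carries
  almost all of \<open>q\<close> carries almost all of \<open>p n\<close> for large \<open>n\<close>. Hence the convergence extends to the
  unit circle.
\<close>

lemma pgf_tendsto_of_pmf_tendsto:
  fixes p :: "nat \<Rightarrow> nat pmf" and q :: "nat pmf"
  assumes lim: "\<And>k. (\<lambda>n. pmf (p n) k) \<longlonglongrightarrow> pmf q k" and z: "norm z \<le> 1"
  shows "(\<lambda>n. pgf (p n) z) \<longlonglongrightarrow> pgf q z"
proof (rule LIMSEQ_I)
  fix e :: real assume e: "0 < e"
  have "(\<lambda>k. pmf q k) sums 1"
    using integral_pmf_nat_sums[of "\<lambda>_. 1" 1 q] by (simp add: sums_of_real_iff[where c = 1, simplified])
  then have "(\<lambda>k. \<Sum>j<k. pmf q j) \<longlonglongrightarrow> 1" by (simp add: sums_def)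
  then have "eventually (\<lambda>k. 1 - e / 4 < (\<Sum>j<k. pmf q j)) sequentially"
    using e by (intro order_tendstoD) auto
  then obtain k where k: "1 - e / 4 < (\<Sum>j<k. pmf q j)"
    by (auto simp: eventually_sequentially)
  have "(\<lambda>n. \<Sum>j<k. pmf (p n) j) \<longlonglongrightarrow> (\<Sum>j<k. pmf q j)" by (intro tendsto_sum lim)
  then have 1: "eventually (\<lambda>n. 1 - e / 4 < (\<Sum>j<k. pmf (p n) j)) sequentially"
    using k by (intro order_tendstoD) auto
  have "(\<lambda>n. \<Sum>j<k. of_real (pmf (p n) j) * z ^ j) \<longlonglongrightarrow> (\<Sum>j<k. of_real (pmf q j) * z ^ j)"
    by (intro tendsto_sum tendsto_intros lim)
  from tendstoD[OF this, of "e / 4"] e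
  have 2: "eventually (\<lambda>n. norm ((\<Sum>j<k. of_real (pmf (p n) j) * z ^ j) - (\<Sum>j<k. of_real (pmf q j) * z ^ j)) < e / 4) sequentially"
    by (simp add: dist_norm)
  have seg: "norm (pgf r z - (\<Sum>j<k. of_real (pmf r j) * z ^ j)) \<le> 1 * (1 - (\<Sum>j<k. pmf r j))" for r
    by (intro expectation_pmf_initial_segment norm_power_le_1[OF z])
  from eventually_conj[OF 1 2] have "eventually (\<lambda>n. norm (pgf (p n) z - pgf q z) < e) sequentially"
  proof eventually_elim
    case (elim n)
    define a b where "a = (\<Sum>j<k. of_real (pmf (p n) j) * z ^ j)" and "b = (\<Sum>j<k. of_real (pmf q j) * z ^ j)"
    have "pgf (p n) z - pgf q z = (pgf (p n) z - a) + (a - b) - (pgf q z - b)" by simp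
    also have "norm \<dots> \<le> norm (pgf (p n) z - a) + norm (a - b) + norm (pgf q z - b)"
      by (intro order_trans[OF norm_triangle_ineq4] add_right_mono norm_triangle_ineq)
    also have "\<dots> < e / 4 + e / 4 + e / 4"
    proof (intro add_strict_mono)
      show "norm (pgf (p n) z - a) < e / 4" using seg[of "p n"] conjunct1[OF elim] by (simp add: a_def)
      show "norm (a - b) < e / 4" using conjunct2[OF elim] by (simp add: a_def b_def)
      show "norm (pgf q z - b) < e / 4" using seg[of q] k by (simp add: b_def)
    qed
    also have "\<dots> < e" using e by simp
    finally show ?case .
  qed
  then show "\<exists>no. \<forall>n\<ge>no. norm (pgf (p n) z - pgf q z) < e"
    by (simp add: eventually_sequentially)
qed

text \<open>
  Continuity of the limit at 1 excludes a loss of mass: for \<open>x < 1\<close>, \<open>norm (\<phi> x)\<close> is at most the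
  total mass of the limiting coefficients, and it tends to 1 as \<open>x\<close> does.
\<close>

proposition pgf_continuity:
  fixes p :: "nat \<Rightarrow> nat pmf" and \<phi> :: "complex \<Rightarrow> complex"
  assumes lim: "\<And>z. norm z \<le> 1 \<Longrightarrow> (\<lambda>n. pgf (p n) z) \<longlonglongrightarrow> \<phi> z"
    and cont: "\<And>x. 0 < x \<Longrightarrow> x < 1 \<Longrightarrow> norm (\<phi> (of_real x) - 1) \<le> C * (1 - x)"
  shows "\<exists>q. (\<forall>k. (\<lambda>n. pmf (p n) k) \<longlonglongrightarrow> pmf q k) \<and> (\<forall>z. norm z \<le> 1 \<longrightarrow> pgf q z = \<phi> z)"
proof -
  have "convergent (\<lambda>n. pmf (p n) k)" for k
    by (rule pmf_converges_if_pgf_converges, rule convergentI, rule lim) simp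
  then obtain l where l: "\<And>k. (\<lambda>n. pmf (p n) k) \<longlonglongrightarrow> l k"
    unfolding convergent_def by metis
  have l_nonneg: "0 \<le> l k" for k
    by (rule LIMSEQ_le_const[OF l]) auto
  have l_sum_le: "(\<Sum>j<k. l j) \<le> 1" for k
    by (rule LIMSEQ_le_const2[OF tendsto_sum[OF l]]) (auto intro: sum_pmf_le_1)
  have "summable l"
    by (rule summableI_nonneg_bounded[where x = 1]) (auto simp: l_nonneg l_sum_le)
  have suml: "suminf l \<le> 1" by (rule suminf_le_const[OF \<open>summable l\<close> l_sum_le])
  have phi_le: "norm (\<phi> (of_real x)) \<le> suminf l" if x: "0 < x" "x < 1" for x
  proof -
    have nx: "norm (complex_of_real x) \<le> 1" using x by simp
    have "norm (pgf (p n) (of_real x)) \<le> x ^ k + (\<Sum>j<k. pmf (p n) j)" for n k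
    proof -
      have "norm (pgf (p n) (of_real x) - (\<Sum>j<k. of_real (pmf (p n) j) * of_real x ^ j)) \<le> x ^ k * (1 - (\<Sum>j<k. pmf (p n) j))"
        using x by (intro expectation_pmf_initial_segment) (auto simp: norm_power power_le_one power_decreasing)
      also have "\<dots> \<le> x ^ k * 1" using x by (intro mult_left_mono) (auto simp: sum_nonneg)
      finally have 1: "norm (pgf (p n) (of_real x) - (\<Sum>j<k. of_real (pmf (p n) j) * of_real x ^ j)) \<le> x ^ k" by simp
      have "norm (\<Sum>j<k. of_real (pmf (p n) j) * complex_of_real x ^ j) \<le> (\<Sum>j<k. pmf (p n) j)"
        using x by (intro order_trans[OF norm_sum] sum_mono) (simp add: norm_mult norm_power power_le_one mult_left_le)
      with 1 show ?thesis
        using norm_triangle_sub[of "pgf (p n) (of_real x)" "\<Sum>j<k. of_real (pmf (p n) j) * of_real x ^ j"] by linarith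
    qed
    then have "norm (\<phi> (of_real x)) \<le> x ^ k + (\<Sum>j<k. l j)" for k
      by (intro LIMSEQ_le[OF tendsto_norm[OF lim[OF nx]] tendsto_add[OF tendsto_const tendsto_sum[OF l]]]) auto
    moreover have "(\<lambda>k. x ^ k + (\<Sum>j<k. l j)) \<longlonglongrightarrow> 0 + suminf l"
      using x by (intro tendsto_add LIMSEQ_power_zero summable_LIMSEQ \<open>summable l\<close>) auto
    ultimately show ?thesis
      using LIMSEQ_le_const[of "\<lambda>k. x ^ k + (\<Sum>j<k. l j)" "suminf l" "norm (\<phi> (of_real x))"] by auto
  qed
  have "1 \<le> suminf l"
  proof (rule LIMSEQ_le_const2)
    have "(\<lambda>n. 1 / real (Suc (Suc n))) \<longlonglongrightarrow> 0"
      using LIMSEQ_Suc[OF LIMSEQ_inverse_real_of_nat] by (simp add: inverse_eq_divide del: of_nat_Suc)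
    then have "(\<lambda>n. 1 - C * (1 / real (Suc (Suc n)))) \<longlonglongrightarrow> 1 - C * 0"
      by (intro tendsto_intros)
    then show "(\<lambda>n. 1 - C * (1 / real (Suc (Suc n)))) \<longlonglongrightarrow> 1" by simp
    have "1 - C * (1 / real (Suc (Suc n))) \<le> suminf l" for n
    proof -
      define x where "x = 1 - 1 / real (Suc (Suc n))"
      have x: "0 < x" "x < 1" by (auto simp: x_def field_simps)
      have "1 - norm (\<phi> (of_real x)) \<le> norm (\<phi> (of_real x) - 1)"
        using norm_triangle_ineq2[of 1 "\<phi> (of_real x)"] by (simp add: norm_minus_commute)
      also have "\<dots> \<le> C * (1 - x)" by (rule cont[OF x])
      finally show ?thesis using phi_le[OF x] by (simp add: x_def)
    qed
    then show "\<exists>N. \<forall>n\<ge>N. 1 - C * (1 / real (Suc (Suc n))) \<le> suminf l" by blast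
  qed
  with suml have "suminf l = 1" by simp
  then have "(\<integral>\<^sup>+k. ennreal (l k) \<partial>count_space UNIV) = 1"
    using suminf_ennreal2[OF l_nonneg \<open>summable l\<close>] by (simp add: nn_integral_count_space_nat)
  then have q: "pmf (embed_pmf l) k = l k" for k
    by (intro pmf_embed_pmf l_nonneg)
  define r where "r = embed_pmf l"
  have "(\<lambda>n. pmf (p n) k) \<longlonglongrightarrow> pmf r k" for k using l by (simp add: r_def q)
  moreover have "pgf r z = \<phi> z" if "norm z \<le> 1" for z
    by (rule LIMSEQ_unique[OF pgf_tendsto_of_pmf_tendsto lim]) (use calculation that in auto)
  ultimately show ?thesis by blast
qed

section \<open>Convergence of the infinite product\<close>

locale stable_glue_laws = glue_laws +
  assumes FB_integrable: "integrable FB (\<lambda>b. b)" and FS_integrable: "integrable FS (\<lambda>s. s)"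
    and load: "lam * (LINT b|FB. b) < 1"
begin

definition "\<rho> = lam * (LINT b|FB. b)"
text \<open>
  The derivative of \<open>f\<close> at 1, and a Lipschitz constant of \<open>K\<close> at 1.
\<close>

definition "contraction = stick_prob * \<rho> + (1 - stick_prob)"
definition "K_slope = lam * (LINT s|FS. s) + lam * G * \<rho>"

lemma rho_nonneg: "0 \<le> \<rho>"
  unfolding \<rho>_def using lam_pos FB_nonneg by (intro mult_nonneg_nonneg integral_nonneg_AE) auto

lemma K_slope_nonneg: "0 \<le> K_slope"
  unfolding K_slope_def using lam_pos G_pos rho_nonneg FS_nonneg
  by (intro add_nonneg_nonneg mult_nonneg_nonneg integral_nonneg_AE) auto

lemma contraction_nonneg: "0 \<le> contraction"
  unfolding contraction_def using stick_prob_bounds rho_nonneg by simp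

lemma contraction_less_1: "contraction < 1"
proof -
  have "0 < stick_prob" using nu_pos G_pos by (simp add: stick_prob_def)
  then have "stick_prob * \<rho> < stick_prob * 1"
    using load by (intro mult_strict_left_mono) (simp_all add: \<rho>_def)
  then show ?thesis by (simp add: contraction_def)
qed

lemma norm_one_minus_beta_le:
  assumes z: "norm z \<le> 1" shows "norm (1 - \<beta> z) \<le> \<rho> * norm (1 - z)"
  using norm_one_minus_LST_le[OF FB_prob FB_sets FB_nonneg Re_arg_nonneg[OF z] FB_integrable] lam_pos
  by (simp add: beta_gf_def \<rho>_def norm_mult ac_simps)

lemma norm_one_minus_f_le:
  assumes z: "norm z \<le> 1" shows "norm (1 - f z) \<le> contraction * norm (1 - z)"
proof -
  have "1 - f z = of_real stick_prob * (1 - \<beta> z) + of_real (1 - stick_prob) * (1 - z)"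
    by (simp add: f_gf_eq algebra_simps)
  also have "norm \<dots> \<le> stick_prob * norm (1 - \<beta> z) + (1 - stick_prob) * norm (1 - z)"
    using stick_prob_bounds by (intro norm_triangle_le) (simp add: norm_mult del: of_real_diff)
  also have "\<dots> \<le> stick_prob * (\<rho> * norm (1 - z)) + (1 - stick_prob) * norm (1 - z)"
    using norm_one_minus_beta_le[OF z] stick_prob_bounds by (intro add_right_mono mult_left_mono) auto
  finally show ?thesis by (simp add: contraction_def algebra_simps)
qed

lemma norm_one_minus_iterate_le:
  assumes z: "norm z \<le> 1" shows "norm (1 - (f ^^ n) z) \<le> contraction ^ n * norm (1 - z)"
proof (induction n)
  case (Suc n)
  have "norm (1 - (f ^^ Suc n) z) \<le> contraction * norm (1 - (f ^^ n) z)"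
    using norm_one_minus_f_le[OF norm_iterate_f_le_1[OF z]] by simp
  also have "\<dots> \<le> contraction * (contraction ^ n * norm (1 - z))"
    by (intro mult_left_mono Suc contraction_nonneg)
  finally show ?case by (simp add: mult.assoc)
qed simp

lemma norm_glue_factor:
  assumes z: "norm z \<le> 1"
  shows "norm (exp (- (of_real lam * (1 - \<beta> z) * of_real G))) \<le> 1"
    and "norm (exp (- (of_real lam * (1 - \<beta> z) * of_real G)) - 1) \<le> lam * G * (\<rho> * norm (1 - z))"
proof -
  have "0 \<le> 1 - Re (\<beta> z)" using norm_beta_le_1[OF z] complex_Re_le_cmod[of "\<beta> z"] by simp
  then have re: "Re (- (of_real lam * (1 - \<beta> z) * of_real G)) \<le> 0"
    using lam_pos G_pos by simp
  then show "norm (exp (- (of_real lam * (1 - \<beta> z) * of_real G))) \<le> 1" by simp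
  have "norm (exp (- (of_real lam * (1 - \<beta> z) * of_real G)) - 1) \<le> norm (- (of_real lam * (1 - \<beta> z) * of_real G))"
    by (rule norm_exp_minus_one_le[OF re])
  also have "\<dots> = lam * G * norm (1 - \<beta> z)" using lam_pos G_pos by (simp add: norm_mult)
  also have "\<dots> \<le> lam * G * (\<rho> * norm (1 - z))"
    using lam_pos G_pos by (intro mult_left_mono norm_one_minus_beta_le[OF z]) simp
  finally show "norm (exp (- (of_real lam * (1 - \<beta> z) * of_real G)) - 1) \<le> lam * G * (\<rho> * norm (1 - z))" .
qed

lemma norm_K_le_1: "norm z \<le> 1 \<Longrightarrow> norm (K z) \<le> 1"
  unfolding K_gf_def norm_mult by (intro mult_le_one norm_sigma_le_1 norm_glue_factor) auto

lemma norm_K_minus_1_le: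
  assumes z: "norm z \<le> 1" shows "norm (K z - 1) \<le> K_slope * norm (1 - z)"
proof -
  define E where "E = exp (- (of_real lam * (1 - \<beta> z) * of_real G))"
  have "norm (1 - \<sigma> z) \<le> lam * (LINT s|FS. s) * norm (1 - z)"
    using norm_one_minus_LST_le[OF FS_prob FS_sets FS_nonneg Re_arg_nonneg[OF z] FS_integrable] lam_pos
    by (simp add: sigma_gf_def norm_mult ac_simps)
  moreover have "norm (\<sigma> z * E - 1) \<le> norm ((\<sigma> z - 1) * E) + norm (E - 1)"
    using norm_triangle_ineq[of "(\<sigma> z - 1) * E" "E - 1"] by (simp add: algebra_simps)
  moreover have "norm ((\<sigma> z - 1) * E) \<le> norm (1 - \<sigma> z)"
    using norm_glue_factor(1)[OF z] by (simp add: norm_mult E_def norm_minus_commute mult_left_le)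
  ultimately show ?thesis
    using norm_glue_factor(2)[OF z] by (simp add: K_gf_def K_slope_def E_def algebra_simps)
qed

lemma norm_K_iterate_minus_1_le:
  assumes z: "norm z \<le> 1" shows "norm (K ((f ^^ j) z) - 1) \<le> K_slope * norm (1 - z) * contraction ^ j"
proof -
  have "norm (K ((f ^^ j) z) - 1) \<le> K_slope * norm (1 - (f ^^ j) z)"
    by (rule norm_K_minus_1_le[OF norm_iterate_f_le_1[OF z]])
  also have "\<dots> \<le> K_slope * (contraction ^ j * norm (1 - z))"
    by (intro mult_left_mono norm_one_minus_iterate_le[OF z] K_slope_nonneg)
  finally show ?thesis by (simp add: ac_simps)
qed

definition limit_pgf :: "complex \<Rightarrow> complex" where
  "limit_pgf z = (\<Prod>j. K ((f ^^ j) z))"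

text \<open>
  The factors differ from 1 by a geometric sequence. Individual factors may vanish, which absolute
  convergence allows.
\<close>

lemma K_iterates_has_prod:
  assumes z: "norm z \<le> 1" shows "(\<lambda>j. K ((f ^^ j) z)) has_prod limit_pgf z"
proof -
  have "summable (\<lambda>j. norm (K ((f ^^ j) z) - 1))"
  proof (rule summable_comparison_test')
    show "summable (\<lambda>j. K_slope * norm (1 - z) * contraction ^ j)"
      using contraction_nonneg contraction_less_1 by (intro summable_mult summable_geometric) auto
    show "norm (norm (K ((f ^^ j) z) - 1)) \<le> K_slope * norm (1 - z) * contraction ^ j" for j
      using norm_K_iterate_minus_1_le[OF z] by simp
  qed
  then have "convergent_prod (\<lambda>j. K ((f ^^ j) z))"
    by (intro abs_convergent_prod_imp_convergent_prod) (simp add: abs_convergent_prod_conv_summable)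
  then show ?thesis
    unfolding limit_pgf_def by (rule convergent_prod_has_prod)
qed

lemma norm_limit_pgf_minus_1_le:
  assumes z: "norm z \<le> 1"
  shows "norm (limit_pgf z - 1) \<le> K_slope / (1 - contraction) * norm (1 - z)"
proof (rule LIMSEQ_le_const2)
  show "(\<lambda>n. norm ((\<Prod>j<n. K ((f ^^ j) z)) - 1)) \<longlonglongrightarrow> norm (limit_pgf z - 1)"
    by (intro tendsto_intros has_prod_imp_tendsto' K_iterates_has_prod[OF z])
  have "norm ((\<Prod>j<n. K ((f ^^ j) z)) - 1) \<le> K_slope / (1 - contraction) * norm (1 - z)" for n
  proof -
    have "norm ((\<Prod>j<n. K ((f ^^ j) z)) - (\<Prod>j<n. 1)) \<le> (\<Sum>j<n. norm (K ((f ^^ j) z) - 1))"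
      by (rule norm_prod_diff) (simp_all add: norm_K_le_1 norm_iterate_f_le_1[OF z])
    also have "\<dots> \<le> (\<Sum>j<n. K_slope * norm (1 - z) * contraction ^ j)"
      by (intro sum_mono norm_K_iterate_minus_1_le[OF z])
    also have "\<dots> = K_slope * norm (1 - z) * (\<Sum>j<n. contraction ^ j)"
      by (simp add: sum_distrib_left)
    also have "\<dots> \<le> K_slope * norm (1 - z) * (1 / (1 - contraction))"
    proof (intro mult_left_mono)
      show "(\<Sum>j<n. contraction ^ j) \<le> 1 / (1 - contraction)"
        using contraction_nonneg contraction_less_1
        by (subst suminf_geometric[symmetric]) (auto intro!: sum_le_suminf summable_geometric)
    qed (use K_slope_nonneg in auto)
    finally show ?thesis by (simp add: ac_simps)
  qed
  then show "\<exists>N. \<forall>n\<ge>N. norm ((\<Prod>j<n. K ((f ^^ j) z)) - 1) \<le> K_slope / (1 - contraction) * norm (1 - z)" by blast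
qed

text \<open>
  The initial distribution enters through its generating function at the \<open>n\<close>th iterate of \<open>f\<close>, that
  is, near 1.
\<close>

lemma pgf_chain_tendsto:
  assumes z: "norm z \<le> 1"
  shows "(\<lambda>n. pgf (bind_pmf p (chain n)) z) \<longlonglongrightarrow> limit_pgf z"
proof -
  have "(\<lambda>n. 1 - (f ^^ n) z) \<longlonglongrightarrow> 0"
  proof (rule Lim_null_comparison)
    show "eventually (\<lambda>n. norm (1 - (f ^^ n) z) \<le> contraction ^ n * norm (1 - z)) sequentially"
      by (intro always_eventually allI norm_one_minus_iterate_le[OF z])
    show "(\<lambda>n. contraction ^ n * norm (1 - z)) \<longlonglongrightarrow> 0"
      using contraction_nonneg contraction_less_1 by (intro tendsto_mult_left_zero LIMSEQ_power_zero) simp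
  qed
  from tendsto_diff[OF tendsto_const this, of 1] have iter: "(\<lambda>n. (f ^^ n) z) \<longlonglongrightarrow> 1" by simp
  have "(\<lambda>n. pgf p ((f ^^ n) z)) \<longlonglongrightarrow> measure_pmf.expectation p (\<lambda>k. 1)"
  proof (rule integral_dominated_convergence[where w = "\<lambda>_. 1"])
    show "AE k in measure_pmf p. (\<lambda>n. (f ^^ n) z ^ k) \<longlonglongrightarrow> 1"
      using tendsto_power[OF iter] by simp
    show "AE k in measure_pmf p. norm ((f ^^ n) z ^ k) \<le> 1" for n
      by (simp add: norm_power_le_1 norm_iterate_f_le_1[OF z])
  qed auto
  then have "(\<lambda>n. (\<Prod>j<n. K ((f ^^ j) z)) * pgf p ((f ^^ n) z)) \<longlonglongrightarrow> limit_pgf z * 1"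
    by (intro tendsto_mult has_prod_imp_tendsto' K_iterates_has_prod[OF z]) simp
  moreover have "pgf (bind_pmf p (chain n)) z = (\<Prod>j<n. K ((f ^^ j) z)) * pgf p ((f ^^ n) z)" for n
    by (simp add: expectation_bind_pmf[OF norm_power_le_1[OF z]] pgf_chain[OF z])
  ultimately show ?thesis by simp
qed

proposition chain_limit:
  "\<exists>q. (\<forall>k. (\<lambda>n. pmf (bind_pmf p (chain n)) k) \<longlonglongrightarrow> pmf q k) \<and> (\<forall>z. norm z \<le> 1 \<longrightarrow> pgf q z = limit_pgf z)"
proof (rule pgf_continuity[OF pgf_chain_tendsto])
  fix x :: real assume "0 < x" "x < 1"
  moreover from this have "norm (1 - complex_of_real x) = 1 - x"
    using norm_of_real[where 'a = complex, of "1 - x"] by simp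
  ultimately show "norm (limit_pgf (of_real x) - 1) \<le> K_slope / (1 - contraction) * (1 - x)"
    using norm_limit_pgf_minus_1_le[of "of_real x"] by simp
qed

end

section \<open>The queueing model\<close>

context glue_retrial_queue
begin

abbreviation "source \<equiv> case_random_source (\<lambda>\<omega>. real (X0 \<omega>)) A B V R"

lemma source_measurable: "source s \<in> borel_measurable M"
  using indep unfolding indep_vars_def by auto

lemma measurables [measurable]:
  "A i \<in> borel_measurable M" "B i \<in> borel_measurable M" "V i \<in> borel_measurable M" "R k i \<in> borel_measurable M"
  "(\<lambda>\<omega>. real (X0 \<omega>)) \<in> borel_measurable M"
  using source_measurable[of "Interarrival i"] source_measurable[of "Service i"] source_measurable[of "Vacation i"]
    source_measurable[of "Retrial k i"] source_measurable[of Initial] by simp_all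

lemma X0_measurable [measurable]: "X0 \<in> M \<rightarrow>\<^sub>M count_space UNIV"
proof -
  have "(\<lambda>\<omega>. nat \<lfloor>real (X0 \<omega>)\<rfloor>) \<in> M \<rightarrow>\<^sub>M count_space UNIV" by measurable
  then show ?thesis by simp
qed

lemma distr_exponential:
  assumes "distributed M lborel X (exponential_density r)"
  shows "distr M borel X = expm r"
proof -
  have "distr M borel X = distr M lborel X" by (rule distr_cong) auto
  then show ?thesis using distributed_distr_eq_density[OF assms] by simp
qed

sublocale glue_laws lam \<nu> G FB FS
proof (rule glue_laws.intro)
  show "prob_space FB" using prob_space_distr[of "B 0" borel] B_distr[of 0] by simp
  show "prob_space FS" using prob_space_distr[of "V 0" borel] V_distr[of 0] by simp
  show "sets FB = sets borel" using B_distr[of 0] by (metis sets_distr)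
  show "sets FS = sets borel" using V_distr[of 0] by (metis sets_distr)
qed (use lam_pos nu_pos G_pos FB_nonneg FS_nonneg in auto)

definition X0_law :: "real measure" where "X0_law = distr M borel (\<lambda>\<omega>. real (X0 \<omega>))"

definition source_law :: "random_source \<Rightarrow> real measure" where
  "source_law = case_random_source X0_law (\<lambda>_. expm lam) (\<lambda>_. FB) (\<lambda>_. FS) (\<lambda>_ _. expm \<nu>)"

lemma source_law: "distr M borel (source s) = source_law s"
  by (cases s) (simp_all add: source_law_def X0_law_def distr_exponential[OF A_distr] distr_exponential[OF R_distr] B_distr V_distr)

lemma prob_space_source_law: "prob_space (source_law s)"
  unfolding source_law[symmetric] by (rule prob_space_distr[OF source_measurable])

lemma sets_source_law [measurable_cong]: "sets (source_law s) = sets borel"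
  unfolding source_law[symmetric] by simp

lemma sets_X0_law [measurable_cong]: "sets X0_law = sets borel"
  by (simp add: X0_law_def)

lemma distr_sources:
  "distr M (PiM UNIV (\<lambda>_. borel)) (\<lambda>\<omega> s. source s \<omega>) = PiM UNIV source_law"
  using indep_vars_iff_distr_eq_PiM[THEN iffD1, OF _ _ indep] source_measurable
  by (simp add: source_law restrict_def)

text \<open>
  Finite sets of sources that exhaust all sources and are products along the five families.
\<close>

definition source_box :: "nat \<Rightarrow> random_source set" where
  "source_box m = {Initial} \<union> Interarrival ` {..<m} \<union> Service ` {..<m} \<union> Vacation ` {..<m} \<union> case_prod Retrial ` ({..<m} \<times> {..<m})"

lemma finite_subset_source_box:
  assumes "finite J" shows "\<exists>m. J \<subseteq> source_box m"
proof -
  define h where "h = case_random_source (0::nat) (\<lambda>i. i) (\<lambda>i. i) (\<lambda>i. i) (\<lambda>k i. max k i)"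
  have "s \<in> source_box m" if "h s < m" for s m
    using that by (cases s) (auto simp: source_box_def h_def)
  moreover obtain m where "\<forall>s\<in>J. h s < m"
    using finite_nat_set_iff_bounded[of "h ` J"] assms by auto
  ultimately show ?thesis by blast
qed

lemma prod_source_box:
  fixes g :: "random_source \<Rightarrow> 'z::comm_monoid_mult"
  shows "(\<Prod>s\<in>source_box m. g s) = g Initial * ((\<Prod>i<m. g (Vacation i)) * ((\<Prod>i<m. g (Service i)) *
    ((\<Prod>i<m. g (Interarrival i)) * (\<Prod>k<m. \<Prod>i<m. g (Retrial k i)))))"
proof -
  have inj: "inj_on (case_prod Retrial) ({..<m} \<times> {..<m})" by (auto simp: inj_on_def)
  have "(\<Prod>s\<in>source_box m. g s) = g Initial * (\<Prod>s\<in>Interarrival ` {..<m}. g s) * (\<Prod>s\<in>Service ` {..<m}. g s) *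
     (\<Prod>s\<in>Vacation ` {..<m}. g s) * (\<Prod>s\<in>case_prod Retrial ` ({..<m} \<times> {..<m}). g s)"
    unfolding source_box_def by (subst prod.union_disjoint, simp, simp, force)+ simp
  also have "(\<Prod>s\<in>Interarrival ` {..<m}. g s) = (\<Prod>i<m. g (Interarrival i))"
    by (subst prod.reindex) (auto simp: inj_on_def)
  also have "(\<Prod>s\<in>Service ` {..<m}. g s) = (\<Prod>i<m. g (Service i))"
    by (subst prod.reindex) (auto simp: inj_on_def)
  also have "(\<Prod>s\<in>Vacation ` {..<m}. g s) = (\<Prod>i<m. g (Vacation i))"
    by (subst prod.reindex) (auto simp: inj_on_def)
  also have "(\<Prod>s\<in>case_prod Retrial ` ({..<m} \<times> {..<m}). g s) = (\<Prod>k<m. \<Prod>i<m. g (Retrial k i))"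
    by (subst prod.reindex[OF inj]) (simp add: prod.cartesian_product split_beta')
  finally show ?thesis by (simp add: ac_simps)
qed

lemma Ball_source_box:
  "(\<forall>s\<in>source_box m. P s) \<longleftrightarrow> P Initial \<and> (\<forall>i<m. P (Vacation i)) \<and> (\<forall>i<m. P (Service i)) \<and>
    (\<forall>i<m. P (Interarrival i)) \<and> (\<forall>k<m. \<forall>i<m. P (Retrial k i))"
  unfolding source_box_def ball_Un by auto

lemma emeasure_iid_cylinder:
  assumes N: "prob_space N" and X: "\<And>i. X i \<in> sets N"
  shows "emeasure (iid N) {u \<in> space (iid N). \<forall>i<m. u i \<in> X i} = (\<Prod>i<m. emeasure N (X i))"
    and "{u \<in> space (iid N). \<forall>i<m. u i \<in> X i} \<in> sets (iid N)"
proof -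
  interpret N: prob_space N by fact
  interpret P: product_prob_space "\<lambda>_. N" "UNIV :: nat set" ..
  have "emeasure (iid N) {u \<in> space (iid N). \<forall>i\<in>{..<m}. u i \<in> X i} = (\<Prod>i<m. emeasure N (X i))"
    using X by (intro P.emeasure_PiM_Collect) auto
  then show "emeasure (iid N) {u \<in> space (iid N). \<forall>i<m. u i \<in> X i} = (\<Prod>i<m. emeasure N (X i))"
    by (simp only: Ball_def lessThan_iff)
  note X[measurable]
  show "{u \<in> space (iid N). \<forall>i<m. u i \<in> X i} \<in> sets (iid N)" by measurable
qed

abbreviation join_sources :: "real \<times> (nat \<Rightarrow> real) \<times> (nat \<Rightarrow> real) \<times> (nat \<Rightarrow> real) \<times> (nat \<Rightarrow> nat \<Rightarrow> real) \<Rightarrow> random_source \<Rightarrow> real" where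
  "join_sources \<equiv> \<lambda>(x, V, B, A, R). case_random_source x A B V R"

lemma join_sources_measurable [measurable]:
  "join_sources \<in> X0_law \<Otimes>\<^sub>M (PV \<Otimes>\<^sub>M (PB \<Otimes>\<^sub>M (PA \<Otimes>\<^sub>M PR))) \<rightarrow>\<^sub>M PiM UNIV (\<lambda>_. borel)"
proof (rule measurable_PiM_single')
  fix s show "(\<lambda>\<omega>. join_sources \<omega> s) \<in> X0_law \<Otimes>\<^sub>M (PV \<Otimes>\<^sub>M (PB \<Otimes>\<^sub>M (PA \<Otimes>\<^sub>M PR))) \<rightarrow>\<^sub>M borel"
  proof (cases s)
    case (Retrial k i)
    have "(\<lambda>\<omega>. snd (snd (snd (snd \<omega>))) k i) \<in> X0_law \<Otimes>\<^sub>M (PV \<Otimes>\<^sub>M (PB \<Otimes>\<^sub>M (PA \<Otimes>\<^sub>M PR))) \<rightarrow>\<^sub>M borel"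
    proof -
      have "(\<lambda>\<omega>. snd (snd (snd (snd \<omega>)))) \<in> X0_law \<Otimes>\<^sub>M (PV \<Otimes>\<^sub>M (PB \<Otimes>\<^sub>M (PA \<Otimes>\<^sub>M PR))) \<rightarrow>\<^sub>M iid (iid borel)"
        by measurable
      from measurable_compose[OF measurable_compose[OF this measurable_component_singleton[of k]]
          measurable_component_singleton[of i]]
      show ?thesis by simp
    qed
    then show ?thesis by (simp add: Retrial split_beta')
  qed (simp_all add: split_beta')
qed (auto simp: space_PiM)

text \<open>
  The joint law of all sources, a product over the type \<open>random_source\<close>, regrouped into an iterated
  product so that the sources can be integrated one after the other. Both sides agree on cylinders,
  and every cylinder can be based on a \<open>source_box\<close> if the superfluous coordinates are unrestricted.
\<close>

lemma PiM_sources_eq: "distr (X0_law \<Otimes>\<^sub>M (PV \<Otimes>\<^sub>M (PB \<Otimes>\<^sub>M (PA \<Otimes>\<^sub>M PR)))) (PiM UNIV (\<lambda>_. borel)) join_sources = PiM UNIV source_law"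
proof -
  interpret X: prob_space X0_law unfolding X0_law_def by (rule prob_space_distr) measurable
  interpret AR: pair_prob_space PA PR ..
  interpret BAR: pair_prob_space PB "PA \<Otimes>\<^sub>M PR" ..
  interpret VBAR: pair_prob_space PV "PB \<Otimes>\<^sub>M (PA \<Otimes>\<^sub>M PR)" ..
  interpret S: product_prob_space source_law UNIV
    by (intro product_prob_spaceI prob_space_source_law)
  let ?P = "X0_law \<Otimes>\<^sub>M (PV \<Otimes>\<^sub>M (PB \<Otimes>\<^sub>M (PA \<Otimes>\<^sub>M PR)))"
  have sets_eq: "sets (PiM UNIV source_law) = sets (PiM UNIV (\<lambda>_. borel))"
    by (intro sets_PiM_cong) (auto simp: sets_source_law)
  show ?thesis
  proof (rule S.PiM_eq)
    fix J X assume J: "finite J" "J \<subseteq> (UNIV :: random_source set)" and X: "\<And>s. s \<in> J \<Longrightarrow> X s \<in> sets (source_law s)"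
    obtain m where m: "J \<subseteq> source_box m" using finite_subset_source_box[OF J(1)] by blast
    \<comment> \<open>The cylinder, based on a source box that contains \<open>J\<close>.\<close>
    define Y where "Y s = (if s \<in> J then X s else UNIV)" for s
    have Y: "Y s \<in> sets borel" for s using X[of s] sets_source_law[of s] by (auto simp: Y_def)
    let ?E = "prod_emb UNIV source_law J (Pi\<^sub>E J X)"
    have "(\<forall>s\<in>source_box m. u s \<in> Y s) \<longleftrightarrow> (\<forall>s\<in>J. u s \<in> X s)" for u
      using m unfolding Y_def by (metis UNIV_I subsetD)
    then have E: "?E = {u. \<forall>s\<in>source_box m. u s \<in> Y s}"
      using sets_eq_imp_space_eq[OF sets_source_law] by (auto simp: prod_emb_def space_PiM)
    have E_sets: "?E \<in> sets (PiM UNIV (\<lambda>_. borel))"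
      unfolding sets_eq[symmetric] using J X by (intro sets_PiM_I) auto
    define W where "W C N = {u \<in> space (iid N). \<forall>i<m. u i \<in> Y (C i)}" for C and N :: "real measure"
    define WR where "WR = {R \<in> space PR. \<forall>k<m. R k \<in> W (Retrial k) (expm \<nu>)}"
    note cyl = emeasure_iid_cylinder
    have W: "emeasure (iid N) (W C N) = (\<Prod>i<m. emeasure N (Y (C i)))" "W C N \<in> sets (iid N)"
      if "prob_space N" "sets N = sets borel" for C N
      unfolding W_def using that Y by (intro cyl; simp)+
    note eE = prob_space_expm[OF nu_pos] and eA = prob_space_expm[OF lam_pos]
    have WR: "emeasure PR WR = (\<Prod>k<m. \<Prod>i<m. emeasure (expm \<nu>) (Y (Retrial k i)))" "WR \<in> sets PR"
      unfolding WR_def using cyl[OF prob_space_iid[OF eE], of "\<lambda>k. W (Retrial k) (expm \<nu>)" m] W[OF eE] by simp_all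
    have pre: "join_sources -` ?E \<inter> space ?P =
      Y Initial \<times> (W Vacation FS \<times> (W Service FB \<times> (W Interarrival (expm lam) \<times> WR)))"
      unfolding E Ball_source_box W_def WR_def
      by (auto simp: space_pair_measure space_PiM sets_eq_imp_space_eq[OF FB_sets] sets_eq_imp_space_eq[OF FS_sets]
          sets_eq_imp_space_eq[OF sets_X0_law])
    have "emeasure (distr ?P (PiM UNIV (\<lambda>_. borel)) join_sources) ?E = emeasure ?P (join_sources -` ?E \<inter> space ?P)"
      using E_sets by (intro emeasure_distr) measurable
    also have "\<dots> = emeasure X0_law (Y Initial) * (emeasure PV (W Vacation FS) * (emeasure PB (W Service FB) *
        (emeasure PA (W Interarrival (expm lam)) * emeasure PR WR)))"
      unfolding pre using W(2)[OF FB_prob FB_sets] W(2)[OF FS_prob FS_sets] W(2)[OF eA] WR(2) Y[of Initial]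
      by (simp add: VBAR.P.emeasure_pair_measure_Times BAR.P.emeasure_pair_measure_Times AR.P.emeasure_pair_measure_Times
          R.emeasure_pair_measure_Times sets_X0_law)
    also have "\<dots> = (\<Prod>s\<in>source_box m. emeasure (source_law s) (Y s))"
      unfolding prod_source_box using W(1)[OF FB_prob FB_sets] W(1)[OF FS_prob FS_sets] W(1)[OF eA] WR(1)
      by (simp add: source_law_def)
    also have "\<dots> = (\<Prod>s\<in>J. emeasure (source_law s) (X s))"
    proof (rule prod.mono_neutral_cong_right)
      show "finite (source_box m)" by (simp add: source_box_def)
      show "\<forall>s\<in>source_box m - J. emeasure (source_law s) (Y s) = 1"
        using prob_space.emeasure_space_1[OF prob_space_source_law] sets_eq_imp_space_eq[OF sets_source_law]
        by (simp add: Y_def)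
    qed (use m in \<open>auto simp: Y_def\<close>)
    finally show "emeasure (distr ?P (PiM UNIV (\<lambda>_. borel)) join_sources) ?E = (\<Prod>s\<in>J. emeasure (source_law s) (X s))" .
  qed (simp add: sets_eq)
qed

lemma nn_integral_sources:
  assumes F[measurable]: "F \<in> borel_measurable (PiM UNIV (\<lambda>_. borel))"
  shows "(\<integral>\<^sup>+\<omega>. F (\<lambda>s. source s \<omega>) \<partial>M) =
    (\<integral>\<^sup>+x. \<integral>\<^sup>+V. \<integral>\<^sup>+B. \<integral>\<^sup>+A. \<integral>\<^sup>+R. F (case_random_source x A B V R) \<partial>PR \<partial>PA \<partial>PB \<partial>PV \<partial>X0_law)"
proof -
  interpret X: prob_space X0_law unfolding X0_law_def by (rule prob_space_distr) measurable
  interpret AR: pair_prob_space PA PR ..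
  interpret BAR: pair_prob_space PB "PA \<Otimes>\<^sub>M PR" ..
  interpret VBAR: pair_prob_space PV "PB \<Otimes>\<^sub>M (PA \<Otimes>\<^sub>M PR)" ..
  let ?P = "X0_law \<Otimes>\<^sub>M (PV \<Otimes>\<^sub>M (PB \<Otimes>\<^sub>M (PA \<Otimes>\<^sub>M PR)))"
  have [measurable]: "(\<lambda>\<omega> s. source s \<omega>) \<in> M \<rightarrow>\<^sub>M PiM UNIV (\<lambda>_. borel)"
    by (rule measurable_PiM_single') (auto simp: source_measurable space_PiM)
  define H where "H p = F (join_sources p)" for p
  have [measurable]: "H \<in> borel_measurable ?P" unfolding H_def by measurable
  have "(\<integral>\<^sup>+\<omega>. F (\<lambda>s. source s \<omega>) \<partial>M) = (\<integral>\<^sup>+u. F u \<partial>distr M (PiM UNIV (\<lambda>_. borel)) (\<lambda>\<omega> s. source s \<omega>))"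
    by (rule nn_integral_distr[symmetric]) measurable
  also have "\<dots> = (\<integral>\<^sup>+u. F u \<partial>distr ?P (PiM UNIV (\<lambda>_. borel)) join_sources)"
    by (simp only: distr_sources PiM_sources_eq)
  also have "\<dots> = (\<integral>\<^sup>+p. H p \<partial>?P)"
    unfolding H_def by (rule nn_integral_distr) measurable
  also have "\<dots> = (\<integral>\<^sup>+x. \<integral>\<^sup>+V. \<integral>\<^sup>+B. \<integral>\<^sup>+A. \<integral>\<^sup>+R. H (x, V, B, A, R) \<partial>PR \<partial>PA \<partial>PB \<partial>PV \<partial>X0_law)"
  proof -
    have [measurable]: "H \<in> borel_measurable (borel \<Otimes>\<^sub>M (iid borel \<Otimes>\<^sub>M (iid borel \<Otimes>\<^sub>M (iid borel \<Otimes>\<^sub>M iid (iid borel)))))"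
      by measurable
    have "(\<integral>\<^sup>+p. H p \<partial>?P) = (\<integral>\<^sup>+x. \<integral>\<^sup>+p. H (x, p) \<partial>(PV \<Otimes>\<^sub>M (PB \<Otimes>\<^sub>M (PA \<Otimes>\<^sub>M PR))) \<partial>X0_law)"
      by (rule VBAR.P.nn_integral_fst[symmetric]) measurable
    also have "\<dots> = (\<integral>\<^sup>+x. \<integral>\<^sup>+V. \<integral>\<^sup>+p. H (x, V, p) \<partial>(PB \<Otimes>\<^sub>M (PA \<Otimes>\<^sub>M PR)) \<partial>PV \<partial>X0_law)"
      by (intro nn_integral_cong BAR.P.nn_integral_fst[symmetric]) measurable
    also have "\<dots> = (\<integral>\<^sup>+x. \<integral>\<^sup>+V. \<integral>\<^sup>+B. \<integral>\<^sup>+p. H (x, V, B, p) \<partial>(PA \<Otimes>\<^sub>M PR) \<partial>PB \<partial>PV \<partial>X0_law)"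
      by (intro nn_integral_cong AR.P.nn_integral_fst[symmetric]) measurable
    also have "\<dots> = (\<integral>\<^sup>+x. \<integral>\<^sup>+V. \<integral>\<^sup>+B. \<integral>\<^sup>+A. \<integral>\<^sup>+R. H (x, V, B, A, R) \<partial>PR \<partial>PA \<partial>PB \<partial>PV \<partial>X0_law)"
      by (intro nn_integral_cong R.nn_integral_fst[symmetric]) measurable
    finally show ?thesis .
  qed
  finally show ?thesis by (simp add: H_def)
qed

lemma orbit_size_sources_measurable:
  "(\<lambda>u. orbit_size G (nat \<lfloor>u Initial\<rfloor>) {} (\<lambda>i. u (Interarrival i)) (\<lambda>k. u (Service k)) (\<lambda>j. u (Vacation j))
     (\<lambda>k i. u (Retrial k i)) n) \<in> PiM UNIV (\<lambda>_. borel :: real measure) \<rightarrow>\<^sub>M count_space UNIV"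
proof (rule orbit_size_measurable)
  show "(\<lambda>u. \<lambda>i. u (Interarrival i)) \<in> PiM UNIV (\<lambda>_. borel) \<rightarrow>\<^sub>M iid (borel :: real measure)"
    by (rule measurable_PiM_single') (auto simp: space_PiM)
  show "(\<lambda>u. \<lambda>i. u (Service i)) \<in> PiM UNIV (\<lambda>_. borel) \<rightarrow>\<^sub>M iid (borel :: real measure)"
    by (rule measurable_PiM_single') (auto simp: space_PiM)
  show "(\<lambda>u. \<lambda>i. u (Vacation i)) \<in> PiM UNIV (\<lambda>_. borel) \<rightarrow>\<^sub>M iid (borel :: real measure)"
    by (rule measurable_PiM_single') (auto simp: space_PiM)
  show "(\<lambda>u. \<lambda>k i. u (Retrial k i)) \<in> PiM UNIV (\<lambda>_. borel) \<rightarrow>\<^sub>M iid (iid (borel :: real measure))"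
  proof (rule measurable_PiM_single')
    fix k
    show "(\<lambda>u. \<lambda>i. u (Retrial k i)) \<in> PiM UNIV (\<lambda>_. borel) \<rightarrow>\<^sub>M iid (borel :: real measure)"
      by (rule measurable_PiM_single') (auto simp: space_PiM)
  qed (auto simp: space_PiM)
qed measurable

definition initial_pmf :: "nat pmf" where
  "initial_pmf = embed_pmf (\<lambda>k. prob {\<omega> \<in> space M. X0 \<omega> = k})"

lemma nn_integral_X0:
  fixes g :: "nat \<Rightarrow> ennreal"
  shows "(\<integral>\<^sup>+\<omega>. g (X0 \<omega>) \<partial>M) = (\<Sum>k. ennreal (prob {\<omega> \<in> space M. X0 \<omega> = k}) * g k)"
proof -
  have "(\<integral>\<^sup>+\<omega>. g (X0 \<omega>) \<partial>M) = (\<integral>\<^sup>+\<omega>. (\<Sum>k. g k * indicator {\<omega> \<in> space M. X0 \<omega> = k} \<omega>) \<partial>M)"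
  proof (rule nn_integral_cong)
    fix \<omega> assume \<omega>: "\<omega> \<in> space M"
    have "(\<Sum>k. g k * indicator {\<omega> \<in> space M. X0 \<omega> = k} \<omega>) = (\<Sum>k\<in>{X0 \<omega>}. g k * indicator {\<omega> \<in> space M. X0 \<omega> = k} \<omega>)"
      by (rule suminf_finite) auto
    then show "g (X0 \<omega>) = (\<Sum>k. g k * indicator {\<omega> \<in> space M. X0 \<omega> = k} \<omega>)" using \<omega> by simp
  qed
  also have "\<dots> = (\<Sum>k. \<integral>\<^sup>+\<omega>. g k * indicator {\<omega> \<in> space M. X0 \<omega> = k} \<omega> \<partial>M)"
    by (rule nn_integral_suminf) measurable
  also have "\<dots> = (\<Sum>k. ennreal (prob {\<omega> \<in> space M. X0 \<omega> = k}) * g k)"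
    by (intro suminf_cong, subst nn_integral_cmult_indicator) (auto simp: emeasure_eq_measure mult.commute)
  finally show ?thesis .
qed

lemma pmf_initial: "pmf initial_pmf k = prob {\<omega> \<in> space M. X0 \<omega> = k}"
  unfolding initial_pmf_def
proof (rule pmf_embed_pmf)
  show "(\<integral>\<^sup>+k. ennreal (prob {\<omega> \<in> space M. X0 \<omega> = k}) \<partial>count_space UNIV) = 1"
    using nn_integral_X0[of "\<lambda>_. 1"] by (simp add: nn_integral_count_space_nat emeasure_space_1)
qed simp

text \<open>
  The path is a function of independent sources, so that the law of the number in orbit is the mixture
  of the laws \<open>orbit_prob\<close> over the initial number.
\<close>

proposition X_glue_law:
  "prob {\<omega> \<in> space M. X_glue G X0 A B V R n \<omega> = k} = pmf (bind_pmf initial_pmf (chain n)) k"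
proof -
  \<comment> \<open>The source \<open>Initial\<close> carries \<open>X0\<close> as a real number, which \<open>nat\<close> and the floor undo.\<close>
  define N where "N u = orbit_size G (nat \<lfloor>u Initial\<rfloor>) {} (\<lambda>i. u (Interarrival i)) (\<lambda>k. u (Service k))
      (\<lambda>j. u (Vacation j)) (\<lambda>k i. u (Retrial k i)) n" for u :: "random_source \<Rightarrow> real"
  have N_meas[measurable]: "N \<in> PiM UNIV (\<lambda>_. borel) \<rightarrow>\<^sub>M count_space UNIV"
    unfolding N_def by (rule orbit_size_sources_measurable)
  have X: "X_glue G X0 A B V R n \<omega> = N (\<lambda>s. source s \<omega>)" for \<omega>
    by (simp add: X_glue_def number_at_glue_eq N_def)
  have [measurable]: "(\<lambda>\<omega> s. source s \<omega>) \<in> M \<rightarrow>\<^sub>M PiM UNIV (\<lambda>_. borel)"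
    by (rule measurable_PiM_single') (auto simp: source_measurable space_PiM)
  have [measurable]: "(\<lambda>x::real. orbit_prob n k {} (nat \<lfloor>x\<rfloor>)) \<in> borel_measurable borel"
  proof -
    have "(\<lambda>x::real. nat \<lfloor>x\<rfloor>) \<in> borel \<rightarrow>\<^sub>M count_space UNIV" by measurable
    from measurable_compose[OF this, of "orbit_prob n k {}" borel] show ?thesis by simp
  qed
  have "ennreal (prob {\<omega> \<in> space M. X_glue G X0 A B V R n \<omega> = k}) =
    (\<integral>\<^sup>+\<omega>. indicator {\<omega> \<in> space M. N (\<lambda>s. source s \<omega>) = k} \<omega> \<partial>M)"
    unfolding X by (subst nn_integral_indicator) (auto simp: emeasure_eq_measure)
  also have "\<dots> = (\<integral>\<^sup>+\<omega>. (if N (\<lambda>s. source s \<omega>) = k then 1 else 0) \<partial>M)"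
    by (intro nn_integral_cong) (auto simp: indicator_def)
  also have "\<dots> = (\<integral>\<^sup>+x. orbit_prob n k {} (nat \<lfloor>x\<rfloor>) \<partial>X0_law)"
  proof -
    have "(\<lambda>u. if N u = k then 1 else 0 :: ennreal) \<in> borel_measurable (PiM UNIV (\<lambda>_. borel))"
      by measurable
    from nn_integral_sources[OF this] show ?thesis
      by (simp add: N_def orbit_prob_def size_indicator_def)
  qed
  also have "\<dots> = (\<integral>\<^sup>+\<omega>. orbit_prob n k {} (X0 \<omega>) \<partial>M)"
    unfolding X0_law_def by (subst nn_integral_distr) auto
  also have "\<dots> = (\<integral>\<^sup>+\<omega>. ennreal (pmf (chain n (X0 \<omega>)) k) \<partial>M)"
    by (simp add: orbit_prob_eq_chain)
  also have "\<dots> = ennreal (pmf (bind_pmf initial_pmf (chain n)) k)"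
    unfolding nn_integral_X0[of "\<lambda>x. ennreal (pmf (chain n x) k)"] ennreal_pmf_bind nn_integral_pmf_nat pmf_initial ..
  finally show ?thesis by simp
qed

end

theorem theorem1:
  fixes M :: "'a measure"
    and lam \<nu> G :: real
    and FB FS :: "real measure"
    and X0 :: "'a \<Rightarrow> nat"
    and A B V :: "nat \<Rightarrow> 'a \<Rightarrow> real"
    and R :: "nat \<Rightarrow> nat \<Rightarrow> 'a \<Rightarrow> real"
  assumes model: "glue_retrial_queue M lam \<nu> G FB FS X0 A B V R"
    and rho: "lam * (LINT b|FB. b) < 1"
  shows "\<exists>p :: nat pmf.
           limiting_distribution M (X_glue G X0 A B V R) p \<and>
           (\<forall>z::complex. norm z \<le> 1 \<longrightarrow>
              (\<lambda>j. K_gf lam G FB FS ((f_gf lam \<nu> G FB ^^ j) z))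
                has_prod measure_pmf.expectation p (\<lambda>k. z ^ k))"
proof -
  interpret glue_retrial_queue M lam \<nu> G FB FS X0 A B V R by (rule model)
  interpret stable_glue_laws lam \<nu> G FB FS
    by unfold_locales (fact FB_integrable FS_integrable rho)+
  obtain q where "\<forall>k. (\<lambda>n. pmf (bind_pmf initial_pmf (chain n)) k) \<longlonglongrightarrow> pmf q k"
    and "\<forall>z. norm z \<le> 1 \<longrightarrow> pgf q z = limit_pgf z"
    using chain_limit by blast
  then show ?thesis
    using K_iterates_has_prod
    by (intro exI[of _ q]) (auto simp: limiting_distribution_def X_glue_law)
qed

end
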